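(* The formula $$\Delta(D)=\sum_{C\subset\mathcal{C}(D)}(-1)^{k_C(D)}\,q_C(D)\otimes r_C(D),$$ for $D$ a dissection diagram, extended to $\Delta:\mathcal{D}\to\mathcal{D}\otimes\mathcal{D}$ as a morphism of algebras, gives $\mathcal{D}$ the structure of a graded connected commutative Hopf algebra.
   Context: For $n\ge 0$, $\Pi_n$ is an oriented polygon (drawn as a circle, so that $\Pi_0,\Pi_1$ make sense) with $n+1$ vertices, one of which is called the root; the others are labelled $1,\dots,n$ following the orientation, $1$ being just after the root. Its $n+1$ sides (arcs between consecutive vertices, directed following the orientation) are labelled $0,\dots,n$: side $0$ (the root side) leaves the root and side $i$ leaves vertex $i$ for $1\le i\le n$. Write $\mathcal{S}=\{0,\dots,n\}$, $\mathcal{S}^+=\{1,\dots,n\}$. A chord is a straight line between two distinct vertices (never identified with a side). A dissection diagram $D$ of degree $n$ is a set of $n$ chords of $\Pi_n$ not crossing each other (common endpoints allowed) such that the graph formed by the chords is acyclic; it is then a spanning tree on the vertices. Chords are directed towards the root, and the chord leaving vertex $i$ is labelled $i$, so the set of chords is $\mathcal{C}(D)=\{1,\dots,n\}$. $\mathcal{D}$ is the free commutative unital $\mathbb{Q}$-algebra on the set of dissection diagrams of positive degree, graded by the degree; the dissection diagram of degree $0$ is identified with the unit $1$. Let $C\subset\mathcal{C}(D)$, $\overline{C}=\mathcal{C}(D)\setminus C$. The planar graph formed by $C$ and all sides has $|C|+1$ faces $\alpha$, each the interior of a polygon $\widetilde{\Pi}(\alpha)$. Let $\mathcal{S}_C(\alpha)$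 be the (nonempty) set of sides of $\Pi_n$ bounding $\alpha$, $\overline{C}(\alpha)$ the set of chords of $\overline{C}$ inside $\widetilde{\Pi}(\alpha)$, $\mathcal{S}_C^+(\alpha)=\mathcal{S}_C(\alpha)\setminus\{\min\mathcal{S}_C(\alpha)\}$ and $\mathcal{S}_C^+=\bigsqcup_\alpha\mathcal{S}_C^+(\alpha)$. The dissection diagram $q_C^\alpha(D)$ is obtained by contracting all sides of $\widetilde{\Pi}(\alpha)$ that are chords of $C$: it lives in the resulting polygon, whose sides are $\mathcal{S}_C(\alpha)$, its root side is $\min\mathcal{S}_C(\alpha)$, its root is the starting vertex of that side, and its chords are $\overline{C}(\alpha)$; its degree is $|\overline{C}(\alpha)|=|\mathcal{S}_C^+(\alpha)|$. Put $q_C(D)=\prod_\alpha q_C^\alpha(D)\in\mathcal{D}$. The dissection diagram $r_C(D)$ of degree $|C|$ is obtained by keeping only the chords of $C$ and contracting the sides in $\mathcal{S}_C^+$; its root is the image of the root, its chords are $C$ and its non-root sides are $\mathcal{S}^+\setminus\mathcal{S}_C^+$. $k_C(D)$ is the number of chords of $C$ whose direction in $r_C(D)$ (towards its root) is opposite to their direction in $D$. *)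

theory Defs
  imports Complex_Main "HOL-Library.Multiset" "HOL-Library.Poly_Mapping" "HOL-Library.Product_Plus"
begin

section \<open>Monoid algebras over the rationals and Hopf algebra structures on them\<close>

text \<open>
  The type \<open>'m \<Rightarrow>\<^sub>0 rat\<close> is the free rational vector space on \<open>'m\<close>; if \<open>'m\<close> is a commutative
  monoid (written additively), its multiplication is that of the monoid algebra. In particular
  \<open>'a multiset \<Rightarrow>\<^sub>0 rat\<close> is the free commutative unital algebra on the set \<open>'a\<close>.
  The tensor product of the free vector spaces on \<open>'a\<close> and \<open>'b\<close> is the free vector space on
  \<open>'a \<times> 'b\<close>; for monoids, the multiplication of the monoid algebra of the product monoid is
  the usual one, \<open>(a \<otimes> b) * (c \<otimes> d) = (a * c) \<otimes> (b * d)\<close>.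
\<close>

definition scale :: "rat \<Rightarrow> ('m \<Rightarrow>\<^sub>0 rat) \<Rightarrow> ('m \<Rightarrow>\<^sub>0 rat)" (infixr "*\<^sub>s" 75)
  where "c *\<^sub>s p = Poly_Mapping.map ((*) c) p"

definition tensor :: "('a \<Rightarrow>\<^sub>0 rat) \<Rightarrow> ('b \<Rightarrow>\<^sub>0 rat) \<Rightarrow> ('a \<times> 'b \<Rightarrow>\<^sub>0 rat)" (infixr "\<otimes>" 72)
  where "a \<otimes> b = (\<Sum>x\<in>Poly_Mapping.keys a. \<Sum>y\<in>Poly_Mapping.keys b. Poly_Mapping.single (x, y) (Poly_Mapping.lookup a x * Poly_Mapping.lookup b y))"

text \<open>The linear map on the tensor product that is induced by a bilinear map \<open>f\<close>.\<close>

definition tensor_lift ::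
    "(('a \<Rightarrow>\<^sub>0 rat) \<Rightarrow> ('b \<Rightarrow>\<^sub>0 rat) \<Rightarrow> ('c \<Rightarrow>\<^sub>0 rat)) \<Rightarrow> ('a \<times> 'b \<Rightarrow>\<^sub>0 rat) \<Rightarrow> ('c \<Rightarrow>\<^sub>0 rat)"
  where "tensor_lift f t =
    (\<Sum>(x, y)\<in>Poly_Mapping.keys t. Poly_Mapping.lookup t (x, y) *\<^sub>s f (Poly_Mapping.single x 1) (Poly_Mapping.single y 1))"

definition tensor_map ::
    "(('a \<Rightarrow>\<^sub>0 rat) \<Rightarrow> ('c \<Rightarrow>\<^sub>0 rat)) \<Rightarrow> (('b \<Rightarrow>\<^sub>0 rat) \<Rightarrow> ('d \<Rightarrow>\<^sub>0 rat)) \<Rightarrow>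
      ('a \<times> 'b \<Rightarrow>\<^sub>0 rat) \<Rightarrow> ('c \<times> 'd \<Rightarrow>\<^sub>0 rat)"
  where "tensor_map f g = tensor_lift (\<lambda>a b. f a \<otimes> g b)"

definition tensor_assoc :: "(('a \<times> 'b) \<times> 'c \<Rightarrow>\<^sub>0 rat) \<Rightarrow> ('a \<times> ('b \<times> 'c) \<Rightarrow>\<^sub>0 rat)"
  where "tensor_assoc = tensor_lift (\<lambda>t c. tensor_lift (\<lambda>a b. a \<otimes> (b \<otimes> c)) t)"

lemma lookup_scale [simp]: "Poly_Mapping.lookup (c *\<^sub>s p) x = c * Poly_Mapping.lookup p x"
  by (simp add: scale_def Poly_Mapping.map.rep_eq when_def)

lemma vector_space_scale: "vector_space (scale :: rat \<Rightarrow> ('m \<Rightarrow>\<^sub>0 rat) \<Rightarrow> _)"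
  by unfold_locales (auto intro!: poly_mapping_eqI simp: lookup_add algebra_simps)

lemma scale_eq_times: "c *\<^sub>s p = Poly_Mapping.single 0 c * (p :: 'm::comm_monoid_add \<Rightarrow>\<^sub>0 rat)"
  by (simp add: scale_def mult_map_scale_conv_mult)

lemma scale_mult_left: "(c *\<^sub>s p) * q = c *\<^sub>s (p * (q :: 'm::comm_monoid_add \<Rightarrow>\<^sub>0 rat))"
  by (simp add: scale_eq_times mult.assoc)

lemma single_tensor_single:
  "Poly_Mapping.single x a \<otimes> Poly_Mapping.single y b = Poly_Mapping.single (x, y) (a * b)"
  by (simp add: tensor_def)

definition algebra_hom ::
    "(('m::comm_monoid_add \<Rightarrow>\<^sub>0 rat) \<Rightarrow> ('k::comm_monoid_add \<Rightarrow>\<^sub>0 rat)) \<Rightarrow> bool"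
  where "algebra_hom f \<longleftrightarrow> Vector_Spaces.linear scale scale f \<and> f 1 = 1 \<and> (\<forall>a b. f (a * b) = f a * f b)"

text \<open>
  The underlying algebra is the monoid algebra of \<open>'m\<close>: it is a unital associative rational
  algebra by \<open>vector_space_scale\<close>, \<open>scale_mult_left\<close> and the class instances of \<open>\<Rightarrow>\<^sub>0\<close>.
\<close>

locale hopf_algebra =
  fixes \<Delta> :: "('m::comm_monoid_add \<Rightarrow>\<^sub>0 rat) \<Rightarrow> ('m \<times> 'm \<Rightarrow>\<^sub>0 rat)"
    and \<epsilon> :: "('m \<Rightarrow>\<^sub>0 rat) \<Rightarrow> rat"
    and S :: "('m \<Rightarrow>\<^sub>0 rat) \<Rightarrow> ('m \<Rightarrow>\<^sub>0 rat)"
  assumes comult_hom: "algebra_hom \<Delta>"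
    and counit_linear: "Vector_Spaces.linear scale (*) \<epsilon>"
    and counit_one: "\<epsilon> 1 = 1"
    and counit_mult: "\<epsilon> (a * b) = \<epsilon> a * \<epsilon> b"
    and coassoc: "tensor_assoc (tensor_map \<Delta> id (\<Delta> a)) = tensor_map id \<Delta> (\<Delta> a)"
    and counit_left: "tensor_lift (\<lambda>b c. \<epsilon> b *\<^sub>s c) (\<Delta> a) = a"
    and counit_right: "tensor_lift (\<lambda>b c. \<epsilon> c *\<^sub>s b) (\<Delta> a) = a"
    and antipode_linear: "Vector_Spaces.linear scale scale S"
    and antipode_left: "tensor_lift (*) (tensor_map S id (\<Delta> a)) = \<epsilon> a *\<^sub>s 1"
    and antipode_right: "tensor_lift (*) (tensor_map id S (\<Delta> a)) = \<epsilon> a *\<^sub>s 1"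

locale graded_connected_commutative_hopf_algebra = hopf_algebra \<Delta> \<epsilon> S
  for \<Delta> :: "('m::comm_monoid_add \<Rightarrow>\<^sub>0 rat) \<Rightarrow> ('m \<times> 'm \<Rightarrow>\<^sub>0 rat)"
    and \<epsilon> :: "('m \<Rightarrow>\<^sub>0 rat) \<Rightarrow> rat"
    and S :: "('m \<Rightarrow>\<^sub>0 rat) \<Rightarrow> ('m \<Rightarrow>\<^sub>0 rat)" +
  fixes A :: "nat \<Rightarrow> ('m \<Rightarrow>\<^sub>0 rat) set"
  assumes commutative: "(a :: 'm \<Rightarrow>\<^sub>0 rat) * b = b * a"
    and grade_subspace: "module.subspace scale (A n)"
    and grade_direct_sum:
      "\<exists>!f. (\<forall>n. f n \<in> A n) \<and> finite {n. f n \<noteq> 0} \<and> a = (\<Sum>n | f n \<noteq> 0. f n)"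
    and grade_one: "1 \<in> A 0"
    and grade_mult: "a \<in> A i \<Longrightarrow> b \<in> A j \<Longrightarrow> a * b \<in> A (i + j)"
    and grade_comult:
      "a \<in> A n \<Longrightarrow> \<Delta> a \<in> module.span scale {b \<otimes> c | b c. \<exists>i j. i + j = n \<and> b \<in> A i \<and> c \<in> A j}"
    and grade_counit: "a \<in> A n \<Longrightarrow> 0 < n \<Longrightarrow> \<epsilon> a = 0"
    and grade_antipode: "a \<in> A n \<Longrightarrow> S a \<in> A n"
    and connected: "A 0 = {c *\<^sub>s 1 | c. True}"


section \<open>Dissection diagrams\<close>

text \<open>
  The vertices of \<open>\<Pi>\<^sub>n\<close> are \<open>0, \<dots>, n\<close>, with \<open>0\<close> the root. The sides are also labelled
  \<open>0, \<dots>, n\<close>: side \<open>i\<close> goes from vertex \<open>i\<close> to vertex \<open>i + 1\<close> (to \<open>0\<close> if \<open>i = n\<close>).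
  A chord is the set of its two end points; it may join two consecutive vertices.
\<close>

definition chord :: "nat \<Rightarrow> nat set \<Rightarrow> bool"
  where "chord n c \<longleftrightarrow> (\<exists>a b. a < b \<and> b \<le> n \<and> c = {a, b})"

definition crossing :: "nat set \<Rightarrow> nat set \<Rightarrow> bool"
  where "crossing c d \<longleftrightarrow> (\<exists>a b x y. a < x \<and> x < b \<and> b < y \<and> c = {a, b} \<and> d = {x, y})"

definition acyclic_graph :: "nat set set \<Rightarrow> bool"
  where "acyclic_graph E \<longleftrightarrow>
    \<not> (\<exists>vs. 3 \<le> length vs \<and> distinct vs \<and>
        (\<forall>i<length vs. {vs ! i, vs ! (Suc i mod length vs)} \<in> E))"

definition dissection_diagram :: "nat \<Rightarrow> nat set set \<Rightarrow> bool"
  where "dissection_diagram n E \<longleftrightarrow>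
    (\<forall>c\<in>E. chord n c) \<and> card E = n \<and> finite E \<and> (\<forall>c\<in>E. \<forall>d\<in>E. \<not> crossing c d) \<and> acyclic_graph E"

text \<open>
  The chord \<open>{i, j}\<close> is directed from \<open>i\<close> to \<open>j\<close>, i.e. it is the first edge on the path from \<open>i\<close> to
  the root.
\<close>

definition directed :: "nat set set \<Rightarrow> nat \<Rightarrow> nat \<Rightarrow> bool"
  where "directed E i j \<longleftrightarrow>
    (\<exists>vs. distinct (i # j # vs) \<and> last (j # vs) = 0 \<and> successively (\<lambda>x y. {x, y} \<in> E) (i # j # vs))"


section \<open>The operations \<open>q\<^sub>C\<close> and \<open>r\<^sub>C\<close>\<close>

text \<open>
  A chord \<open>c = {a, b}\<close> with \<open>a < b\<close> cuts the disk into two parts, one of which is bounded by the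
  sides \<open>a, \<dots>, b - 1\<close> and has the vertices \<open>a, \<dots>, b\<close>, the other by the remaining sides.
  A face of the graph formed by \<open>C\<close> and the sides is an intersection of such parts, one for each
  chord of \<open>C\<close>. It is represented by its set \<open>\<S>\<^sub>C(\<alpha>)\<close> of sides, which is nonempty as \<open>C\<close> is acyclic:
  two sides bound the same face iff no chord of \<open>C\<close> separates them.
\<close>

definition arc_sides :: "nat set \<Rightarrow> nat set"
  where "arc_sides c = {Min c..<Max c}"

definition faces :: "nat \<Rightarrow> nat set set \<Rightarrow> nat set set"
  where "faces n C =
    {..n} // {(s, t). s \<le> n \<and> t \<le> n \<and> (\<forall>c\<in>C. s \<in> arc_sides c \<longleftrightarrow> t \<in> arc_sides c)}"

text \<open>The vertices of the polygon bounding the face with set of sides \<open>F\<close>.\<close>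

definition face_vertices :: "nat \<Rightarrow> nat set set \<Rightarrow> nat set \<Rightarrow> nat set"
  where "face_vertices n C F = {v \<in> {..n}. \<forall>c\<in>C. \<forall>s\<in>F.
    if s \<in> arc_sides c then v \<in> {Min c..Max c} else v \<notin> {Min c<..<Max c}}"

definition chords_inside :: "nat \<Rightarrow> nat set set \<Rightarrow> nat set set \<Rightarrow> nat set \<Rightarrow> nat set set"
  where "chords_inside n E C F = {c \<in> E - C. c \<subseteq> face_vertices n C F}"

text \<open>
  Contract all sides of a polygon except those in \<open>K\<close>, and renumber: the sides in \<open>K\<close> become
  \<open>0, \<dots>, card K - 1\<close> in increasing order, so that the root is the starting vertex of the side
  \<open>Min K\<close>. A vertex \<open>v\<close> that comes after the \<open>i\<close>-th and before or at the start of the next remaining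
  side is mapped to \<open>i\<close>; a vertex after the last remaining side is mapped to the root \<open>0\<close>.
  If the polygon is the one bounding a face with set of sides \<open>K\<close>, the contracted sides are precisely
  those which are chords.
\<close>

definition contract :: "nat set \<Rightarrow> nat \<Rightarrow> nat"
  where "contract K v = card {s \<in> K. s < v} mod card K"

definition contract_chords :: "nat set \<Rightarrow> nat set set \<Rightarrow> nat set set"
  where "contract_chords K E = (\<lambda>c. contract K ` c) ` E"

text \<open>
  The sides that are not contracted in \<open>r\<^sub>C\<close>, i.e. those outside \<open>\<S>\<^sub>C\<^sup>+\<close>; they include side \<open>0\<close>.
\<close>

definition kept_sides :: "nat \<Rightarrow> nat set set \<Rightarrow> nat set"
  where "kept_sides n C = Min ` faces n C"

text \<open>The chords of \<open>q\<^sub>C\<^sup>\<alpha>\<close> (in degree \<open>card F - 1\<close>) and of \<open>r\<^sub>C\<close> (in degree \<open>card C\<close>).\<close>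

definition q_face :: "nat \<Rightarrow> nat set set \<Rightarrow> nat set set \<Rightarrow> nat set \<Rightarrow> nat set set"
  where "q_face n E C F = contract_chords F (chords_inside n E C F)"

definition r_chords :: "nat \<Rightarrow> nat set set \<Rightarrow> nat set set"
  where "r_chords n C = contract_chords (kept_sides n C) C"

definition k_number :: "nat \<Rightarrow> nat set set \<Rightarrow> nat set set \<Rightarrow> nat"
  where "k_number n E C = card {c \<in> C. \<exists>i j. c = {i, j} \<and> directed E i j \<and>
    directed (r_chords n C) (contract (kept_sides n C) j) (contract (kept_sides n C) i)}"


section \<open>The algebra of dissection diagrams and the coproduct\<close>

typedef pos_diagram = "{(n, E). 0 < n \<and> dissection_diagram n E}"
proof
  have "acyclic_graph {{0, 1}}"
  proof -
    { fix vs :: "nat list"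
      assume vs: "3 \<le> length vs" "distinct vs"
        and e: "\<forall>i<length vs. {vs ! i, vs ! (Suc i mod length vs)} \<in> {{0, 1}}"
      have "vs ! i \<in> {0, 1}" if "i < length vs" for i
        using e that by blast
      hence "set vs \<subseteq> {0, 1}"
        by (metis in_set_conv_nth subsetI)
      hence "card (set vs) \<le> 2"
        using card_mono[of "{0, 1::nat}" "set vs"] by simp
      hence False
        using vs by (simp add: distinct_card) }
    thus ?thesis
      unfolding acyclic_graph_def by blast
  qed
  moreover have "\<not> crossing {0, 1} {0, 1}"
    unfolding crossing_def by (auto simp: doubleton_eq_iff)
  moreover have "chord 1 {0, 1}"
    unfolding chord_def by auto
  ultimately show "(1, {{0, 1}}) \<in> {(n, E). 0 < n \<and> dissection_diagram n E}"
    by (simp add: dissection_diagram_def)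
qed

type_synonym diagram_algebra = "pos_diagram multiset \<Rightarrow>\<^sub>0 rat"

type_synonym diagram_algebra_tensor = "pos_diagram multiset \<times> pos_diagram multiset \<Rightarrow>\<^sub>0 rat"

definition diagram :: "nat \<Rightarrow> nat set set \<Rightarrow> diagram_algebra"
  where "diagram n E = (if n = 0 then 1 else Poly_Mapping.single {#Abs_pos_diagram (n, E)#} 1)"

definition diagram_degree :: "pos_diagram \<Rightarrow> nat"
  where "diagram_degree d = fst (Rep_pos_diagram d)"

definition degree_component :: "nat \<Rightarrow> diagram_algebra set"
  where "degree_component n = {p. \<forall>m\<in>Poly_Mapping.keys p. (\<Sum>d\<in>#m. diagram_degree d) = n}"

definition q_op :: "nat \<Rightarrow> nat set set \<Rightarrow> nat set set \<Rightarrow> diagram_algebra"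
  where "q_op n E C = (\<Prod>F\<in>faces n C. diagram (card F - 1) (q_face n E C F))"

definition r_op :: "nat \<Rightarrow> nat set set \<Rightarrow> diagram_algebra"
  where "r_op n C = diagram (card C) (r_chords n C)"

definition diagram_coproduct :: "nat \<Rightarrow> nat set set \<Rightarrow> diagram_algebra_tensor"
  where "diagram_coproduct n E = (\<Sum>C\<in>Pow E. (-1) ^ k_number n E C *\<^sub>s (q_op n E C \<otimes> r_op n C))"

text \<open>The extension of \<open>diagram_coproduct\<close> to a morphism of algebras.\<close>

definition coproduct :: "diagram_algebra \<Rightarrow> diagram_algebra_tensor"
  where "coproduct p = (\<Sum>m\<in>Poly_Mapping.keys p. Poly_Mapping.lookup p m *\<^sub>s
    (\<Prod>d\<in>#m. case Rep_pos_diagram d of (n, E) \<Rightarrow> diagram_coproduct n E))"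

end

theory Submission
  imports Defs
begin

text \<open>
  A chord is encoded by the bipartition of the sides of the polygon that it induces. In these terms
  a set of \<open>n\<close> noncrossing chords is a dissection diagram iff every two of the \<open>n + 1\<close> sides are
  separated by a chord, and contracting sides amounts to restricting all bipartitions to the
  remaining sides. Adding a chord to a noncrossing set splits at most one class of sides, so that in
  a dissection diagram every chord outside \<open>C\<close> cuts exactly one class of \<open>C\<close>; counting shows that the
  chords cutting a class \<open>F\<close> form a dissection diagram on \<open>F\<close>, and that \<open>C\<close> forms one on the set of
  the minima of its classes. The coproduct is computed for such restricted diagrams, and
  coassociativity is the reindexing \<open>(C, D) \<mapsto> (C \<union> D, C)\<close> where \<open>D\<close> is disjoint from \<open>C\<close>.

  For the signs, removing the chord \<open>c\<close> leaves exactly two sides \<open>s < t\<close> that are separated by no other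
  chord, and \<open>c\<close> leaves its end point in \<open>{s<..t}\<close>. These two sides are also the ones belonging to \<open>c\<close>
  in the diagram on the class \<open>F\<close> cut by \<open>c\<close>, so the directions change only in the passage to \<open>r\<^sub>C\<close>.

  The antipode is the convolution inverse \<open>\<Sum>k. (- 1) ^ k *\<^sub>s J\<^sup>k\<close> of the identity, where \<open>J = id - \<epsilon>\<close> and
  \<open>J\<^sup>k\<close> vanishes in degrees below \<open>k\<close>.
\<close>

section \<open>Splits of the set of sides\<close>

text \<open>Passing to a contracted diagram moves end points; it may send the larger end point of a
  chord to the root and thereby exchange an arc with its complement. Only the unordered bipartition
  of the remaining sides survives, which is why \<open>separates\<close> and \<open>overlap\<close>
  are insensitive to exchanging the two parts of a split. Restricted diagrams are kept as pairs
  \<open>(K, E)\<close> of sides and original chords: iterated operations q and r then become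
  identities between sets of sides, and renumbering is done once, on entering the algebra.
  Acyclicity is awkward to transport through a contraction, whereas the count
  \<open>card K = card E + 1\<close> is not: the bounds for the single faces add up to an equality,
  hence none of them can be strict. The signs fit together because each of them is a product over
  chords of the comparison of two directions, and comparing a first direction with a second and the
  second with a third amounts to comparing the first with the third.\<close>

definition separates :: "nat set \<Rightarrow> nat \<Rightarrow> nat \<Rightarrow> bool"
  where "separates c s t \<longleftrightarrow> (s \<in> arc_sides c) \<noteq> (t \<in> arc_sides c)"

definition cuts :: "nat set \<Rightarrow> nat set \<Rightarrow> bool"
  where "cuts c F \<longleftrightarrow> (\<exists>s\<in>F. \<exists>t\<in>F. separates c s t)"

definition side_class :: "nat set \<Rightarrow> nat set set \<Rightarrow> nat \<Rightarrow> nat set"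
  where "side_class K C s = {t \<in> K. \<forall>c\<in>C. \<not> separates c s t}"

definition side_classes :: "nat set \<Rightarrow> nat set set \<Rightarrow> nat set set"
  where "side_classes K C = side_class K C ` K"

text \<open>This is crossing, seen only through the sides in \<open>K\<close>. Quantifying over both
  truth values makes it invariant under exchanging the two parts of either split, which contraction
  may do.\<close>

definition overlap :: "nat set \<Rightarrow> nat set \<Rightarrow> nat set \<Rightarrow> bool"
  where "overlap K c d \<longleftrightarrow> (\<forall>p q. \<exists>s\<in>K. (s \<in> arc_sides c \<longleftrightarrow> p) \<and> (s \<in> arc_sides d \<longleftrightarrow> q))"

text \<open>If \<open>F\<close> is the set of sides of the face \<open>\<alpha>\<close> of \<open>C\<close>, then \<open>inside E C F\<close> is the set of chords inside
  \<open>\<alpha>\<close>; \<open>transversal K C\<close> is the set of sides that are not contracted in \<open>r\<^sub>C\<close>.\<close>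

definition inside :: "nat set set \<Rightarrow> nat set set \<Rightarrow> nat set \<Rightarrow> nat set set"
  where "inside E C F = {c \<in> E - C. cuts c F}"

definition transversal :: "nat set \<Rightarrow> nat set set \<Rightarrow> nat set"
  where "transversal K C = Min ` side_classes K C"

lemma separates_sym: "separates c s t \<longleftrightarrow> separates c t s"
  by (auto simp: separates_def)

lemma not_separates_refl [simp]: "\<not> separates c s s"
  by (simp add: separates_def)

lemma cuts_mono: "cuts c F \<Longrightarrow> F \<subseteq> G \<Longrightarrow> cuts c G"
  by (auto simp: cuts_def)

lemma overlap_mono: "overlap F c d \<Longrightarrow> F \<subseteq> G \<Longrightarrow> overlap G c d"
  unfolding overlap_def by blast

lemma side_class_mem: "s \<in> K \<Longrightarrow> s \<in> side_class K C s"
  by (simp add: side_class_def)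

lemma side_class_eq: "t \<in> side_class K C s \<Longrightarrow> side_class K C t = side_class K C s"
  unfolding side_class_def by (auto simp: separates_def)

lemma side_classes_eq:
  assumes "F \<in> side_classes K C" "s \<in> F"
  shows "F = side_class K C s"
  using assms side_class_eq unfolding side_classes_def by blast

lemma side_classes_subset: "F \<in> side_classes K C \<Longrightarrow> F \<subseteq> K"
  by (auto simp: side_classes_def side_class_def)

lemma side_classes_nonempty: "F \<in> side_classes K C \<Longrightarrow> F \<noteq> {}"
  by (auto simp: side_classes_def side_class_def)

lemma side_classes_not_separated:
  "F \<in> side_classes K C \<Longrightarrow> s \<in> F \<Longrightarrow> t \<in> F \<Longrightarrow> c \<in> C \<Longrightarrow> \<not> separates c s t"
  using side_classes_eq[of F K C s] by (auto simp: side_class_def)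

lemma side_classes_mem:
  "F \<in> side_classes K C \<Longrightarrow> s \<in> F \<Longrightarrow> t \<in> K \<Longrightarrow> (\<And>c. c \<in> C \<Longrightarrow> \<not> separates c s t) \<Longrightarrow> t \<in> F"
  using side_classes_eq[of F K C s] by (auto simp: side_class_def)

lemma side_classes_unique:
  "F \<in> side_classes K C \<Longrightarrow> G \<in> side_classes K C \<Longrightarrow> s \<in> F \<Longrightarrow> s \<in> G \<Longrightarrow> F = G"
  using side_classes_eq by metis

lemma side_classes_separated:
  assumes "F \<in> side_classes K C" "G \<in> side_classes K C" "F \<noteq> G"
  obtains c where "c \<in> C" "\<And>s t. s \<in> F \<Longrightarrow> t \<in> G \<Longrightarrow> separates c s t"
proof -
  obtain s t where s: "s \<in> F" and t: "t \<in> G"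
    using assms side_classes_nonempty by blast
  have "t \<notin> F"
    using assms t side_classes_unique by blast
  moreover have "t \<in> K"
    using t assms side_classes_subset by blast
  ultimately obtain c where c: "c \<in> C" "separates c s t"
    using side_classes_mem[OF assms(1) s] by blast
  have "separates c s' t'" if "s' \<in> F" "t' \<in> G" for s' t'
    using side_classes_not_separated[OF assms(1) s that(1) c(1)]
      side_classes_not_separated[OF assms(2) t that(2) c(1)] c(2)
    by (auto simp: separates_def)
  thus ?thesis
    using that c by blast
qed

lemma finite_side_classes [simp]: "finite K \<Longrightarrow> finite (side_classes K C)"
  by (simp add: side_classes_def)

lemma Union_side_classes: "\<Union> (side_classes K C) = K"
  by (auto simp: side_classes_def side_class_def)

lemma sum_card_side_classes:
  assumes "finite K"
  shows "(\<Sum>F\<in>side_classes K C. card F) = card K"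
proof -
  have "card (\<Union> (side_classes K C)) = (\<Sum>F\<in>side_classes K C. card F)"
  proof (rule card_Union_disjoint)
    show "pairwise disjnt (side_classes K C)"
      using side_classes_unique by (metis disjnt_iff pairwiseI)
    show "finite F" if "F \<in> side_classes K C" for F
      using side_classes_subset[OF that] assms finite_subset by blast
  qed
  thus ?thesis
    by (simp add: Union_side_classes)
qed

lemma side_class_insert:
  "side_class K (insert c C) s =
    (if s \<in> arc_sides c then side_class K C s \<inter> arc_sides c else side_class K C s - arc_sides c)"
  by (auto simp: side_class_def separates_def)

lemma side_class_insert_uncut:
  assumes "\<not> cuts c (side_class K C s)" "s \<in> K"
  shows "side_class K (insert c C) s = side_class K C s"
proof -
  have "\<not> separates c s t" if "t \<in> side_class K C s" for t
    using assms(1) that side_class_mem[OF assms(2)] unfolding cuts_def by blast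
  thus ?thesis
    by (auto simp: side_class_def)
qed

text \<open>If \<open>d\<close> in \<open>C\<close> puts \<open>F\<close> and \<open>G\<close> into
  different parts while \<open>c\<close> splits both, then each part of \<open>c\<close> contains a
  side of \<open>F\<close> and a side of \<open>G\<close>, so all four intersections are met and
  \<open>c\<close> overlaps \<open>d\<close>.\<close>

lemma cuts_unique:
  assumes "F \<in> side_classes K C" "G \<in> side_classes K C" "cuts c F" "cuts c G"
    and "\<And>d. d \<in> C \<Longrightarrow> \<not> overlap K c d"
  shows "F = G"
proof (rule ccontr)
  assume "F \<noteq> G"
  then obtain d where d: "d \<in> C" "\<And>s t. s \<in> F \<Longrightarrow> t \<in> G \<Longrightarrow> separates d s t"
    using side_classes_separated assms by metis
  obtain s s' where s: "s \<in> F" "s' \<in> F" "separates c s s'"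
    using assms(3) by (auto simp: cuts_def)
  obtain t t' where t: "t \<in> G" "t' \<in> G" "separates c t t'"
    using assms(4) by (auto simp: cuts_def)
  have "overlap K c d"
    unfolding overlap_def
  proof (intro allI)
    fix p q
    obtain u where u: "u \<in> F" "u \<in> arc_sides c \<longleftrightarrow> p"
      using s unfolding separates_def by metis
    obtain v where v: "v \<in> G" "v \<in> arc_sides c \<longleftrightarrow> p"
      using t unfolding separates_def by metis
    have "(u \<in> arc_sides d \<longleftrightarrow> q) \<or> (v \<in> arc_sides d \<longleftrightarrow> q)"
      using d(2)[OF u(1) v(1)] unfolding separates_def by blast
    thus "\<exists>u\<in>K. (u \<in> arc_sides c \<longleftrightarrow> p) \<and> (u \<in> arc_sides d \<longleftrightarrow> q)"
      using u v assms(1,2)[THEN side_classes_subset] by blast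
  qed
  thus False
    using assms(5) d(1) by blast
qed

lemma side_classes_insert_uncut:
  assumes "\<And>F. F \<in> side_classes K C \<Longrightarrow> \<not> cuts c F"
  shows "side_classes K (insert c C) = side_classes K C"
  unfolding side_classes_def
  using assms side_class_insert_uncut by (intro image_cong) (auto simp: side_classes_def)

text \<open>By \<open>cuts_unique\<close> only one class can be cut; it is replaced by at most two
  pieces and all other classes stay.\<close>

lemma card_side_classes_insert_le:
  assumes "finite K" "\<And>d. d \<in> C \<Longrightarrow> \<not> overlap K c d"
  shows "card (side_classes K (insert c C)) \<le> card (side_classes K C) + 1"
proof (cases "\<exists>F\<in>side_classes K C. cuts c F")
  case True
  then obtain F where F: "F \<in> side_classes K C" "cuts c F"
    by blast
  have "side_classes K (insert c C) \<subseteq>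
      (side_classes K C - {F}) \<union> {F \<inter> arc_sides c, F - arc_sides c}"
  proof
    fix G assume "G \<in> side_classes K (insert c C)"
    then obtain s where s: "s \<in> K" and G: "G = side_class K (insert c C) s"
      by (auto simp: side_classes_def)
    show "G \<in> (side_classes K C - {F}) \<union> {F \<inter> arc_sides c, F - arc_sides c}"
    proof (cases "s \<in> F")
      case True
      then show ?thesis
        by (simp add: G side_class_insert side_classes_eq[OF F(1), symmetric])
    next
      case False
      have *: "side_class K C s \<in> side_classes K C"
        using s by (simp add: side_classes_def)
      have "\<not> cuts c (side_class K C s)"
        using cuts_unique[OF F(1) * F(2) _ assms(2)] False side_class_mem[OF s] by blast
      then show ?thesis
        using * False side_class_mem[OF s, of C] by (auto simp: G side_class_insert_uncut s)
    qed
  qed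
  hence "card (side_classes K (insert c C)) \<le>
      card ((side_classes K C - {F}) \<union> {F \<inter> arc_sides c, F - arc_sides c})"
    using assms(1) by (intro card_mono) auto
  also have "\<dots> \<le> card (side_classes K C - {F}) + card {F \<inter> arc_sides c, F - arc_sides c}"
    by (rule card_Un_le)
  also have "\<dots> \<le> card (side_classes K C - {F}) + 2"
    by (simp add: card_insert_if)
  also have "\<dots> = card (side_classes K C) + 1"
    using F(1) assms(1) card_Suc_Diff1[of "side_classes K C" F] by simp
  finally show ?thesis .
next
  case False
  hence "side_classes K (insert c C) = side_classes K C"
    by (intro side_classes_insert_uncut) blast
  thus ?thesis
    by simp
qed

lemma card_side_classes_Un_le:
  assumes "finite K" "finite D" "\<And>c d. c \<in> D \<Longrightarrow> d \<in> C \<union> D \<Longrightarrow> \<not> overlap K c d"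
  shows "card (side_classes K (C \<union> D)) \<le> card (side_classes K C) + card D"
  using assms(2,3)
proof (induction D)
  case empty
  then show ?case by simp
next
  case (insert c D)
  have "card (side_classes K (insert c (C \<union> D))) \<le> card (side_classes K (C \<union> D)) + 1"
    using insert.prems assms(1) by (intro card_side_classes_insert_le) auto
  moreover have "card (side_classes K (C \<union> D)) \<le> card (side_classes K C) + card D"
    using insert by blast
  ultimately show ?case
    using insert.hyps by simp
qed

lemma side_classes_singletons:
  assumes "\<And>s t. s \<in> K \<Longrightarrow> t \<in> K \<Longrightarrow> s \<noteq> t \<Longrightarrow> \<exists>c\<in>C. separates c s t"
  shows "side_classes K C = (\<lambda>s. {s}) ` K"
  unfolding side_classes_def
proof (rule image_cong[OF refl])
  fix s assume "s \<in> K"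
  thus "side_class K C s = {s}"
    using assms[of s] by (auto simp: side_class_def)
qed

lemma side_classes_empty: "K \<noteq> {} \<Longrightarrow> side_classes K {} = {K}"
  by (auto simp: side_classes_def side_class_def)

text \<open>The process starts from one class and ends with singletons, each chord contributing at
  most one new class. Dissection diagrams are the case of equality, and this inequality is what
  \<open>split_system_inside\<close> sums over the faces.\<close>

lemma card_le_separating:
  assumes "finite C" "K \<noteq> {}" "finite K"
    and "\<And>c d. c \<in> C \<Longrightarrow> d \<in> C \<Longrightarrow> \<not> overlap K c d"
    and "\<And>s t. s \<in> K \<Longrightarrow> t \<in> K \<Longrightarrow> s \<noteq> t \<Longrightarrow> \<exists>c\<in>C. separates c s t"
  shows "card K \<le> card C + 1"
proof -
  have "card (side_classes K ({} \<union> C)) \<le> card (side_classes K {}) + card C"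
    using assms by (intro card_side_classes_Un_le) auto
  thus ?thesis
    using assms(2) side_classes_singletons[OF assms(5)]
    by (simp add: side_classes_empty card_image)
qed

text \<open>A dissection diagram seen only through the sides in \<open>K\<close>; the chords keep
  their end points in the original polygon. The count \<open>card_eq\<close> is the case of equality
  in \<open>card_le_separating\<close> and stands in for acyclicity.\<close>

locale split_system =
  fixes K :: "nat set" and E :: "nat set set"
  assumes finite_chords: "finite E"
    and chord_ex: "c \<in> E \<Longrightarrow> \<exists>a b. a < b \<and> c = {a, b}"
    and not_overlap: "c \<in> E \<Longrightarrow> d \<in> E \<Longrightarrow> \<not> overlap K c d"
    and card_eq: "card K = card E + 1"
    and separated: "s \<in> K \<Longrightarrow> t \<in> K \<Longrightarrow> s \<noteq> t \<Longrightarrow> \<exists>c\<in>E. separates c s t"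
begin

lemma finite_sides: "finite K"
  by (rule card_ge_0_finite) (simp add: card_eq)

lemma sides_nonempty: "K \<noteq> {}"
  using card_eq by auto

text \<open>Going from no chords to \<open>C\<close> and from \<open>C\<close> to \<open>E\<close>
  adds at most one class per chord, while the total gain from 1 to \<open>card K\<close> is exactly
  \<open>card E\<close>. So neither stage can fall short.\<close>

lemma card_side_classes:
  assumes "C \<subseteq> E"
  shows "card (side_classes K C) = card C + 1"
proof (rule antisym)
  have fin: "finite C"
    using assms finite_chords finite_subset by blast
  have "card (side_classes K ({} \<union> C)) \<le> card (side_classes K {}) + card C"
    using assms finite_sides fin not_overlap by (intro card_side_classes_Un_le) auto
  thus "card (side_classes K C) \<le> card C + 1"
    by (simp add: side_classes_empty[OF sides_nonempty])
  have "card (side_classes K (C \<union> (E - C))) \<le> card (side_classes K C) + card (E - C)"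
    using assms finite_sides finite_chords not_overlap by (intro card_side_classes_Un_le) auto
  moreover have "card (side_classes K (C \<union> (E - C))) = card K"
  proof -
    have "side_classes K (C \<union> (E - C)) = (\<lambda>s. {s}) ` K"
    proof (rule side_classes_singletons)
      fix s t assume "s \<in> K" "t \<in> K" "s \<noteq> t"
      then obtain c where "c \<in> E" "separates c s t"
        using separated by blast
      thus "\<exists>c\<in>C \<union> (E - C). separates c s t"
        by blast
    qed
    thus ?thesis
      by (simp add: card_image)
  qed
  moreover have "card C + card (E - C) = card E"
    using assms fin finite_chords by (simp add: card_Diff_subset card_mono)
  ultimately show "card C + 1 \<le> card (side_classes K C)"
    using card_eq by linarith
qed

text \<open>Otherwise \<open>c\<close> would leave the classes of \<open>C\<close> unchanged,
  although \<open>card_side_classes\<close> gives one more class for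
  \<open>insert c C\<close>.\<close>

lemma ex_cut_class:
  assumes "C \<subseteq> E" "c \<in> E - C"
  shows "\<exists>F\<in>side_classes K C. cuts c F"
proof (rule ccontr)
  assume "\<not> ?thesis"
  hence "side_classes K (insert c C) = side_classes K C"
    by (intro side_classes_insert_uncut) blast
  hence "card (insert c C) = card C"
    using card_side_classes[of C] card_side_classes[of "insert c C"] assms by simp
  moreover have "finite C"
    using assms finite_chords finite_subset by blast
  ultimately show False
    using assms by simp
qed

lemma cut_class_unique:
  assumes "C \<subseteq> E" "c \<in> E" "F \<in> side_classes K C" "G \<in> side_classes K C" "cuts c F" "cuts c G"
  shows "F = G"
proof (rule cuts_unique[OF assms(3-6)])
  show "\<not> overlap K c d" if "d \<in> C" for d
    using that assms not_overlap by blast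
qed

lemma cuts_sides: "c \<in> E \<Longrightarrow> cuts c K"
  using ex_cut_class[of "{}" c] by (simp add: side_classes_empty[OF sides_nonempty])

lemma ex_sole_separator:
  assumes "c \<in> E"
  obtains s t where "s \<in> K" "t \<in> K" "s < t" "\<And>d. d \<in> E \<Longrightarrow> separates d s t \<longleftrightarrow> d = c"
proof -
  \<comment> \<open>The two sides are taken from the class of \<open>E - {c}\<close> that
    \<open>c\<close> cuts, so no chord other than \<open>c\<close> separates them.\<close>
  obtain F where F: "F \<in> side_classes K (E - {c})" "cuts c F"
    using ex_cut_class[of "E - {c}" c] assms by blast
  then obtain s t where st: "s \<in> F" "t \<in> F" "separates c s t"
    by (auto simp: cuts_def)
  have *: "separates d s t \<longleftrightarrow> d = c" if "d \<in> E" for d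
    using side_classes_not_separated[OF F(1) st(1,2)] st(3) that by blast
  have "s \<in> K" "t \<in> K"
    using st F(1) side_classes_subset by blast+
  moreover have "s \<noteq> t"
    using st by auto
  ultimately show ?thesis
    using that[of s t] that[of t s] * separates_sym[of _ s t] by (metis linorder_neqE_nat)
qed

lemma UN_inside:
  assumes "C \<subseteq> E"
  shows "(\<Union>F\<in>side_classes K C. inside E C F) = E - C"
  using ex_cut_class[OF assms] by (auto simp: inside_def)

lemma inside_disjoint:
  assumes "C \<subseteq> E" "F \<in> side_classes K C" "G \<in> side_classes K C" "F \<noteq> G"
  shows "inside E C F \<inter> inside E C G = {}"
  using cut_class_unique[OF assms(1) _ assms(2,3)] assms(4) by (auto simp: inside_def)

lemma finite_inside: "finite (inside E C F)"
  using finite_chords by (auto simp: inside_def)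

lemma separated_inside:
  assumes "F \<in> side_classes K C" "s \<in> F" "t \<in> F" "s \<noteq> t"
  shows "\<exists>c\<in>inside E C F. separates c s t"
proof -
  have "s \<in> K" "t \<in> K"
    using assms side_classes_subset by blast+
  then obtain c where "c \<in> E" "separates c s t"
    using separated assms(4) by blast
  thus ?thesis
    using side_classes_not_separated[OF assms(1-3)] assms by (auto simp: inside_def cuts_def)
qed

text \<open>A face has at most one side more than it has chords inside. Every chord outside
  \<open>C\<close> lies in exactly one face and there are \<open>card C + 1\<close> faces, so both
  totals equal \<open>card K\<close> and equality holds in each face.\<close>

lemma split_system_inside:
  assumes "C \<subseteq> E" "F \<in> side_classes K C"
  shows "split_system F (inside E C F)"
proof
  note fin = finite_side_classes[OF finite_sides, of C]
  have noov: "\<not> overlap G c d" if "G \<in> side_classes K C" "c \<in> E" "d \<in> E" for G c d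
    using not_overlap that overlap_mono side_classes_subset by metis
  have le: "card G \<le> card (inside E C G) + 1" if G: "G \<in> side_classes K C" for G
    using finite_inside side_classes_nonempty[OF G] finite_subset[OF side_classes_subset[OF G] finite_sides]
      noov[OF G] separated_inside[OF G]
    by (intro card_le_separating) (auto simp: inside_def)
  have "(\<Sum>G\<in>side_classes K C. card (inside E C G)) = card (\<Union>G\<in>side_classes K C. inside E C G)"
    using inside_disjoint[OF assms(1)] finite_inside fin by (subst card_UN_disjoint) auto
  also have "\<dots> = card E - card C"
    using UN_inside[OF assms(1)] assms(1) finite_chords
    by (simp add: card_Diff_subset finite_subset)
  finally have "(\<Sum>G\<in>side_classes K C. card (inside E C G) + 1) = card E - card C + (card C + 1)"
    using card_side_classes[OF assms(1)] unfolding sum.distrib by simp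
  also have "\<dots> = (\<Sum>G\<in>side_classes K C. card G)"
    using sum_card_side_classes[OF finite_sides, of C] card_eq
      card_mono[OF finite_chords assms(1)] by simp
  finally show "card F = card (inside E C F) + 1"
    using sum_mono_inv[of card "side_classes K C" "\<lambda>G. card (inside E C G) + 1" F] le assms(2) fin
    by simp
  show "finite (inside E C F)"
    by (rule finite_inside)
  show "\<exists>a b. a < b \<and> c = {a, b}" if "c \<in> inside E C F" for c
    using chord_ex[of c] that by (simp add: inside_def)
  show "\<not> overlap F c d" if "c \<in> inside E C F" "d \<in> inside E C F" for c d
    using noov[OF assms(2)] that by (simp add: inside_def)
  show "\<exists>c\<in>inside E C F. separates c s t" if "s \<in> F" "t \<in> F" "s \<noteq> t" for s t
    using separated_inside[OF assms(2) that] .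
qed

lemma Min_class:
  assumes "F \<in> side_classes K C"
  shows "Min F \<in> F"
  using assms side_classes_nonempty[OF assms] finite_subset[OF side_classes_subset[OF assms] finite_sides]
  by simp

lemma inj_on_Min_classes: "inj_on Min (side_classes K C)"
  using Min_class side_classes_unique by (intro inj_onI) metis

lemma transversal_subset: "transversal K C \<subseteq> K"
  unfolding transversal_def using Min_class side_classes_subset by blast

text \<open>There are \<open>card C + 1\<close> classes, and sides from distinct classes are
  separated by a chord of \<open>C\<close>, so a set of representatives satisfies both the count and
  the separation. That the representatives are minima is dictated by the root sides of the
  faces.\<close>

lemma split_system_transversal:
  assumes "C \<subseteq> E"
  shows "split_system (transversal K C) C"
proof
  show "finite C"
    using assms finite_chords finite_subset by blast
  show "\<not> overlap (transversal K C) c d" if "c \<in> C" "d \<in> C" for c d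
    using that assms not_overlap overlap_mono[OF _ transversal_subset] by blast
  show "card (transversal K C) = card C + 1"
    unfolding transversal_def using card_side_classes[OF assms] inj_on_Min_classes
    by (simp add: card_image)
  fix s t assume "s \<in> transversal K C" "t \<in> transversal K C" "s \<noteq> t"
  then obtain F G where FG: "F \<in> side_classes K C" "G \<in> side_classes K C"
    "s = Min F" "t = Min G" "F \<noteq> G"
    by (auto simp: transversal_def)
  show "\<exists>c\<in>C. separates c s t"
    using side_classes_separated[OF FG(1,2,5)] Min_class[OF FG(1)] Min_class[OF FG(2)] FG(3,4)
    by metis
qed (use assms chord_ex in blast)

end

section \<open>Contraction\<close>

lemma arc_sides_pair: "a < b \<Longrightarrow> arc_sides {a, b} = {a..<b}"
  by (simp add: arc_sides_def)

text \<open>Cutting the circle at the sides \<open>s\<close> and \<open>t\<close> leaves two arcs of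
  vertices, and \<open>{s<..t}\<close> is the one without the root. A chord has \<open>s\<close> and
  \<open>t\<close> on different sides iff it joins these arcs.\<close>

lemma separates_iff_vertices:
  assumes "s < t" "x \<noteq> y"
  shows "separates {x, y} s t \<longleftrightarrow> (x \<in> {s<..t}) \<noteq> (y \<in> {s<..t})"
proof -
  have *: "separates {a, b} s t \<longleftrightarrow> (a \<in> {s<..t}) \<noteq> (b \<in> {s<..t})" if "a < b" for a b
    using that assms(1) by (auto simp: separates_def arc_sides_pair)
  show ?thesis
    using *[of x y] *[of y x] assms(2) by (cases "x < y") (auto simp: insert_commute)
qed

lemma card_less_sides:
  fixes K :: "nat set"
  assumes "finite K" "s \<in> K"
  shows "card {u \<in> K. u < s} < card K"
proof (rule psubset_card_mono[OF assms(1)])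
  show "{u \<in> K. u < s} \<subset> K"
    using assms(2) less_irrefl by blast
qed

lemma contract_side:
  assumes "finite K" "s \<in> K"
  shows "contract K s = card {u \<in> K. u < s}"
  using card_less_sides[OF assms] by (simp add: contract_def)

lemma card_less_less_iff:
  fixes K :: "nat set"
  assumes "finite K" "s \<in> K"
  shows "card {u \<in> K. u < s} < card {u \<in> K. u < v} \<longleftrightarrow> s < v"
proof (cases "s < v")
  case True
  hence "{u \<in> K. u < s} \<subseteq> {u \<in> K. u < v}" "s \<in> {u \<in> K. u < v} - {u \<in> K. u < s}"
    using assms(2) by auto
  hence "{u \<in> K. u < s} \<subset> {u \<in> K. u < v}"
    by blast
  thus ?thesis
    using assms True by (simp add: psubset_card_mono)
next
  case False
  have "{u \<in> K. u < v} \<subseteq> {u \<in> K. u < s}"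
  proof
    show "x \<in> {u \<in> K. u < s}" if "x \<in> {u \<in> K. u < v}" for x
      using that False by simp
  qed
  thus ?thesis
    using assms False by (simp add: card_mono not_less)
qed

lemma contract_less_iff:
  assumes "finite K" "s \<in> K" "t \<in> K"
  shows "contract K s < contract K t \<longleftrightarrow> s < t"
  using assms by (simp add: contract_side card_less_less_iff)

lemma inj_on_contract: "finite K \<Longrightarrow> inj_on (contract K) K"
  using contract_less_iff by (intro inj_onI) (metis less_irrefl linorder_neqE_nat)

lemma contract_image:
  assumes "finite K"
  shows "contract K ` K = {..<card K}"
proof (rule card_seteq)
  show "contract K ` K \<subseteq> {..<card K}"
    using assms by (auto simp: contract_side card_less_sides)
qed (simp_all add: card_image inj_on_contract assms)

text \<open>\<open>contract\<close> is not monotone: a vertex after the last side of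
  \<open>K\<close> wraps around to 0. Such a vertex is outside every interval between sides of
  \<open>K\<close>, and so is 0 outside the image interval, hence the equivalence survives.\<close>

lemma contract_between_iff:
  assumes "finite K" "s \<in> K" "t \<in> K"
  shows "contract K v \<in> {contract K s<..contract K t} \<longleftrightarrow> v \<in> {s<..t}"
proof (cases "v \<le> t")
  case True
  hence "card {u \<in> K. u < v} \<le> card {u \<in> K. u < t}"
    using assms(1) by (intro card_mono) auto
  moreover from this have "contract K v = card {u \<in> K. u < v}"
    using card_less_sides[OF assms(1,3)] by (simp add: contract_def)
  ultimately show ?thesis
    using True assms by (simp add: contract_side card_less_less_iff)
next
  case False
  hence *: "card {u \<in> K. u < t} < card {u \<in> K. u < v}"
    using assms by (simp add: card_less_less_iff)
  have "card {u \<in> K. u < v} \<le> card K"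
    using assms(1) by (intro card_mono) auto
  hence "contract K v = 0 \<or> contract K v = card {u \<in> K. u < v}"
    by (cases "card {u \<in> K. u < v} = card K") (simp_all add: contract_def)
  thus ?thesis
    using * False assms by (auto simp: contract_side)
qed

lemma contract_contract:
  assumes "finite K" "L \<subseteq> K"
  shows "contract (contract K ` L) (contract K v) = contract L v"
proof -
  have inj: "inj_on (contract K) L"
    using inj_on_contract assms inj_on_subset by blast
  have finL: "finite L"
    using assms finite_subset by blast
  show ?thesis
  proof (cases "card {u \<in> K. u < v} < card K")
    case True
    hence v: "contract K v = card {u \<in> K. u < v}"
      by (simp add: contract_def)
    have "{r \<in> contract K ` L. r < contract K v} = contract K ` {s \<in> L. s < v}"
      using assms by (force simp: v contract_side card_less_less_iff subset_iff)
    hence "card {r \<in> contract K ` L. r < contract K v} = card {s \<in> L. s < v}"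
      using inj by (simp add: card_image inj_on_subset[OF inj])
    thus ?thesis
      using inj by (simp add: contract_def[of L] contract_def[of "contract K ` L"] card_image)
  next
    case False
    \<comment> \<open>Here \<open>v\<close> comes after all sides of \<open>K\<close>, hence after
      those of \<open>L\<close>, and both ways of contracting send it to the root.\<close>
    have "{u \<in> K. u < v} = K"
      using False assms(1) by (intro card_seteq) auto
    hence "contract K v = 0" and "{u \<in> L. u < v} = L"
      using assms by (auto simp: contract_def)
    thus ?thesis
      by (simp add: contract_def)
  qed
qed

lemma contract_atMost: "v \<le> n \<Longrightarrow> contract {..n} v = v"
proof -
  assume "v \<le> n"
  hence "{s \<in> {..n}. s < v} = {..<v}"
    by auto
  thus ?thesis
    using \<open>v \<le> n\<close> by (simp add: contract_def)
qed

lemma contract_chords_atMost: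
  assumes "\<And>c. c \<in> C \<Longrightarrow> c \<subseteq> {..n}"
  shows "contract_chords {..n} C = C"
proof -
  have "contract {..n} ` c = c" if "c \<in> C" for c
    using assms[OF that] by (force simp: contract_atMost subset_iff)
  thus ?thesis
    by (simp add: contract_chords_def)
qed

lemma contract_chords_contract:
  assumes "finite K" "L \<subseteq> K"
  shows "contract_chords (contract K ` L) (contract_chords K C) = contract_chords L C"
  using assms by (simp add: contract_chords_def image_image contract_contract)

text \<open>The flag \<open>p\<close> records whether contraction exchanges the two parts of the
  split. This happens when every side of \<open>K\<close> precedes \<open>b\<close>: the rank of
  \<open>b\<close> is then \<open>card K\<close> and \<open>b\<close> becomes the root. Because the
  chord cuts \<open>K\<close>, its end points stay distinct.\<close>

lemma contract_chord:
  assumes "finite K" "a < b" "cuts {a, b} K"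
  shows "\<exists>p. \<forall>s\<in>K. contract K s \<in> arc_sides {contract K a, contract K b} \<longleftrightarrow> (s \<in> {a..<b}) \<noteq> p"
    and "contract K a < card K" "contract K b < card K" "contract K a \<noteq> contract K b"
proof -
  define r where "r v = card {u \<in> K. u < v}" for v
  obtain s where s: "s \<in> K" "a \<le> s" "s < b" and "\<exists>t\<in>K. \<not> (a \<le> t \<and> t < b)"
    using assms(2,3) by (auto simp: cuts_def separates_def arc_sides_pair)
  then obtain t where t: "t \<in> K" "t < a \<or> b \<le> t"
    by auto
  have less: "r u < r v \<longleftrightarrow> u < v" if "u \<in> K" for u v
    using card_less_less_iff[OF assms(1) that] by (simp add: r_def)
  have side: "contract K u = r u" "r u < card K" if "u \<in> K" for u
    using contract_side[OF assms(1) that] card_less_sides[OF assms(1) that] by (simp_all add: r_def)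
  have r_le: "r v \<le> card K" for v
    unfolding r_def using assms(1) by (intro card_mono) auto
  have "r a < r b"
    using s less[of s a] less[of s b] by linarith
  hence ra: "contract K a = r a"
    using r_le[of b] by (simp add: contract_def r_def)
  show "contract K a < card K" "contract K b < card K"
    using assms(1) s(1) by (auto simp: contract_def intro!: mod_less_divisor card_gt_0_iff[THEN iffD2])
  have "(contract K a \<noteq> contract K b) \<and>
      (\<exists>p. \<forall>s\<in>K. contract K s \<in> arc_sides {contract K a, contract K b} \<longleftrightarrow> (s \<in> {a..<b}) \<noteq> p)"
  proof (cases "r b < card K")
    case True
    hence "contract K b = r b"
      by (simp add: contract_def r_def)
    moreover have "r u \<in> {r a..<r b} \<longleftrightarrow> u \<in> {a..<b}" if "u \<in> K" for u
      using less[OF that, of a] less[OF that, of b] by auto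
    ultimately show ?thesis
      using \<open>r a < r b\<close> by (auto simp: ra arc_sides_pair side intro!: exI[of _ False])
  next
    case False
    hence "r b = card K"
      using r_le[of b] by simp
    hence "contract K b = 0"
      by (simp add: contract_def r_def)
    have lt: "u < b" if "u \<in> K" for u
      using less[OF that, of b] side[OF that] \<open>r b = card K\<close> by simp
    \<comment> \<open>All sides of \<open>K\<close> precede \<open>b\<close>, so the side
      \<open>t\<close> outside the arc must precede \<open>a\<close>.\<close>
    have "0 < r a"
      using t less[OF t(1), of a] lt[OF t(1)] by auto
    have "r u < r a \<longleftrightarrow> u \<notin> {a..<b}" if "u \<in> K" for u
      using less[OF that, of a] lt[OF that] by auto
    thus ?thesis
      using \<open>0 < r a\<close> \<open>contract K b = 0\<close>
      by (auto simp: ra arc_sides_pair side insert_commute[of "r a"] intro!: exI[of _ True])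
  qed
  thus "contract K a \<noteq> contract K b"
    and "\<exists>p. \<forall>s\<in>K. contract K s \<in> arc_sides {contract K a, contract K b} \<longleftrightarrow> (s \<in> {a..<b}) \<noteq> p"
    by blast+
qed

lemma Min_contract:
  assumes "finite K" "F \<subseteq> K" "F \<noteq> {}"
  shows "Min (contract K ` F) = contract K (Min F)"
proof (rule Min_eqI)
  have fin: "finite F"
    using assms finite_subset by blast
  show "finite (contract K ` F)" "contract K (Min F) \<in> contract K ` F"
    using fin assms(3) by simp_all
  fix y assume "y \<in> contract K ` F"
  then obtain s where s: "s \<in> F" "y = contract K s"
    by blast
  have "Min F \<in> K" "s \<in> K" "Min F \<le> s"
    using assms(2) s(1) Min_in[OF fin assms(3)] Min_le[OF fin s(1)] by blast+
  thus "contract K (Min F) \<le> y"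
    using contract_less_iff[OF assms(1), of s "Min F"] s(2) by linarith
qed

section \<open>Contraction of split systems\<close>

context split_system
begin

lemma contract_arc:
  assumes "c \<in> E"
  shows "\<exists>p. \<forall>s\<in>K. contract K s \<in> arc_sides (contract K ` c) \<longleftrightarrow> (s \<in> arc_sides c) \<noteq> p"
proof -
  obtain a b where ab: "a < b" "c = {a, b}"
    using chord_ex[OF assms] by blast
  show ?thesis
    using contract_chord(1)[OF finite_sides ab(1)] cuts_sides[OF assms] ab
    by (simp add: arc_sides_pair)
qed

lemma contract_chord_ex:
  assumes "c \<in> E"
  shows "\<exists>a b. a < b \<and> b < card K \<and> contract K ` c = {a, b}"
proof -
  obtain a b where ab: "a < b" "c = {a, b}"
    using chord_ex[OF assms] by blast
  note * = contract_chord[OF finite_sides ab(1) cuts_sides[OF assms, unfolded ab(2)]]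
  show ?thesis
  proof (cases "contract K a < contract K b")
    case True
    then show ?thesis
      using * ab by blast
  next
    case False
    then show ?thesis
      using * ab(2) insert_commute[of "contract K a"]
      by (intro exI[of _ "contract K b"] exI[of _ "contract K a"]) auto
  qed
qed

lemma separates_contract:
  assumes "c \<in> E" "s \<in> K" "t \<in> K"
  shows "separates (contract K ` c) (contract K s) (contract K t) \<longleftrightarrow> separates c s t"
proof -
  obtain p where "\<forall>s\<in>K. contract K s \<in> arc_sides (contract K ` c) \<longleftrightarrow> (s \<in> arc_sides c) \<noteq> p"
    using contract_arc[OF assms(1)] by blast
  thus ?thesis
    using assms(2,3) unfolding separates_def by metis
qed

lemma cuts_contract:
  assumes "c \<in> E" "F \<subseteq> K"
  shows "cuts (contract K ` c) (contract K ` F) \<longleftrightarrow> cuts c F"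
  using separates_contract[OF assms(1)] assms(2) unfolding cuts_def by (simp add: subset_iff)

lemma overlap_contract:
  assumes "c \<in> E" "d \<in> E" "overlap (contract K ` K) (contract K ` c) (contract K ` d)"
  shows "overlap K c d"
proof -
  obtain p q where
    "\<forall>s\<in>K. contract K s \<in> arc_sides (contract K ` c) \<longleftrightarrow> (s \<in> arc_sides c) \<noteq> p"
    "\<forall>s\<in>K. contract K s \<in> arc_sides (contract K ` d) \<longleftrightarrow> (s \<in> arc_sides d) \<noteq> q"
    using contract_arc[OF assms(1)] contract_arc[OF assms(2)] by blast
  hence *: "contract K s \<in> arc_sides (contract K ` c) \<longleftrightarrow> (s \<in> arc_sides c) \<noteq> p"
    "contract K s \<in> arc_sides (contract K ` d) \<longleftrightarrow> (s \<in> arc_sides d) \<noteq> q" if "s \<in> K" for s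
    using that by blast+
  show ?thesis
    unfolding overlap_def
  proof (intro allI)
    fix p' q'
    obtain s where s: "s \<in> K" "contract K s \<in> arc_sides (contract K ` c) \<longleftrightarrow> (p' \<noteq> p)"
      "contract K s \<in> arc_sides (contract K ` d) \<longleftrightarrow> (q' \<noteq> q)"
      using assms(3)[unfolded overlap_def, rule_format, of "p' \<noteq> p" "q' \<noteq> q"] by blast
    have "(s \<in> arc_sides c \<longleftrightarrow> p') \<and> (s \<in> arc_sides d \<longleftrightarrow> q')"
      using *[OF s(1)] s(2,3) by argo
    thus "\<exists>s\<in>K. (s \<in> arc_sides c \<longleftrightarrow> p') \<and> (s \<in> arc_sides d \<longleftrightarrow> q')"
      using s(1) by blast
  qed
qed

text \<open>Two sides separated by \<open>c\<close> alone are still told apart by the image of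
  \<open>c\<close>, and not by the image of any other chord.\<close>

lemma inj_on_contract_chord: "inj_on ((`) (contract K)) E"
proof (rule inj_onI, rule ccontr)
  fix c d assume cd: "c \<in> E" "d \<in> E" "contract K ` c = contract K ` d" "c \<noteq> d"
  obtain s t where "s \<in> K" "t \<in> K" "\<And>d. d \<in> E \<Longrightarrow> separates d s t \<longleftrightarrow> d = c"
    using ex_sole_separator[OF cd(1)] by metis
  thus False
    using cd separates_contract[of c s t] separates_contract[of d s t] by simp
qed

lemma split_system_contract: "split_system (contract K ` K) (contract_chords K E)"
proof
  show "finite (contract_chords K E)"
    by (simp add: contract_chords_def finite_chords)
  show "\<exists>a b. a < b \<and> c = {a, b}" if "c \<in> contract_chords K E" for c
    using that contract_chord_ex unfolding contract_chords_def by blast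
  show "\<not> overlap (contract K ` K) c d" if "c \<in> contract_chords K E" "d \<in> contract_chords K E" for c d
    using that overlap_contract not_overlap unfolding contract_chords_def by blast
  show "card (contract K ` K) = card (contract_chords K E) + 1"
    by (simp add: contract_chords_def card_image inj_on_contract finite_sides inj_on_contract_chord card_eq)
  fix s t assume "s \<in> contract K ` K" "t \<in> contract K ` K" "s \<noteq> t"
  then obtain u v where uv: "u \<in> K" "v \<in> K" "s = contract K u" "t = contract K v" "u \<noteq> v"
    by blast
  then obtain c where "c \<in> E" "separates c u v"
    using separated by blast
  thus "\<exists>c\<in>contract_chords K E. separates c s t"
    using separates_contract[of c u v] uv unfolding contract_chords_def by blast
qed

lemma side_classes_contract:
  assumes "C \<subseteq> E"
  shows "side_classes (contract K ` K) (contract_chords K C) = (`) (contract K) ` side_classes K C"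
proof -
  have "side_class (contract K ` K) (contract_chords K C) (contract K s) = contract K ` side_class K C s"
    if "s \<in> K" for s
  proof -
    have "(\<forall>c\<in>contract_chords K C. \<not> separates c (contract K s) (contract K t)) \<longleftrightarrow>
        (\<forall>c\<in>C. \<not> separates c s t)" if "t \<in> K" for t
      using separates_contract[OF _ \<open>s \<in> K\<close> that] assms unfolding contract_chords_def
      by (simp add: subset_iff)
    thus ?thesis
      unfolding side_class_def by blast
  qed
  thus ?thesis
    unfolding side_classes_def by (simp add: image_image)
qed

lemma inside_contract:
  assumes "C \<subseteq> E" "F \<subseteq> K"
  shows "inside (contract_chords K E) (contract_chords K C) (contract K ` F) = contract_chords K (inside E C F)"
proof -
  have "contract_chords K E - contract_chords K C = contract_chords K (E - C)"
    unfolding contract_chords_def using inj_on_image_set_diff[OF inj_on_contract_chord _ assms(1)] by simp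
  thus ?thesis
    using cuts_contract[OF _ assms(2)] by (auto simp: inside_def contract_chords_def)
qed

lemma transversal_contract:
  assumes "C \<subseteq> E"
  shows "transversal (contract K ` K) (contract_chords K C) = contract K ` transversal K C"
proof -
  have "Min (contract K ` F) = contract K (Min F)" if "F \<in> side_classes K C" for F
    using Min_contract[OF finite_sides side_classes_subset side_classes_nonempty] that by blast
  thus ?thesis
    unfolding transversal_def side_classes_contract[OF assms] by (simp add: image_image)
qed

end

section \<open>Noncrossing trees and directions\<close>

definition joined :: "nat set set \<Rightarrow> nat rel"
  where "joined E = {(x, y). {x, y} \<in> E}\<^sup>*"

lemma joined_path:
  assumes "(x, y) \<in> joined E"
  shows "\<exists>vs. distinct vs \<and> vs \<noteq> [] \<and> hd vs = x \<and> last vs = y \<and> successively (\<lambda>x y. {x, y} \<in> E) vs"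
  using assms unfolding joined_def
proof (induction rule: converse_rtrancl_induct)
  case base
  show ?case
    by (rule exI[of _ "[y]"]) simp
next
  case (step x z)
  then obtain vs where vs: "distinct vs" "vs \<noteq> []" "hd vs = z" "last vs = y"
    "successively (\<lambda>x y. {x, y} \<in> E) vs"
    by blast
  show ?case
  \<comment> \<open>If \<open>x\<close> already occurs, the path is restarted at that occurrence,
    which keeps its vertices distinct.\<close>
  proof (cases "x \<in> set vs")
    case True
    then obtain us ws where "vs = us @ x # ws"
      by (meson split_list)
    then show ?thesis
      using vs by (intro exI[of _ "x # ws"]) (auto simp: successively_append_iff)
  next
    case False
    then show ?thesis
      using vs step.hyps by (intro exI[of _ "x # vs"]) (auto simp: successively_Cons)
  qed
qed

lemma joined_sym: "(x, y) \<in> joined E \<Longrightarrow> (y, x) \<in> joined E"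
proof -
  have "sym {(x, y). {x, y} \<in> E}"
    by (auto simp: sym_def insert_commute)
  thus "(x, y) \<in> joined E \<Longrightarrow> (y, x) \<in> joined E"
    unfolding joined_def by (blast dest: symD[OF sym_rtrancl])
qed

lemma joined_trans: "(x, y) \<in> joined E \<Longrightarrow> (y, z) \<in> joined E \<Longrightarrow> (x, z) \<in> joined E"
  unfolding joined_def by (rule rtrancl_trans)

lemma joined_edge: "{x, y} \<in> E \<Longrightarrow> (x, y) \<in> joined E"
  unfolding joined_def by blast

lemma joined_mono: "E \<subseteq> E' \<Longrightarrow> joined E \<subseteq> joined E'"
  unfolding joined_def by (rule rtrancl_mono) blast

lemma joined_invariant:
  assumes "(x, y) \<in> joined E" "\<And>u v. {u, v} \<in> E \<Longrightarrow> u \<in> X \<longleftrightarrow> v \<in> X"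
  shows "x \<in> X \<longleftrightarrow> y \<in> X"
  using assms(1) unfolding joined_def by (induction rule: rtrancl_induct) (use assms(2) in auto)

lemma equiv_joined: "equiv V (joined E \<inter> V \<times> V)"
proof (rule equivI)
  show "refl_on V (joined E \<inter> V \<times> V)"
    by (auto simp: refl_on_def joined_def)
  show "sym (joined E \<inter> V \<times> V)"
    by (auto simp: sym_def intro: joined_sym)
  show "trans (joined E \<inter> V \<times> V)"
    by (auto intro!: transI intro: joined_trans)
qed auto

text \<open>Sending an \<open>R\<close>-class to the \<open>S\<close>-class containing it is onto,
  and it is not injective because it identifies the classes of \<open>a\<close> and
  \<open>b\<close>.\<close>

lemma card_quotient_less:
  assumes "finite V" "equiv V R" "equiv V S" "R \<subseteq> S" "(a, b) \<in> S - R"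
  shows "card (V // S) < card (V // R)"
proof -
  have ab: "a \<in> V" "b \<in> V"
    using assms(3,5) equiv_class_eq_iff by fastforce+
  have img: "(\<lambda>X. S `` X) ` (V // R) = V // S"
  proof -
    have "S `` (R `` {x}) = S `` {x}" for x
      using refines_equiv_class_eq2[OF assms(4,2,3)] .
    thus ?thesis
      unfolding quotient_def by (auto simp: image_iff)
  qed
  have fin: "finite (V // R)"
    using assms(1,2) by (simp add: finite_quotient equiv_type)
  have "\<not> inj_on (\<lambda>X. S `` X) (V // R)"
  proof
    assume inj: "inj_on (\<lambda>X. S `` X) (V // R)"
    have "S `` (R `` {a}) = S `` (R `` {b})"
      unfolding refines_equiv_class_eq2[OF assms(4,2,3)]
      using equiv_class_eq[OF assms(3)] assms(5) by blast
    hence "R `` {a} = R `` {b}"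
      using inj_onD[OF inj] ab by (simp add: quotientI)
    thus False
      using eq_equiv_class[OF _ assms(2) ab(2)] assms(5) by blast
  qed
  thus ?thesis
    using card_image_le[OF fin] eq_card_imp_inj_on[OF fin] img by (metis le_neq_implies_less)
qed

lemma acyclic_graph_subset: "acyclic_graph E \<Longrightarrow> F \<subseteq> E \<Longrightarrow> acyclic_graph F"
  unfolding acyclic_graph_def by blast

text \<open>The new edge closes a path from \<open>a\<close> to \<open>b\<close> to a cycle. This
  path has at least three vertices: it has distinct ends and is not the single edge
  \<open>{a, b}\<close>.\<close>

lemma acyclic_graph_insert_not_joined:
  assumes "acyclic_graph (insert {a, b} E)" "{a, b} \<notin> E" "a \<noteq> b"
  shows "(a, b) \<notin> joined E"
proof
  assume "(a, b) \<in> joined E"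
  then obtain vs where vs: "distinct vs" "vs \<noteq> []" "hd vs = a" "last vs = b"
    "successively (\<lambda>x y. {x, y} \<in> E) vs"
    using joined_path by blast
  have "length vs \<noteq> 1"
    using vs(3,4) assms(3) by (auto simp: length_Suc_conv)
  moreover have "length vs \<noteq> 2"
    using vs(3,4,5) assms(2) by (auto simp: length_Suc_conv numeral_2_eq_2)
  moreover have "length vs \<noteq> 0"
    using vs(2) by simp
  ultimately have "3 \<le> length vs"
    by linarith
  moreover have "{vs ! i, vs ! (Suc i mod length vs)} \<in> insert {a, b} E" if "i < length vs" for i
  proof (cases "Suc i < length vs")
    case True
    then show ?thesis
      using vs(5) by (simp add: successively_conv_nth)
  next
    case False
    hence "Suc i = length vs"
      using that by simp
    thus ?thesis
      using vs(2-4) by (auto simp: hd_conv_nth last_conv_nth insert_commute simp flip: \<open>Suc i = length vs\<close>)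
  qed
  ultimately show False
    using assms(1) vs(1) unfolding acyclic_graph_def by blast
qed

text \<open>Each edge of a forest merges two components when it is added. For the \<open>n\<close>
  chords of a dissection diagram at most one component remains, so the diagram is connected.\<close>

lemma card_components_le:
  assumes "finite E" "acyclic_graph E" "\<And>c. c \<in> E \<Longrightarrow> chord n c"
  shows "card ({..n} // (joined E \<inter> {..n} \<times> {..n})) + card E \<le> n + 1"
  using assms
proof (induction E)
  case empty
  have "{..n} // (joined {} \<inter> {..n} \<times> {..n}) = (\<lambda>v. {v}) ` {..n}"
    by (auto simp: quotient_def joined_def)
  then show ?case
    by (simp add: card_image)
next
  case (insert c E)
  obtain a b where ab: "a < b" "b \<le> n" "c = {a, b}"
    using insert.prems(2)[of c] by (auto simp: chord_def)
  have "(a, b) \<notin> joined E"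
    using acyclic_graph_insert_not_joined[of a b E] insert.prems(1) insert.hyps ab by simp
  hence "card ({..n} // (joined (insert c E) \<inter> {..n} \<times> {..n})) < card ({..n} // (joined E \<inter> {..n} \<times> {..n}))"
    using ab joined_mono[of E "insert c E"] joined_edge[of a b "insert c E"]
    by (intro card_quotient_less[of _ _ _ a b] equiv_joined) auto
  moreover have "card ({..n} // (joined E \<inter> {..n} \<times> {..n})) + card E \<le> n + 1"
    using insert acyclic_graph_subset by blast
  ultimately show ?case
    using insert.hyps by simp
qed

lemma dissection_diagram_joined:
  assumes "dissection_diagram n E" "x \<le> n" "y \<le> n"
  shows "(x, y) \<in> joined E"
proof -
  let ?R = "joined E \<inter> {..n} \<times> {..n}"
  have "card ({..n} // ?R) + card E \<le> n + 1"
    using assms(1) by (intro card_components_le) (auto simp: dissection_diagram_def)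
  hence "card ({..n} // ?R) \<le> 1"
    using assms(1) by (simp add: dissection_diagram_def)
  moreover have "finite ({..n} // ?R)"
    by (rule finite_quotient) auto
  ultimately have "?R `` {x} = ?R `` {y}"
    using assms(2,3) by (intro card_le_Suc0_iff_eq[THEN iffD1, rule_format]) (auto intro: quotientI)
  thus ?thesis
    using eq_equiv_class[OF _ equiv_joined] assms(3) by blast
qed

text \<open>Sides lying in the first arc only, in both arcs and in the second arc only force the end
  points to alternate.\<close>

lemma overlap_crossing:
  assumes "a < b" "x < y" "overlap K {a, b} {x, y}"
  shows "crossing {a, b} {x, y} \<or> crossing {x, y} {a, b}"
proof -
  obtain s where "s \<in> {a..<b}" "s \<notin> {x..<y}"
    using assms(3)[unfolded overlap_def, rule_format, of True False] assms(1,2) by (auto simp: arc_sides_pair)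
  moreover obtain t where "t \<in> {a..<b}" "t \<in> {x..<y}"
    using assms(3)[unfolded overlap_def, rule_format, of True True] assms(1,2) by (auto simp: arc_sides_pair)
  moreover obtain u where "u \<notin> {a..<b}" "u \<in> {x..<y}"
    using assms(3)[unfolded overlap_def, rule_format, of False True] assms(1,2) by (auto simp: arc_sides_pair)
  ultimately have "a < x \<and> x < b \<and> b < y \<or> x < a \<and> a < y \<and> y < b"
    by auto
  thus ?thesis
    unfolding crossing_def by blast
qed

lemma crossing_overlap:
  assumes "crossing c d" "c \<subseteq> {..n}" "d \<subseteq> {..n}"
  shows "overlap {..n} c d"
proof -
  obtain a b x y where *: "a < x" "x < b" "b < y" "c = {a, b}" "d = {x, y}"
    using assms(1) by (auto simp: crossing_def)
  \<comment> \<open>The sides leaving \<open>a\<close>, \<open>x\<close>, \<open>b\<close>,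
    \<open>y\<close> lie in the first arc only, in both, in the second only and in neither.\<close>
  have "\<exists>s\<in>{a, x, b, y}. (s \<in> arc_sides c \<longleftrightarrow> p) \<and> (s \<in> arc_sides d \<longleftrightarrow> q)" for p q
    using * by (cases p; cases q) (auto simp: arc_sides_pair)
  moreover have "{a, x, b, y} \<subseteq> {..n}"
    using * assms(2,3) by simp
  ultimately show ?thesis
    unfolding overlap_def by (intro allI) blast
qed

lemma split_system_dissection:
  assumes "dissection_diagram n E"
  shows "split_system {..n} E"
proof
  show "finite E" "card {..n} = card E + 1"
    using assms by (simp_all add: dissection_diagram_def)
  show ch: "\<exists>a b. a < b \<and> c = {a, b}" if "c \<in> E" for c
    using assms that unfolding dissection_diagram_def chord_def by blast
  show "\<not> overlap {..n} c d" if cd: "c \<in> E" "d \<in> E" for c d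
  proof -
    obtain a b x y where "a < b" "c = {a, b}" "x < y" "d = {x, y}"
      using ch[OF cd(1)] ch[OF cd(2)] by blast
    thus ?thesis
      using overlap_crossing[of a b x y "{..n}"] assms cd unfolding dissection_diagram_def by blast
  qed
  \<comment> \<open>If no chord separates \<open>s\<close> and \<open>t\<close>, no chord leaves the
    vertex set \<open>{s<..t}\<close>; it contains \<open>t\<close> but not \<open>s\<close>, which
    contradicts connectedness.\<close>
  have sep: "\<exists>c\<in>E. separates c s t" if "s < t" "t \<le> n" for s t
  proof (rule ccontr)
    assume "\<not> (\<exists>c\<in>E. separates c s t)"
    hence "u \<in> {s<..t} \<longleftrightarrow> v \<in> {s<..t}" if "{u, v} \<in> E" for u v
      using separates_iff_vertices[OF \<open>s < t\<close>, of u v] that by (cases "u = v") blast+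
    moreover have "(s, t) \<in> joined E"
      using dissection_diagram_joined[OF assms] that by simp
    ultimately have "s \<in> {s<..t} \<longleftrightarrow> t \<in> {s<..t}"
      using joined_invariant by blast
    thus False
      using that by simp
  qed
  show "\<exists>c\<in>E. separates c s t" if "s \<in> {..n}" "t \<in> {..n}" "s \<noteq> t" for s t
  proof (cases "s < t")
    case True
    then show ?thesis
      using sep[of s t] that by simp
  next
    case False
    then show ?thesis
      using sep[of t s] that separates_sym by auto
  qed
qed

lemma successively_invariant:
  assumes "successively P vs" "\<And>u v. u \<in> set vs \<Longrightarrow> v \<in> set vs \<Longrightarrow> P u v \<Longrightarrow> u \<in> X \<longleftrightarrow> v \<in> X" "vs \<noteq> []"
  shows "hd vs \<in> X \<longleftrightarrow> last vs \<in> X"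
  using assms
proof (induction vs rule: induct_list012)
  case (3 x y zs)
  have "hd (y # zs) \<in> X \<longleftrightarrow> last (y # zs) \<in> X"
  proof (rule "3.IH")
    show "successively P (y # zs)"
      using "3.prems"(1) by simp
    show "u \<in> X \<longleftrightarrow> v \<in> X" if "u \<in> set (y # zs)" "v \<in> set (y # zs)" "P u v" for u v
      using "3.prems"(2)[of u v] that by simp
  qed simp
  moreover have "x \<in> X \<longleftrightarrow> y \<in> X"
    using "3.prems"(1) "3.prems"(2)[of x y] by simp
  ultimately show ?case
    by simp
qed simp_all

text \<open>A cycle is impossible: some two sides are separated by its chord from
  \<open>vs ! 0\<close> to \<open>vs ! 1\<close> and by no other, so the rest of the cycle would
  have to join the end points of this chord without passing between the two arcs of
  vertices.\<close>

lemma dissection_split_system: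
  assumes "split_system {..n} E" "\<And>c. c \<in> E \<Longrightarrow> c \<subseteq> {..n}"
  shows "dissection_diagram n E"
proof -
  interpret split_system "{..n}" E
    by fact
  have "acyclic_graph E"
    unfolding acyclic_graph_def
  proof (rule notI, elim exE conjE)
    fix vs assume vs: "3 \<le> length vs" "distinct vs"
      "\<forall>i<length vs. {vs ! i, vs ! (Suc i mod length vs)} \<in> E"
    have len: "0 < length vs" "1 < length vs" "Suc (length vs - 1) = length vs"
      using vs(1) by linarith+
    have c: "{vs ! 0, vs ! 1} \<in> E"
      using vs(1) vs(3)[rule_format, OF len(1)] by simp
    obtain s t where st: "s < t" "\<And>d. d \<in> E \<Longrightarrow> separates d s t \<longleftrightarrow> d = {vs ! 0, vs ! 1}"
      using ex_sole_separator[OF c] by metis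
    have step: "vs ! i \<in> {s<..t} \<longleftrightarrow> vs ! (Suc i mod length vs) \<in> {s<..t}" if "0 < i" "i < length vs" for i
    proof -
      have "vs ! j = vs ! k \<longleftrightarrow> j = k" if "j < length vs" "k < length vs" for j k
        using nth_eq_iff_index_eq[OF vs(2) that] .
      moreover have "i \<noteq> Suc i mod length vs" "i = 1 \<Longrightarrow> Suc i mod length vs \<noteq> 0" "Suc i mod length vs < length vs"
        using that vs(1) by (auto simp: mod_Suc)
      ultimately have "vs ! i \<noteq> vs ! (Suc i mod length vs)" "{vs ! i, vs ! (Suc i mod length vs)} \<noteq> {vs ! 0, vs ! 1}"
        using that len by (auto simp: doubleton_eq_iff simp del: length_greater_0_conv)
      thus ?thesis
        using separates_iff_vertices[OF st(1)] st(2) vs(3) that by blast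
    qed
    have "vs ! 1 \<in> {s<..t} \<longleftrightarrow> vs ! Suc i \<in> {s<..t}" if "Suc i < length vs" for i
      using that by (induction i) (use step in auto)
    from this[of "length vs - 2"] have "vs ! 1 \<in> {s<..t} \<longleftrightarrow> vs ! (length vs - 1) \<in> {s<..t}"
      using vs(1) by (simp add: Suc_diff_Suc numeral_2_eq_2)
    moreover have "vs ! (length vs - 1) \<in> {s<..t} \<longleftrightarrow> vs ! 0 \<in> {s<..t}"
      using step[of "length vs - 1"] vs(1) unfolding len(3) by simp
    moreover have "vs ! 0 \<noteq> vs ! 1"
      using nth_eq_iff_index_eq[OF vs(2) len(1,2)] by simp
    ultimately show False
      using separates_iff_vertices[OF st(1), of "vs ! 0" "vs ! 1"] st(2)[OF c] by blast
  qed
  moreover have "chord n c" if "c \<in> E" for c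
    using chord_ex[OF that] assms(2)[OF that] by (auto simp: chord_def)
  moreover have "\<not> crossing c d" if "c \<in> E" "d \<in> E" for c d
    using crossing_overlap assms(2) not_overlap that by blast
  ultimately show ?thesis
    using card_eq finite_chords by (simp add: dissection_diagram_def)
qed

section \<open>Directions towards the root\<close>

lemma dissection_diagram_subset: "dissection_diagram n E \<Longrightarrow> c \<in> E \<Longrightarrow> c \<subseteq> {..n}"
  by (auto simp: dissection_diagram_def chord_def)

text \<open>A simple path from \<open>x\<close> to the root either meets \<open>y\<close>, and then
  the chord followed by its tail from \<open>y\<close> shows \<open>directed E x y\<close>, or it
  avoids \<open>y\<close> and can be prolonged by \<open>y\<close> at the front.\<close>

lemma directed_or_directed:
  assumes "dissection_diagram n E" "{x, y} \<in> E" "x \<noteq> y"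
  shows "directed E x y \<or> directed E y x"
proof -
  have "(x, 0) \<in> joined E"
    using dissection_diagram_joined[OF assms(1)] dissection_diagram_subset[OF assms(1,2)] by simp
  then obtain vs where vs: "distinct vs" "vs \<noteq> []" "hd vs = x" "last vs = 0"
    "successively (\<lambda>x y. {x, y} \<in> E) vs"
    using joined_path by blast
  show ?thesis
  proof (cases "y \<in> set vs")
    case True
    then obtain us ws where uw: "vs = us @ y # ws"
      by (meson split_list)
    hence "us \<noteq> []" "hd us = x"
      using vs(3) assms(3) by (auto simp: hd_append split: if_splits)
    hence "x \<in> set us"
      using hd_in_set by blast
    hence "directed E x y"
      unfolding directed_def using vs uw assms(2,3)
      by (intro exI[of _ ws]) (auto simp: successively_append_iff)
    thus ?thesis ..
  next
    case False
    obtain ws where "vs = x # ws"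
      using vs(2,3) by (cases vs) auto
    hence "directed E y x"
      unfolding directed_def using vs False assms(2)
      by (intro exI[of _ ws]) (auto simp: insert_commute)
    thus ?thesis ..
  qed
qed

text \<open>The sides \<open>s < t\<close> bound the two faces next to the chord, so that removing the chord
  from the tree disconnects the vertices in \<open>{s<..t}\<close> from the root.\<close>

lemma directed_iff:
  assumes "dissection_diagram n E" "{x, y} \<in> E" "x \<noteq> y" "s < t"
    and "\<And>d. d \<in> E \<Longrightarrow> separates d s t \<longleftrightarrow> d = {x, y}"
  shows "directed E x y \<longleftrightarrow> x \<in> {s<..t}"
proof -
  \<comment> \<open>The path from \<open>v\<close> to the root avoids \<open>u\<close>, hence does
    not use the chord and cannot pass between the two arcs of vertices. It ends in 0, outside
    \<open>{s<..t}\<close>, so \<open>v\<close> is outside and \<open>u\<close> inside.\<close>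
  have tail: "u \<in> {s<..t}" if dir: "directed E u v" and uv: "{u, v} = {x, y}" for u v
  proof -
    obtain vs where vs: "distinct (u # v # vs)" "last (v # vs) = 0"
      "successively (\<lambda>x y. {x, y} \<in> E) (u # v # vs)"
      using dir by (auto simp: directed_def)
    have "hd (v # vs) \<in> {s<..t} \<longleftrightarrow> last (v # vs) \<in> {s<..t}"
    proof (rule successively_invariant)
      show "successively (\<lambda>x y. {x, y} \<in> E) (v # vs)"
        using vs(3) by simp
      fix a b assume ab: "a \<in> set (v # vs)" "b \<in> set (v # vs)" "{a, b} \<in> E"
      have "u \<notin> {a, b}"
        using ab(1,2) vs(1) by auto
      hence "\<not> separates {a, b} s t"
        using assms(5)[OF ab(3)] uv by auto
      thus "a \<in> {s<..t} \<longleftrightarrow> b \<in> {s<..t}"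
        using separates_iff_vertices[OF assms(4)] by (cases "a = b") auto
    qed simp
    moreover have "(u \<in> {s<..t}) \<noteq> (v \<in> {s<..t})"
      using separates_iff_vertices[OF assms(4), of u v] assms(2,5) uv vs(1) by simp
    ultimately show ?thesis
      using vs(2) by simp
  qed
  have "(x \<in> {s<..t}) \<noteq> (y \<in> {s<..t})"
    using separates_iff_vertices[OF assms(4,3)] assms(2,5) by simp
  thus ?thesis
    using directed_or_directed[OF assms(1-3)] tail[of x y] tail[of y x] by (metis insert_commute)
qed

section \<open>Faces and the terms of the coproduct\<close>

text \<open>The only place where a restricted diagram is renumbered. Keeping original chords
  everywhere else allows the results of repeated restrictions to be compared as sets.\<close>

definition contracted :: "nat set \<Rightarrow> nat set set \<Rightarrow> diagram_algebra"
  where "contracted K E = diagram (card E) (contract_chords K E)"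

definition q_part :: "nat set \<Rightarrow> nat set set \<Rightarrow> nat set set \<Rightarrow> diagram_algebra"
  where "q_part K E C = (\<Prod>F\<in>side_classes K C. contracted F (inside E C F))"

definition r_part :: "nat set \<Rightarrow> nat set set \<Rightarrow> diagram_algebra"
  where "r_part K C = contracted (transversal K C) C"

text \<open>In the diagram obtained by restricting \<open>E\<close> to \<open>K\<close>, the chord \<open>c\<close> is directed from its smaller to
  its larger end point (as numbered before the restriction).\<close>

definition leaves_min :: "nat set \<Rightarrow> nat set set \<Rightarrow> nat set \<Rightarrow> bool"
  where "leaves_min K E c \<longleftrightarrow>
    (\<exists>s\<in>K. \<exists>t\<in>K. s < t \<and> (\<forall>d\<in>E. separates d s t \<longleftrightarrow> d = c) \<and> Min c \<in> {s<..t})"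

text \<open>Both predicates refer to the same original end point \<open>Min c\<close>, so directions
  before and after restriction are compared without renumbering.\<close>

definition k_part :: "nat set \<Rightarrow> nat set set \<Rightarrow> nat set set \<Rightarrow> nat"
  where "k_part K E C = card {c \<in> C. leaves_min K E c \<noteq> leaves_min (transversal K C) C c}"

lemma faces_eq: "faces n C = side_classes {..n} C"
proof -
  have "{(s, t). s \<le> n \<and> t \<le> n \<and> (\<forall>c\<in>C. s \<in> arc_sides c \<longleftrightarrow> t \<in> arc_sides c)} `` {s} = side_class {..n} C s"
    if "s \<le> n" for s
    using that by (auto simp: side_class_def separates_def)
  thus ?thesis
    unfolding faces_def side_classes_def quotient_def by auto
qed

lemma kept_sides_eq: "kept_sides n C = transversal {..n} C"
  by (simp add: kept_sides_def transversal_def faces_eq)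

text \<open>All of \<open>F\<close> lies in one part of \<open>{a, b}\<close>. A chord in the other
  closed half would have all of \<open>F\<close> in one of its own parts, and a chord leaving both
  halves would cross \<open>{a, b}\<close>; so \<open>{x, y}\<close>, which separates
  \<open>s\<close> and \<open>t\<close>, stays in the closed half of \<open>F\<close>.\<close>

lemma chord_not_crossing_face_vertices:
  assumes "x < y" "s \<in> F" "t \<in> F" "s \<in> {x..<y}" "t \<notin> {x..<y}"
    and d: "a < b" "\<forall>u\<in>F. \<forall>v\<in>F. \<not> separates {a, b} u v"
    and nc: "\<not> crossing {x, y} {a, b}" "\<not> crossing {a, b} {x, y}" and "u \<in> F" "v \<in> {x, y}"
  shows "if u \<in> arc_sides {a, b} then v \<in> {Min {a, b}..Max {a, b}} else v \<notin> {Min {a, b}<..<Max {a, b}}"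
proof -
  have nc: "\<not> (x < a \<and> a < y \<and> y < b)" "\<not> (a < x \<and> x < b \<and> b < y)"
    using nc unfolding crossing_def by blast+
  have "\<not> separates {a, b} s u" "\<not> separates {a, b} t u"
    using d(2) assms(2,3,10) by blast+
  hence st: "a \<le> s \<and> s < b \<longleftrightarrow> a \<le> u \<and> u < b" "a \<le> t \<and> t < b \<longleftrightarrow> a \<le> u \<and> u < b"
      "x \<le> s" "s < y" "t < x \<or> y \<le> t" "v = x \<or> v = y"
    using d(1) assms(4,5,11) by (auto simp: separates_def arc_sides_pair)
  have "if a \<le> u \<and> u < b then a \<le> v \<and> v \<le> b else \<not> (a < v \<and> v < b)"
  proof (cases "a \<le> u \<and> u < b")
    case True
    hence "a \<le> s" "s < b" "a \<le> t" "t < b"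
      using st(1,2) by simp_all
    hence "a \<le> x" "y \<le> b"
      using nc st(3-5) assms(1) by presburger+
    thus ?thesis
      using True st(6) assms(1) by auto
  next
    case False
    hence "s < a \<or> b \<le> s" "t < a \<or> b \<le> t"
      using st(1,2) by auto
    hence "\<not> (a < x \<and> x < b)" "\<not> (a < y \<and> y < b)"
      using nc st(3-5) by presburger+
    thus ?thesis
      using False st(6) by auto
  qed
  thus ?thesis
    using d(1) by (simp add: arc_sides_pair)
qed

text \<open>A chord that cuts \<open>F\<close> has its end points on the polygon of \<open>F\<close>
  by the preceding lemma. Conversely, a chord outside \<open>C\<close> cuts some class
  \<open>G\<close>; if \<open>G\<close> were not \<open>F\<close>, its end points would lie on two
  polygons separated by a chord of \<open>C\<close>, and it would be that chord.\<close>

lemma chords_inside_eq: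
  assumes "dissection_diagram n E" "C \<subseteq> E" "F \<in> side_classes {..n} C"
  shows "chords_inside n E C F = inside E C F"
proof -
  interpret split_system "{..n}" E
    by (rule split_system_dissection) fact
  have sub: "c \<subseteq> face_vertices n C F" if c: "c \<in> E - C" "cuts c F"
    and F: "F \<in> side_classes {..n} C" for c F
  proof
    obtain x y where xy: "x < y" "c = {x, y}"
      using chord_ex c(1) by blast
    have "c \<subseteq> {..n}"
      using dissection_diagram_subset assms(1) c(1) by blast
    obtain s t where st: "s \<in> F" "t \<in> F" "s \<in> {x..<y}" "t \<notin> {x..<y}"
      using c(2) xy by (auto simp: cuts_def separates_def arc_sides_pair)
    fix v assume v: "v \<in> c"
    have "if u \<in> arc_sides d then v \<in> {Min d..Max d} else v \<notin> {Min d<..<Max d}" if "d \<in> C" "u \<in> F" for d u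
    proof -
      have cd: "c \<in> E" "d \<in> E"
        using c(1) that(1) assms(2) by blast+
      obtain a b where ab: "a < b" "d = {a, b}"
        using chord_ex[OF cd(2)] by blast
      have "\<forall>c\<in>E. \<forall>d\<in>E. \<not> crossing c d"
        using assms(1) by (simp add: dissection_diagram_def)
      hence "\<not> crossing c d" "\<not> crossing d c"
        using cd by blast+
      hence "\<not> crossing {x, y} {a, b}" "\<not> crossing {a, b} {x, y}"
        by (simp_all add: xy(2) ab(2))
      moreover have "\<forall>u\<in>F. \<forall>v\<in>F. \<not> separates {a, b} u v"
        using side_classes_not_separated[OF F] that(1) ab(2) by simp
      moreover have "v \<in> {x, y}"
        using v xy(2) by simp
      ultimately show ?thesis
        unfolding ab(2) using chord_not_crossing_face_vertices[OF xy(1) st ab(1)] that(2) by blast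
    qed
    thus "v \<in> face_vertices n C F"
      using v \<open>c \<subseteq> {..n}\<close> unfolding face_vertices_def by blast
  qed
  have "cuts c F" if c: "c \<in> E - C" "c \<subseteq> face_vertices n C F" for c
  proof -
    obtain G where G: "G \<in> side_classes {..n} C" "cuts c G"
      using ex_cut_class[OF assms(2)] c(1) by blast
    have "F = G"
    proof (rule ccontr)
      assume "F \<noteq> G"
      then obtain d where d: "d \<in> C" "\<And>s t. s \<in> F \<Longrightarrow> t \<in> G \<Longrightarrow> separates d s t"
        using side_classes_separated[OF assms(3) G(1)] by blast
      obtain a b where ab: "a < b" "d = {a, b}"
        using chord_ex assms(2) d(1) by blast
      obtain s t where st: "s \<in> F" "t \<in> G"
        using side_classes_nonempty assms(3) G(1) by blast
      \<comment> \<open>The vertices common to two faces in different parts of \<open>d\<close> are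
        at most the end points of \<open>d\<close>.\<close>
      have "v \<in> d" if v: "v \<in> c" for v
      proof -
        have "v \<in> face_vertices n C F" "v \<in> face_vertices n C G"
          using v c(2) sub[OF c(1) G(2,1)] by blast+
        hence "if s \<in> arc_sides d then v \<in> {Min d..Max d} else v \<notin> {Min d<..<Max d}"
          "if t \<in> arc_sides d then v \<in> {Min d..Max d} else v \<notin> {Min d<..<Max d}"
          using st d(1) unfolding face_vertices_def by blast+
        thus ?thesis
          using d(2)[OF st] ab by (auto simp: separates_def split: if_splits)
      qed
      moreover obtain x y where "x < y" "c = {x, y}"
        using chord_ex c(1) by blast
      ultimately have "c = d"
        using ab by auto
      thus False
        using c(1) d(1) by blast
    qed
    thus ?thesis
      using G(2) by simp
  qed
  thus ?thesis
    using sub[OF _ _ assms(3)] unfolding chords_inside_def inside_def by blast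
qed

lemma (in split_system) sole_separator_inside:
  assumes "F \<in> side_classes K C" "cuts c F" "c \<in> E" "C \<subseteq> E" "c \<notin> C"
    and "s \<in> K" "t \<in> K" "\<And>d. d \<in> E \<Longrightarrow> separates d s t \<longleftrightarrow> d = c"
  shows "s \<in> F \<and> t \<in> F"
proof -
  have "\<not> separates d s t" if "d \<in> C" for d
    using that assms(4,5,8) by blast
  hence "t \<in> side_class K C s"
    using assms(7) by (simp add: side_class_def)
  hence "cuts c (side_class K C s)"
    using side_class_mem[OF assms(6)] assms(3,8) unfolding cuts_def by blast
  hence "side_class K C s = F"
    using cut_class_unique[OF assms(4,3) _ assms(1) _ assms(2)] assms(6) by (simp add: side_classes_def)
  thus ?thesis
    using \<open>t \<in> side_class K C s\<close> side_class_mem[OF assms(6)] by blast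
qed

text \<open>Chords of \<open>C\<close> do not separate sides of \<open>F\<close>, and chords neither
  in \<open>C\<close> nor inside the face do not cut \<open>F\<close>. So a pair of sides of
  \<open>F\<close> separated by \<open>c\<close> alone within the face is separated by
  \<open>c\<close> alone in all of \<open>E\<close>; conversely,
  \<open>sole_separator_inside\<close> puts the pair into \<open>F\<close>.\<close>

lemma (in split_system) leaves_min_inside:
  assumes "C \<subseteq> E" "F \<in> side_classes K C" "c \<in> inside E C F"
  shows "leaves_min F (inside E C F) c \<longleftrightarrow> leaves_min K E c"
proof -
  have c: "c \<in> E" "c \<notin> C" "cuts c F"
    using assms(3) by (auto simp: inside_def)
  show ?thesis
  proof
    assume "leaves_min K E c"
    then obtain s t where st: "s \<in> K" "t \<in> K" "s < t" "\<forall>d\<in>E. separates d s t \<longleftrightarrow> d = c"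
      "Min c \<in> {s<..t}"
      unfolding leaves_min_def by blast
    have "s \<in> F" "t \<in> F"
      using sole_separator_inside[OF assms(2) c(3,1) assms(1) c(2) st(1,2)] st(4) by simp_all
    moreover have "\<forall>d\<in>inside E C F. separates d s t \<longleftrightarrow> d = c"
      using st(4) by (auto simp: inside_def)
    ultimately show "leaves_min F (inside E C F) c"
      unfolding leaves_min_def using st(3,5) by blast
  next
    assume "leaves_min F (inside E C F) c"
    then obtain s t where st: "s \<in> F" "t \<in> F" "s < t" "\<forall>d\<in>inside E C F. separates d s t \<longleftrightarrow> d = c"
      "Min c \<in> {s<..t}"
      unfolding leaves_min_def by blast
    have "separates d s t \<longleftrightarrow> d = c" if "d \<in> E" for d
    proof (cases "d \<in> inside E C F")
      case True
      then show ?thesis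
        using st(4) by blast
    next
      case False
      then show ?thesis
        using side_classes_not_separated[OF assms(2) st(1,2), of d] that st(1,2) assms(3)
        unfolding inside_def cuts_def by blast
    qed
    thus "leaves_min K E c"
      unfolding leaves_min_def using st side_classes_subset[OF assms(2)] by blast
  qed
qed

section \<open>The terms of the coproduct of a restricted diagram\<close>

context split_system
begin

lemma contract_sides_eq: "contract K ` K = {..card E}"
  using contract_image[OF finite_sides] card_eq by (simp add: lessThan_Suc_atMost)

lemma dissection_diagram_contract: "dissection_diagram (card E) (contract_chords K E)"
proof (rule dissection_split_system)
  show "split_system {..card E} (contract_chords K E)"
    using split_system_contract by (simp only: contract_sides_eq)
  show "c \<subseteq> {..card E}" if c: "c \<in> contract_chords K E" for c
  proof -
    obtain d where "d \<in> E" "c = contract K ` d"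
      using c by (auto simp: contract_chords_def)
    then obtain a b where "a < b" "b < card K" "c = {a, b}"
      using contract_chord_ex by blast
    thus ?thesis
      using card_eq by auto
  qed
qed

lemma directed_contract_iff:
  assumes "{x, y} \<in> E" "x \<noteq> y" "s \<in> K" "t \<in> K" "s < t" "\<And>d. d \<in> E \<Longrightarrow> separates d s t \<longleftrightarrow> d = {x, y}"
  shows "directed (contract_chords K E) (contract K x) (contract K y) \<longleftrightarrow> x \<in> {s<..t}"
proof -
  have "directed (contract_chords K E) (contract K x) (contract K y) \<longleftrightarrow>
      contract K x \<in> {contract K s<..contract K t}"
  proof (rule directed_iff[OF dissection_diagram_contract])
    show "{contract K x, contract K y} \<in> contract_chords K E"
      using imageI[OF assms(1), of "image (contract K)"] by (simp add: contract_chords_def)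
    obtain a b where "a < b" "contract K ` {x, y} = {a, b}"
      using contract_chord_ex[OF assms(1)] by blast
    hence "a \<in> {contract K x, contract K y}" "b \<in> {contract K x, contract K y}"
      by auto
    thus "contract K x \<noteq> contract K y"
      using \<open>a < b\<close> by force
    show "contract K s < contract K t"
      using contract_less_iff finite_sides assms(3-5) by simp
    fix d assume "d \<in> contract_chords K E"
    then obtain e where e: "e \<in> E" "d = contract K ` e"
      by (auto simp: contract_chords_def)
    have "separates d (contract K s) (contract K t) \<longleftrightarrow> e = {x, y}"
      using separates_contract[OF e(1) assms(3,4)] e assms(6) by simp
    also have "\<dots> \<longleftrightarrow> d = contract K ` {x, y}"
      using inj_on_eq_iff[OF inj_on_contract_chord e(1) assms(1)] e(2) by simp
    finally show "separates d (contract K s) (contract K t) \<longleftrightarrow> d = {contract K x, contract K y}"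
      by simp
  qed
  thus ?thesis
    using contract_between_iff[OF finite_sides assms(3,4)] by simp
qed

lemma directed_contract:
  assumes "{a, b} \<in> E" "a < b"
  shows "directed (contract_chords K E) (contract K a) (contract K b) \<longleftrightarrow> leaves_min K E {a, b}"
    and "directed (contract_chords K E) (contract K b) (contract K a) \<longleftrightarrow> \<not> leaves_min K E {a, b}"
proof -
  obtain s t where st: "s \<in> K" "t \<in> K" "s < t" "\<And>d. d \<in> E \<Longrightarrow> separates d s t \<longleftrightarrow> d = {a, b}"
    using ex_sole_separator[OF assms(1)] by metis
  \<comment> \<open>Every pair of sides separated by this chord alone decides its direction, so the
    existential quantifiers in \<open>leaves_min\<close> are unambiguous.\<close>
  have a: "directed (contract_chords K E) (contract K a) (contract K b) \<longleftrightarrow> a \<in> {s'<..t'}"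
    if "s' \<in> K" "t' \<in> K" "s' < t'" "\<And>d. d \<in> E \<Longrightarrow> separates d s' t' \<longleftrightarrow> d = {a, b}" for s' t'
    using directed_contract_iff[OF assms(1) _ that] assms(2) by simp
  have b: "directed (contract_chords K E) (contract K b) (contract K a) \<longleftrightarrow> b \<in> {s<..t}"
    using directed_contract_iff[of b a s t] st assms by (simp add: insert_commute)
  have "Min {a, b} = a"
    using assms(2) by simp
  show 1: "directed (contract_chords K E) (contract K a) (contract K b) \<longleftrightarrow> leaves_min K E {a, b}"
  proof
    assume "directed (contract_chords K E) (contract K a) (contract K b)"
    thus "leaves_min K E {a, b}"
      using a[OF st] st unfolding leaves_min_def \<open>Min {a, b} = a\<close> by blast
  next
    assume "leaves_min K E {a, b}"
    then obtain s' t' where "s' \<in> K" "t' \<in> K" "s' < t'" "\<forall>d\<in>E. separates d s' t' \<longleftrightarrow> d = {a, b}"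
      "a \<in> {s'<..t'}"
      unfolding leaves_min_def \<open>Min {a, b} = a\<close> by blast
    thus "directed (contract_chords K E) (contract K a) (contract K b)"
      using a by blast
  qed
  have "(a \<in> {s<..t}) \<noteq> (b \<in> {s<..t})"
    using separates_iff_vertices[OF st(3), of a b] st(4) assms by simp
  thus "directed (contract_chords K E) (contract K b) (contract K a) \<longleftrightarrow> \<not> leaves_min K E {a, b}"
    using a[OF st] b 1 by blast
qed

text \<open>By \<open>contract_contract\<close>, contracting onto \<open>K\<close> and then onto the
  image of a class \<open>F\<close> is contracting onto \<open>F\<close>, so the face factors of the
  renumbered diagram are those of the restricted one.\<close>

lemma q_op_contract:
  assumes "C \<subseteq> E"
  shows "q_op (card E) (contract_chords K E) (contract_chords K C) = q_part K E C"
proof -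
  let ?n = "card E" and ?E = "contract_chords K E" and ?C = "contract_chords K C"
  have C: "?C \<subseteq> ?E"
    using assms unfolding contract_chords_def by blast
  have fac: "side_classes {..?n} ?C = (`) (contract K) ` side_classes K C"
    using side_classes_contract[OF assms] by (simp only: contract_sides_eq)
  have inj: "inj_on ((`) (contract K)) (side_classes K C)"
    using side_classes_subset by (intro inj_on_subset[OF inj_on_image_Pow[OF inj_on_contract[OF finite_sides]]]) blast
  have "q_op ?n ?E ?C =
      (\<Prod>F\<in>side_classes K C. diagram (card (contract K ` F) - 1) (q_face ?n ?E ?C (contract K ` F)))"
    unfolding q_op_def faces_eq fac by (simp add: prod.reindex[OF inj])
  also have "\<dots> = q_part K E C"
    unfolding q_part_def
  proof (rule prod.cong[OF refl])
    fix F assume F: "F \<in> side_classes K C"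
    note sub = side_classes_subset[OF F]
    have "card (contract K ` F) = card F"
      using inj_on_subset[OF inj_on_contract[OF finite_sides] sub] by (rule card_image)
    moreover have "chords_inside ?n ?E ?C (contract K ` F) = contract_chords K (inside E C F)"
      using chords_inside_eq[OF dissection_diagram_contract C] fac F inside_contract[OF assms sub] by simp
    moreover have "card F - 1 = card (inside E C F)"
      using split_system.card_eq[OF split_system_inside[OF assms F]] by simp
    ultimately show "diagram (card (contract K ` F) - 1) (q_face ?n ?E ?C (contract K ` F)) =
        contracted F (inside E C F)"
      by (simp add: q_face_def contracted_def contract_chords_contract[OF finite_sides sub])
  qed
  finally show ?thesis .
qed

lemma kept_sides_contract:
  assumes "C \<subseteq> E"
  shows "kept_sides (card E) (contract_chords K C) = contract K ` transversal K C"
  using transversal_contract[OF assms] by (simp only: kept_sides_eq contract_sides_eq)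

lemma r_chords_contract:
  assumes "C \<subseteq> E"
  shows "r_chords (card E) (contract_chords K C) = contract_chords (transversal K C) C"
  by (simp add: r_chords_def kept_sides_contract[OF assms]
      contract_chords_contract[OF finite_sides transversal_subset])

lemma card_contract_chords: "C \<subseteq> E \<Longrightarrow> card (contract_chords K C) = card C"
  unfolding contract_chords_def by (rule card_image) (rule inj_on_subset[OF inj_on_contract_chord])

lemma r_op_contract:
  assumes "C \<subseteq> E"
  shows "r_op (card E) (contract_chords K C) = r_part K C"
  by (simp add: r_op_def r_part_def contracted_def r_chords_contract card_contract_chords assms)

lemma k_number_contract:
  assumes "C \<subseteq> E"
  shows "k_number (card E) (contract_chords K E) (contract_chords K C) = k_part K E C"
proof -
  let ?n = "card E" and ?E = "contract_chords K E" and ?C = "contract_chords K C"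
  define P where "P c \<longleftrightarrow> (\<exists>i j. c = {i, j} \<and> directed ?E i j \<and>
    directed (r_chords ?n ?C) (contract (kept_sides ?n ?C) j) (contract (kept_sides ?n ?C) i))" for c
  interpret T: split_system "transversal K C" C
    by (rule split_system_transversal) fact
  have tr: "contract (kept_sides ?n ?C) (contract K v) = contract (transversal K C) v" for v
    using contract_contract[OF finite_sides transversal_subset] by (simp add: kept_sides_contract assms)
  have P: "P (contract K ` c) \<longleftrightarrow> leaves_min K E c \<noteq> leaves_min (transversal K C) C c" if c: "c \<in> C" for c
  proof -
    obtain a b where ab: "a < b" "c = {a, b}"
      using chord_ex assms c by blast
    \<comment> \<open>\<open>k_number\<close> admits both orders of the two end points; exactly one
      of them agrees with the direction in the diagram before r is applied.\<close>
    have "P (contract K ` c) \<longleftrightarrow>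
      directed ?E (contract K a) (contract K b) \<and>
        directed (r_chords ?n ?C) (contract (transversal K C) b) (contract (transversal K C) a) \<or>
      directed ?E (contract K b) (contract K a) \<and>
        directed (r_chords ?n ?C) (contract (transversal K C) a) (contract (transversal K C) b)"
      unfolding P_def by (simp add: ab doubleton_eq_iff conj_disj_distribR ex_disj_distrib tr)
    also have "\<dots> \<longleftrightarrow> leaves_min K E c \<noteq> leaves_min (transversal K C) C c"
      using directed_contract[of a b] T.directed_contract[of a b] c ab assms
      by (auto simp: r_chords_contract)
    finally show ?thesis .
  qed
  have "k_number ?n ?E ?C = card {c \<in> ?C. P c}"
    by (simp add: k_number_def P_def)
  also have "{c \<in> ?C. P c} = (`) (contract K) ` {c \<in> C. leaves_min K E c \<noteq> leaves_min (transversal K C) C c}"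
    using P unfolding contract_chords_def by blast
  also have "card \<dots> = k_part K E C"
    unfolding k_part_def using assms by (intro card_image inj_on_subset[OF inj_on_contract_chord]) auto
  finally show ?thesis .
qed

lemma diagram_coproduct_contract:
  "diagram_coproduct (card E) (contract_chords K E) =
    (\<Sum>C\<in>Pow E. (-1) ^ k_part K E C *\<^sub>s (q_part K E C \<otimes> r_part K C))"
proof -
  have "Pow (contract_chords K E) = contract_chords K ` Pow E"
    unfolding contract_chords_def by (simp add: image_Pow_surj)
  moreover have "inj_on (contract_chords K) (Pow E)"
    unfolding contract_chords_def using inj_on_image_Pow[OF inj_on_contract_chord] .
  ultimately show ?thesis
    unfolding diagram_coproduct_def
    by (simp add: sum.reindex q_op_contract r_op_contract k_number_contract)
qed

end

section \<open>Bialgebras on monoid algebras\<close>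

abbreviation linear_map :: "(('a \<Rightarrow>\<^sub>0 rat) \<Rightarrow> ('b \<Rightarrow>\<^sub>0 rat)) \<Rightarrow> bool"
  where "linear_map \<equiv> Vector_Spaces.linear scale scale"

definition extend :: "('a \<Rightarrow> ('b \<Rightarrow>\<^sub>0 rat)) \<Rightarrow> ('a \<Rightarrow>\<^sub>0 rat) \<Rightarrow> ('b \<Rightarrow>\<^sub>0 rat)"
  where "extend f p = (\<Sum>x\<in>Poly_Mapping.keys p. Poly_Mapping.lookup p x *\<^sub>s f x)"

abbreviation basis :: "'a \<Rightarrow> ('a \<Rightarrow>\<^sub>0 rat)"
  where "basis x \<equiv> Poly_Mapping.single x 1"

interpretation scale: vector_space "scale :: rat \<Rightarrow> ('a \<Rightarrow>\<^sub>0 rat) \<Rightarrow> _"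
  by (rule vector_space_scale)

lemma scale_single: "c *\<^sub>s Poly_Mapping.single x d = Poly_Mapping.single x (c * d)"
  by (rule poly_mapping_eqI) (simp add: lookup_single when_def)

lemma linear_mapI:
  assumes "\<And>a b. f (a + b) = f a + f b" "\<And>c a. f (c *\<^sub>s a) = c *\<^sub>s f a"
  shows "linear_map f"
  unfolding Vector_Spaces.linear_iff by (intro conjI allI vector_space_scale assms)

lemma linear_map_add: "linear_map f \<Longrightarrow> f (a + b) = f a + f b"
  and linear_map_scale: "linear_map f \<Longrightarrow> f (c *\<^sub>s a) = c *\<^sub>s f a"
  unfolding Vector_Spaces.linear_iff by blast+

lemma linear_map_zero: "linear_map f \<Longrightarrow> f 0 = 0"
  using linear_map_scale[of f 0 0] by simp

lemma linear_map_sum: "linear_map f \<Longrightarrow> f (\<Sum>i\<in>I. g i) = (\<Sum>i\<in>I. f (g i))"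
  by (induction I rule: infinite_finite_induct) (simp_all add: linear_map_zero linear_map_add)

lemma linear_map_id: "linear_map id"
  and linear_map_comp: "linear_map f \<Longrightarrow> linear_map g \<Longrightarrow> linear_map (\<lambda>a. f (g a))"
  by (auto intro!: linear_mapI simp: linear_map_add linear_map_scale)

lemma sum_basis: "p = (\<Sum>x\<in>Poly_Mapping.keys p. Poly_Mapping.lookup p x *\<^sub>s basis x)"
  by (rule poly_mapping_eqI)
    (simp add: scale_single lookup_sum lookup_single when_def in_keys_iff)

lemma linear_map_eqI:
  assumes "linear_map f" "linear_map g" "\<And>x. x \<in> Poly_Mapping.keys p \<Longrightarrow> f (basis x) = g (basis x)"
  shows "f p = g p"
proof -
  have *: "h p = (\<Sum>x\<in>Poly_Mapping.keys p. Poly_Mapping.lookup p x *\<^sub>s h (basis x))"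
    if "linear_map h" for h :: "('a \<Rightarrow>\<^sub>0 rat) \<Rightarrow> ('b \<Rightarrow>\<^sub>0 rat)"
    using arg_cong[OF sum_basis, of h p] that by (simp add: linear_map_sum linear_map_scale)
  show ?thesis
    using *[OF assms(1)] *[OF assms(2)] assms(3) by simp
qed

text \<open>Cancellation can shrink the keys of a sum; a common finite index set makes linearity
  visible term by term.\<close>

lemma extend_superset:
  assumes "finite A" "Poly_Mapping.keys p \<subseteq> A"
  shows "extend f p = (\<Sum>x\<in>A. Poly_Mapping.lookup p x *\<^sub>s f x)"
  unfolding extend_def using assms by (intro sum.mono_neutral_left) (auto simp: in_keys_iff)

lemma linear_map_extend: "linear_map (extend f)"
proof (rule linear_mapI)
  fix a b :: "'a \<Rightarrow>\<^sub>0 rat" and c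
  let ?A = "Poly_Mapping.keys a \<union> Poly_Mapping.keys b"
  have "Poly_Mapping.keys (a + b) \<subseteq> ?A"
    by (rule Poly_Mapping.keys_add)
  thus "extend f (a + b) = extend f a + extend f b"
    by (simp add: extend_superset[of ?A] lookup_add scale.scale_left_distrib sum.distrib)
  have "Poly_Mapping.keys (c *\<^sub>s a) \<subseteq> Poly_Mapping.keys a"
    by (auto simp: in_keys_iff)
  thus "extend f (c *\<^sub>s a) = c *\<^sub>s extend f a"
    by (simp add: extend_superset[of "Poly_Mapping.keys a"] scale.scale_sum_right)
qed

lemma extend_basis [simp]: "extend f (basis x) = f x"
  by (simp add: extend_def)

lemma tensor_lift_eq: "tensor_lift f = extend (\<lambda>(x, y). f (basis x) (basis y))"
  by (auto simp: tensor_lift_def extend_def split_def)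

lemma linear_map_tensor_lift: "linear_map (tensor_lift f)"
  unfolding tensor_lift_eq by (rule linear_map_extend)

lemma tensor_lift_basis [simp]: "tensor_lift f (basis (x, y)) = f (basis x) (basis y)"
  by (simp add: tensor_lift_eq)

lemma lookup_tensor [simp]:
  "Poly_Mapping.lookup (a \<otimes> b) (x, y) = Poly_Mapping.lookup a x * Poly_Mapping.lookup b y"
proof -
  have "Poly_Mapping.lookup (a \<otimes> b) (x, y) =
      (\<Sum>u\<in>Poly_Mapping.keys a. \<Sum>v\<in>Poly_Mapping.keys b.
        if u = x then if v = y then Poly_Mapping.lookup a u * Poly_Mapping.lookup b v else 0 else 0)"
    unfolding tensor_def lookup_sum by (intro sum.cong) (auto simp: lookup_single when_def)
  also have "\<dots> = (\<Sum>u\<in>Poly_Mapping.keys a.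
      if u = x then Poly_Mapping.lookup a u * Poly_Mapping.lookup b y else 0)"
    by (intro sum.cong) (auto simp: in_keys_iff)
  also have "\<dots> = Poly_Mapping.lookup a x * Poly_Mapping.lookup b y"
    by (auto simp: in_keys_iff)
  finally show ?thesis .
qed

lemma linear_map_tensor_left: "linear_map (\<lambda>a. a \<otimes> b)"
  and linear_map_tensor_right: "linear_map (\<lambda>b. a \<otimes> b)"
  by (auto intro!: linear_mapI poly_mapping_eqI simp: lookup_add algebra_simps)

lemma scale_mult_right: "p * (c *\<^sub>s q) = c *\<^sub>s (p * q)" for p q :: "'m::comm_monoid_add \<Rightarrow>\<^sub>0 rat"
  using scale_mult_left[of c q p] by (simp add: mult.commute)

lemma linear_map_mult_left: "linear_map (\<lambda>a. a * (b :: 'a::comm_monoid_add \<Rightarrow>\<^sub>0 rat))"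
  and linear_map_mult_right: "linear_map (\<lambda>b. a * (b :: 'a::comm_monoid_add \<Rightarrow>\<^sub>0 rat))"
  by (auto intro!: linear_mapI simp: scale_eq_times algebra_simps)

lemma linear_map_scale_map: "linear_map f \<Longrightarrow> linear_map (\<lambda>a. c *\<^sub>s f a)"
  by (auto intro!: linear_mapI simp: linear_map_add linear_map_scale scale.scale_right_distrib mult.commute)

lemma linear_map_plus: "linear_map f \<Longrightarrow> linear_map g \<Longrightarrow> linear_map (\<lambda>a. f a + g a)"
  by (auto intro!: linear_mapI simp: linear_map_add linear_map_scale scale.scale_right_distrib)

lemma linear_map_diff: "linear_map f \<Longrightarrow> linear_map g \<Longrightarrow> linear_map (\<lambda>a. f a - g a)"
  by (auto intro!: linear_mapI simp: linear_map_add linear_map_scale scale.scale_right_diff_distrib)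

lemma linear_map_sum_map: "(\<And>i. i \<in> I \<Longrightarrow> linear_map (f i)) \<Longrightarrow> linear_map (\<lambda>a. \<Sum>i\<in>I. f i a)"
proof (induction I rule: infinite_finite_induct)
  case (insert i I)
  then show ?case
    by (auto intro!: linear_map_plus)
qed (auto intro!: linear_mapI)

lemma tensor_lift_tensor:
  assumes "\<And>a. linear_map (f a)" "\<And>b. linear_map (\<lambda>a. f a b)"
  shows "tensor_lift f (a \<otimes> b) = f a b"
proof (rule linear_map_eqI[of "\<lambda>a. tensor_lift f (a \<otimes> b)" "\<lambda>a. f a b"])
  show "linear_map (\<lambda>a. tensor_lift f (a \<otimes> b))"
    by (rule linear_map_comp[OF linear_map_tensor_lift linear_map_tensor_left])
  fix x
  show "tensor_lift f (basis x \<otimes> b) = f (basis x) b"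
    by (rule linear_map_eqI[of "\<lambda>b. tensor_lift f (basis x \<otimes> b)"])
      (auto intro: linear_map_comp[OF linear_map_tensor_lift linear_map_tensor_right] assms(1)
        simp: single_tensor_single)
qed (rule assms(2))

lemma linear_map_tensor_map: "linear_map (tensor_map f g)"
  unfolding tensor_map_def by (rule linear_map_tensor_lift)

lemma tensor_map_tensor:
  assumes "linear_map f" "linear_map g"
  shows "tensor_map f g (a \<otimes> b) = f a \<otimes> g b"
  unfolding tensor_map_def using assms
  by (intro tensor_lift_tensor linear_map_comp[OF linear_map_tensor_right]
      linear_map_comp[OF linear_map_tensor_left])

lemma tensor_map_basis: "tensor_map f g (basis (x, y)) = f (basis x) \<otimes> g (basis y)"
  by (simp add: tensor_map_def)

lemma linear_map_tensor_assoc: "linear_map tensor_assoc"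
  unfolding tensor_assoc_def by (rule linear_map_tensor_lift)

lemma tensor_assoc_basis: "tensor_assoc (basis ((x, y), z)) = basis (x, (y, z))"
  by (simp add: tensor_assoc_def single_tensor_single)

lemma lookup_tensor_assoc:
  "Poly_Mapping.lookup (tensor_assoc t) (x, (y, z)) = Poly_Mapping.lookup t ((x, y), z)"
proof -
  have "tensor_assoc t = extend (\<lambda>((x, y), z). basis (x, (y, z))) t"
    by (rule linear_map_eqI[OF linear_map_tensor_assoc linear_map_extend])
      (auto simp: tensor_assoc_basis split: prod.splits)
  also have "Poly_Mapping.lookup \<dots> (x, (y, z)) = (\<Sum>w\<in>Poly_Mapping.keys t. if w = ((x, y), z) then Poly_Mapping.lookup t w else 0)"
    unfolding extend_def lookup_sum by (intro sum.cong) (auto simp: lookup_single when_def split: if_splits)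
  also have "\<dots> = Poly_Mapping.lookup t ((x, y), z)"
    by (simp add: in_keys_iff)
  finally show ?thesis .
qed

lemma tensor_assoc_tensor: "tensor_assoc ((a \<otimes> b) \<otimes> c) = a \<otimes> (b \<otimes> c)"
  by (rule poly_mapping_eqI) (auto simp: lookup_tensor_assoc mult.assoc)

lemma linear_map_mult_eqI:
  fixes f :: "('a::comm_monoid_add \<Rightarrow>\<^sub>0 rat) \<Rightarrow> ('b::comm_monoid_add \<Rightarrow>\<^sub>0 rat)"
  assumes "linear_map f" "\<And>x y. f (basis (x + y)) = f (basis x) * f (basis y)"
  shows "f (a * b) = f a * f b"
proof (rule linear_map_eqI[of "\<lambda>a. f (a * b)" "\<lambda>a. f a * f b"])
  show "linear_map (\<lambda>a. f (a * b))" "linear_map (\<lambda>a. f a * f b)"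
    by (rule linear_map_comp[OF assms(1) linear_map_mult_left]
        linear_map_comp[OF linear_map_mult_left assms(1)])+
  fix x
  show "f (basis x * b) = f (basis x) * f b"
  proof (rule linear_map_eqI[of "\<lambda>b. f (basis x * b)" "\<lambda>b. f (basis x) * f b"])
    show "linear_map (\<lambda>b. f (basis x * b))" "linear_map (\<lambda>b. f (basis x) * f b)"
      by (rule linear_map_comp[OF assms(1) linear_map_mult_right]
          linear_map_comp[OF linear_map_mult_right assms(1)])+
  qed (simp add: mult_single assms(2))
qed

text \<open>Writing \<open>a \<otimes> b\<close> as the product of \<open>a \<otimes> 1\<close> and
  \<open>1 \<otimes> b\<close> reduces the claim to the two embeddings being multiplicative, each a
  statement about a linear map of one argument; commutativity exchanges the middle factors.\<close>

lemma tensor_mult: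
  fixes a c :: "'a::comm_monoid_add \<Rightarrow>\<^sub>0 rat" and b d :: "'b::comm_monoid_add \<Rightarrow>\<^sub>0 rat"
  shows "(a \<otimes> b) * (c \<otimes> d) = (a * c) \<otimes> (b * d)"
proof -
  have one: "1 = basis (0 :: 'm::comm_monoid_add)"
    by simp
  have factor: "a \<otimes> b = (a \<otimes> 1) * (1 \<otimes> b)"
    for a :: "'a \<Rightarrow>\<^sub>0 rat" and b :: "'b \<Rightarrow>\<^sub>0 rat"
  proof (rule linear_map_eqI[of "\<lambda>a. a \<otimes> b" "\<lambda>a. (a \<otimes> 1) * (1 \<otimes> b)"])
    show "linear_map (\<lambda>a. (a \<otimes> (1 :: 'b \<Rightarrow>\<^sub>0 rat)) * ((1 :: 'a \<Rightarrow>\<^sub>0 rat) \<otimes> b))"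
      by (rule linear_map_comp[OF linear_map_mult_left linear_map_tensor_left])
    fix x :: 'a
    show "basis x \<otimes> b = (basis x \<otimes> 1) * (1 \<otimes> b)"
    proof (rule linear_map_eqI[of "\<lambda>b. basis x \<otimes> b" "\<lambda>b. (basis x \<otimes> 1) * (1 \<otimes> b)"])
      show "linear_map (\<lambda>b. (basis x \<otimes> (1 :: 'b \<Rightarrow>\<^sub>0 rat)) * ((1 :: 'a \<Rightarrow>\<^sub>0 rat) \<otimes> b))"
        by (rule linear_map_comp[OF linear_map_mult_right linear_map_tensor_right])
    qed (simp_all only: linear_map_tensor_right one single_tensor_single mult_single, simp)
  qed (rule linear_map_tensor_left)
  have left: "(a * c) \<otimes> 1 = (a \<otimes> 1) * (c \<otimes> (1 :: 'b \<Rightarrow>\<^sub>0 rat))" for a c :: "'a \<Rightarrow>\<^sub>0 rat"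
    by (rule linear_map_mult_eqI[OF linear_map_tensor_left])
      (simp only: one single_tensor_single mult_single, simp)
  have right: "1 \<otimes> (b * d) = ((1 :: 'a \<Rightarrow>\<^sub>0 rat) \<otimes> b) * (1 \<otimes> d)" for b d :: "'b \<Rightarrow>\<^sub>0 rat"
    by (rule linear_map_mult_eqI[OF linear_map_tensor_right])
      (simp only: one single_tensor_single mult_single, simp)
  have "(a \<otimes> b) * (c \<otimes> d) = ((a \<otimes> 1) * (c \<otimes> 1)) * ((1 \<otimes> b) * (1 \<otimes> d))"
    using factor[of a b] factor[of c d] by (simp add: mult_ac)
  also have "\<dots> = (a * c) \<otimes> (b * d)"
    using factor[of "a * c" "b * d"] by (simp add: left right)
  finally show ?thesis .
qed

lemma tensor_one: "(1 :: 'a::comm_monoid_add \<Rightarrow>\<^sub>0 rat) \<otimes> (1 :: 'b::comm_monoid_add \<Rightarrow>\<^sub>0 rat) = 1"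
  using single_tensor_single[of "0 :: 'a" 1 "0 :: 'b" 1] by (simp add: zero_prod_def[symmetric])

lemma tensor_prod: "(\<Prod>i\<in>I. a i \<otimes> b i) = (\<Prod>i\<in>I. a i) \<otimes> (\<Prod>i\<in>I. b i)"
  for a :: "'i \<Rightarrow> ('a::comm_monoid_add \<Rightarrow>\<^sub>0 rat)" and b :: "'i \<Rightarrow> ('b::comm_monoid_add \<Rightarrow>\<^sub>0 rat)"
  by (induction I rule: infinite_finite_induct) (simp_all add: tensor_one tensor_mult)

section \<open>Algebra morphisms\<close>

lemma algebra_hom_linear: "algebra_hom f \<Longrightarrow> linear_map f"
  and algebra_hom_one: "algebra_hom f \<Longrightarrow> f 1 = 1"
  and algebra_hom_mult: "algebra_hom f \<Longrightarrow> f (a * b) = f a * f b"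
  by (auto simp: algebra_hom_def)

lemma algebra_hom_prod: "algebra_hom f \<Longrightarrow> f (\<Prod>i\<in>I. a i) = (\<Prod>i\<in>I. f (a i))"
  by (induction I rule: infinite_finite_induct) (simp_all add: algebra_hom_one algebra_hom_mult)

lemma algebra_hom_id: "algebra_hom id"
  by (simp add: algebra_hom_def linear_map_id)

lemma algebra_hom_comp: "algebra_hom f \<Longrightarrow> algebra_hom g \<Longrightarrow> algebra_hom (\<lambda>a. f (g a))"
  by (auto simp: algebra_hom_def intro: linear_map_comp)

lemma algebra_homI:
  assumes "linear_map f" "f (basis 0) = 1" "\<And>x y. f (basis (x + y)) = f (basis x) * f (basis y)"
  shows "algebra_hom f"
  using assms linear_map_mult_eqI[OF assms(1,3)] by (simp add: algebra_hom_def)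

lemma algebra_hom_tensor_map:
  assumes "algebra_hom f" "algebra_hom g"
  shows "algebra_hom (tensor_map f g)"
proof (rule algebra_homI[OF linear_map_tensor_map])
  show "tensor_map f g (basis 0) = 1"
    \<comment> \<open>Deleting \<open>single_one\<close> lets the argument stay a basis element
      until \<open>tensor_map_basis\<close> applies.\<close>
    using assms by (simp add: zero_prod_def tensor_map_basis algebra_hom_one tensor_one del: single_one)
      (simp add: algebra_hom_one tensor_one)
  fix x y :: "'a \<times> 'c"
  have *: "h (basis (u + v)) = h (basis u) * h (basis v)" if "algebra_hom h"
    for h :: "('m::comm_monoid_add \<Rightarrow>\<^sub>0 rat) \<Rightarrow> ('k::comm_monoid_add \<Rightarrow>\<^sub>0 rat)" and u v
    using algebra_hom_mult[OF that, of "basis u" "basis v"] by (simp add: mult_single)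
  show "tensor_map f g (basis (x + y)) = tensor_map f g (basis x) * tensor_map f g (basis y)"
    by (cases x; cases y)
      (simp add: tensor_map_basis tensor_mult *[OF assms(1)] *[OF assms(2)])
qed

lemma algebra_hom_tensor_assoc:
  "algebra_hom (tensor_assoc :: (('a::comm_monoid_add \<times> 'b::comm_monoid_add) \<times> 'c::comm_monoid_add \<Rightarrow>\<^sub>0 rat) \<Rightarrow> _)"
proof (rule algebra_homI[OF linear_map_tensor_assoc])
  show "tensor_assoc (basis 0) = 1"
    by (simp add: zero_prod_def tensor_assoc_basis del: single_one) (simp flip: zero_prod_def)
  fix x y :: "('a \<times> 'b) \<times> 'c"
  show "tensor_assoc (basis (x + y)) = tensor_assoc (basis x) * tensor_assoc (basis y)"
    by (cases x; cases y; cases "fst x"; cases "fst y") (simp add: tensor_assoc_basis mult_single)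
qed

section \<open>Gradings by a weight on the basis\<close>

definition homogeneous :: "('a \<Rightarrow> nat) \<Rightarrow> nat \<Rightarrow> ('a \<Rightarrow>\<^sub>0 rat) set"
  where "homogeneous w n = {p. \<forall>x\<in>Poly_Mapping.keys p. w x = n}"

lemma homogeneous_subspace: "scale.subspace (homogeneous w n)"
proof (rule scale.subspaceI)
  show "x + y \<in> homogeneous w n" if "x \<in> homogeneous w n" "y \<in> homogeneous w n" for x y
    using that Poly_Mapping.keys_add[of x y] unfolding homogeneous_def by blast
  show "c *\<^sub>s x \<in> homogeneous w n" if "x \<in> homogeneous w n" for c x
    using that by (auto simp: homogeneous_def in_keys_iff)
qed (simp add: homogeneous_def)

lemma homogeneous_basis: "basis x \<in> homogeneous w (w x)"
  by (simp add: homogeneous_def)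

lemma homogeneous_mult:
  fixes w :: "'a::comm_monoid_add \<Rightarrow> nat"
  assumes "\<And>x y. w (x + y) = w x + w y" "a \<in> homogeneous w i" "b \<in> homogeneous w j"
  shows "a * b \<in> homogeneous w (i + j)"
  unfolding homogeneous_def
proof (intro CollectI ballI)
  fix z assume "z \<in> Poly_Mapping.keys (a * b)"
  then obtain x y where "z = x + y" "x \<in> Poly_Mapping.keys a" "y \<in> Poly_Mapping.keys b"
    using keys_mult[of a b] by blast
  thus "w z = i + j"
    using assms by (simp add: homogeneous_def)
qed

lemma homogeneous_one:
  fixes w :: "'a::comm_monoid_add \<Rightarrow> nat"
  assumes "\<And>x y. w (x + y) = w x + w y"
  shows "1 \<in> homogeneous w 0"
  using assms[of 0 0] by (simp add: homogeneous_def)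

lemma homogeneous_prod:
  fixes w :: "'a::comm_monoid_add \<Rightarrow> nat"
  assumes "\<And>x y. w (x + y) = w x + w y" "\<And>i. i \<in> I \<Longrightarrow> a i \<in> homogeneous w (n i)"
  shows "(\<Prod>i\<in>I. a i) \<in> homogeneous w (\<Sum>i\<in>I. n i)"
  using assms(2)
  by (induction I rule: infinite_finite_induct)
    (simp_all add: homogeneous_one[of w] homogeneous_mult[of w] assms(1))

lemma homogeneous_tensor:
  assumes "a \<in> homogeneous v i" "b \<in> homogeneous w j"
  shows "a \<otimes> b \<in> homogeneous (\<lambda>(x, y). v x + w y) (i + j)"
  unfolding homogeneous_def
proof (intro CollectI ballI)
  fix z assume z: "z \<in> Poly_Mapping.keys (a \<otimes> b)"
  obtain x y where xy: "z = (x, y)"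
    by fastforce
  have "Poly_Mapping.lookup a x * Poly_Mapping.lookup b y \<noteq> 0"
    using z by (simp add: xy in_keys_iff)
  hence "x \<in> Poly_Mapping.keys a" "y \<in> Poly_Mapping.keys b"
    by (auto simp: in_keys_iff)
  thus "(case z of (x, y) \<Rightarrow> v x + w y) = i + j"
    using assms by (simp add: homogeneous_def xy)
qed

lemma lookup_mult_zero:
  fixes a b :: "'a::comm_monoid_add \<Rightarrow>\<^sub>0 rat"
  assumes "\<And>x y :: 'a. x + y = 0 \<longleftrightarrow> x = 0 \<and> y = 0"
  shows "Poly_Mapping.lookup (a * b) 0 = Poly_Mapping.lookup a 0 * Poly_Mapping.lookup b 0"
proof -
  \<comment> \<open>The coefficient is put back into the algebra as a scalar multiple of 1, so that
    \<open>linear_map_mult_eqI\<close> for maps between monoid algebras applies.\<close>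
  define u :: "('a \<Rightarrow>\<^sub>0 rat) \<Rightarrow> ('a \<Rightarrow>\<^sub>0 rat)" where "u p = Poly_Mapping.lookup p 0 *\<^sub>s 1" for p
  have "linear_map u"
    by (rule linear_mapI) (simp_all add: u_def lookup_add scale.scale_left_distrib)
  hence "u (a * b) = u a * u b"
    by (rule linear_map_mult_eqI) (auto simp: u_def lookup_single when_def assms)
  hence "Poly_Mapping.lookup (u (a * b)) 0 = Poly_Mapping.lookup (u a * u b) 0"
    by simp
  thus ?thesis
    by (simp add: u_def scale_mult_left)
qed

text \<open>The existence of an antipode is derived from \<open>deg_eq_0_iff\<close>, which is
  connectedness, and from \<open>deg_comult\<close>, which says that the coproduct is graded. The
  counit is the coefficient of the monoid unit, the only basis element of degree 0.\<close>

locale connected_bialgebra =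
  fixes \<Delta> :: "('m::comm_monoid_add \<Rightarrow>\<^sub>0 rat) \<Rightarrow> ('m \<times> 'm \<Rightarrow>\<^sub>0 rat)"
    and deg :: "'m \<Rightarrow> nat"
  assumes comult_hom: "algebra_hom \<Delta>"
    and coassoc: "tensor_assoc (tensor_map \<Delta> id (\<Delta> a)) = tensor_map id \<Delta> (\<Delta> a)"
    and counit_left: "tensor_lift (\<lambda>b c. Poly_Mapping.lookup b 0 *\<^sub>s c) (\<Delta> a) = a"
    and counit_right: "tensor_lift (\<lambda>b c. Poly_Mapping.lookup c 0 *\<^sub>s b) (\<Delta> a) = a"
    and deg_add: "deg (x + y) = deg x + deg y"
    and deg_eq_0_iff: "deg x = 0 \<longleftrightarrow> x = 0"
    and deg_comult: "(y, z) \<in> Poly_Mapping.keys (\<Delta> (basis x)) \<Longrightarrow> deg y + deg z = deg x"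
begin

section \<open>Convolution and the antipode\<close>

definition conv :: "(('m \<Rightarrow>\<^sub>0 rat) \<Rightarrow> ('m \<Rightarrow>\<^sub>0 rat)) \<Rightarrow> (('m \<Rightarrow>\<^sub>0 rat) \<Rightarrow> ('m \<Rightarrow>\<^sub>0 rat)) \<Rightarrow> ('m \<Rightarrow>\<^sub>0 rat) \<Rightarrow> ('m \<Rightarrow>\<^sub>0 rat)"
  where "conv f g a = tensor_lift (*) (tensor_map f g (\<Delta> a))"

definition unit_map :: "('m \<Rightarrow>\<^sub>0 rat) \<Rightarrow> ('m \<Rightarrow>\<^sub>0 rat)"
  where "unit_map a = Poly_Mapping.lookup a 0 *\<^sub>s 1"

definition aug :: "('m \<Rightarrow>\<^sub>0 rat) \<Rightarrow> ('m \<Rightarrow>\<^sub>0 rat)"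
  where "aug a = a - unit_map a"

primrec aug_pow :: "nat \<Rightarrow> ('m \<Rightarrow>\<^sub>0 rat) \<Rightarrow> ('m \<Rightarrow>\<^sub>0 rat)"
  where "aug_pow 0 = unit_map"
  | "aug_pow (Suc k) = conv aug (aug_pow k)"

definition partial_antipode :: "nat \<Rightarrow> ('m \<Rightarrow>\<^sub>0 rat) \<Rightarrow> ('m \<Rightarrow>\<^sub>0 rat)"
  where "partial_antipode n a = (\<Sum>k\<le>n. (-1) ^ k *\<^sub>s aug_pow k a)"

text \<open>The alternating series of powers of \<open>aug\<close> is infinite as a series of maps,
  but on \<open>basis x\<close> its terms beyond \<open>deg x\<close> vanish, so truncating at
  \<open>deg x\<close> gives its full value there.\<close>

definition antipode :: "('m \<Rightarrow>\<^sub>0 rat) \<Rightarrow> ('m \<Rightarrow>\<^sub>0 rat)"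
  where "antipode = extend (\<lambda>x. partial_antipode (deg x) (basis x))"

lemma comult_linear: "linear_map \<Delta>"
  using comult_hom by (rule algebra_hom_linear)

lemma linear_map_conv: "linear_map (conv f g)"
  unfolding conv_def
  by (intro linear_map_comp[OF linear_map_tensor_lift] linear_map_comp[OF linear_map_tensor_map] comult_linear)

lemma linear_map_unit_map: "linear_map unit_map"
  by (rule linear_mapI) (simp_all add: unit_map_def lookup_add scale.scale_left_distrib)

lemma linear_map_aug: "linear_map aug"
  unfolding aug_def by (intro linear_map_diff linear_map_unit_map linear_map_id[unfolded id_def])

lemma linear_map_aug_pow: "linear_map (aug_pow k)"
  by (cases k) (simp_all add: linear_map_unit_map linear_map_conv)

lemma conv_eq_extend: "conv f g a = extend (\<lambda>(x, y). f (basis x) * g (basis y)) (\<Delta> a)"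
  unfolding conv_def
proof (rule linear_map_eqI[of "\<lambda>t. tensor_lift (*) (tensor_map f g t)"])
  show "linear_map (\<lambda>t. tensor_lift (*) (tensor_map f g t))"
    by (rule linear_map_comp[OF linear_map_tensor_lift linear_map_tensor_map])
  fix w :: "'m \<times> 'm"
  show "tensor_lift (*) (tensor_map f g (basis w)) = extend (\<lambda>(x, y). f (basis x) * g (basis y)) (basis w)"
    by (cases w) (simp add: tensor_map_basis tensor_lift_tensor linear_map_mult_left linear_map_mult_right)
qed (rule linear_map_extend)

lemma conv_cong_basis:
  assumes "\<And>y z. (y, z) \<in> Poly_Mapping.keys (\<Delta> a) \<Longrightarrow> f (basis y) * g (basis z) = f' (basis y) * g' (basis z)"
  shows "conv f g a = conv f' g' a"
  unfolding conv_eq_extend extend_def using assms by (intro sum.cong) auto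

lemma conv_add_right:
  "conv f (\<lambda>a. g a + h a) a = conv f g a + conv f h a"
  unfolding conv_eq_extend extend_def
  by (simp add: case_prod_unfold distrib_left scale.scale_right_distrib sum.distrib)

lemma conv_add_left:
  "conv (\<lambda>a. g a + h a) f a = conv g f a + conv h f a"
  unfolding conv_eq_extend extend_def
  by (simp add: case_prod_unfold distrib_right scale.scale_right_distrib sum.distrib)

lemma conv_sum_left:
  "conv (\<lambda>a. \<Sum>i\<in>I. c i *\<^sub>s f i a) g a = (\<Sum>i\<in>I. c i *\<^sub>s conv (f i) g a)"
  unfolding conv_eq_extend extend_def
  by (simp add: case_prod_unfold sum_distrib_right scale_mult_left scale.scale_sum_right
      sum.swap[of _ I]) (simp add: mult.commute)

lemma conv_sum_right:
  "conv g (\<lambda>a. \<Sum>i\<in>I. c i *\<^sub>s f i a) a = (\<Sum>i\<in>I. c i *\<^sub>s conv g (f i) a)"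
  unfolding conv_eq_extend extend_def
  by (simp add: case_prod_unfold sum_distrib_left scale_mult_right scale.scale_sum_right
      sum.swap[of _ I]) (simp add: mult.commute)

lemma conv_assoc:
  assumes "linear_map f" "linear_map g" "linear_map h"
  shows "conv (conv f g) h a = conv f (conv g h) a"
proof -
  \<comment> \<open>The map on triple tensors that applies \<open>f\<close>, \<open>g\<close>,
    \<open>h\<close> and multiplies. Both bracketings evaluate it on an iterated coproduct, so they
    agree by coassociativity.\<close>
  define M where "M = extend (\<lambda>(x, y, z). f (basis x) * (g (basis y) * h (basis z)))"
  have M: "linear_map M"
    unfolding M_def by (rule linear_map_extend)
  have M_basis: "M (basis (x, y, z)) = f (basis x) * (g (basis y) * h (basis z))" for x y z
    by (simp add: M_def)
  have left: "f (basis x) * extend (\<lambda>(x, y). g (basis x) * h (basis y)) t = M (basis x \<otimes> t)" for x t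
    by (rule linear_map_eqI[of "\<lambda>t. f (basis x) * extend (\<lambda>(x, y). g (basis x) * h (basis y)) t"])
      (auto intro: linear_map_comp[OF linear_map_mult_right linear_map_extend]
        linear_map_comp[OF M linear_map_tensor_right] simp: single_tensor_single M_basis)
  have right: "extend (\<lambda>(x, y). f (basis x) * g (basis y)) t * h (basis z) = M (tensor_assoc (t \<otimes> basis z))" for z t
    by (rule linear_map_eqI[of "\<lambda>t. extend (\<lambda>(x, y). f (basis x) * g (basis y)) t * h (basis z)"])
      (auto intro: linear_map_comp[OF linear_map_mult_left linear_map_extend]
        linear_map_comp[OF M linear_map_comp[OF linear_map_tensor_assoc linear_map_tensor_left]]
        simp: single_tensor_single tensor_assoc_basis M_basis mult.assoc)
  have "conv (conv f g) h a = M (tensor_assoc (tensor_map \<Delta> id (\<Delta> a)))"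
    unfolding conv_eq_extend[of "conv f g"]
    by (rule linear_map_eqI[OF linear_map_extend])
      (auto intro: linear_map_comp[OF M linear_map_comp[OF linear_map_tensor_assoc linear_map_tensor_map]]
        simp: tensor_map_basis conv_eq_extend right)
  also have "\<dots> = M (tensor_map id \<Delta> (\<Delta> a))"
    by (simp add: coassoc)
  also have "\<dots> = conv f (conv g h) a"
    unfolding conv_eq_extend[of f]
    by (rule linear_map_eqI[OF linear_map_comp[OF M linear_map_tensor_map] linear_map_extend])
      (auto simp: tensor_map_basis conv_eq_extend left)
  finally show ?thesis .
qed

lemma conv_unit_left:
  assumes "linear_map f"
  shows "conv unit_map f a = f a"
proof -
  have "conv unit_map f a = f (tensor_lift (\<lambda>b c. Poly_Mapping.lookup b 0 *\<^sub>s c) (\<Delta> a))"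
    unfolding conv_eq_extend
    by (rule linear_map_eqI[OF linear_map_extend linear_map_comp[OF assms linear_map_tensor_lift]])
      (auto simp: unit_map_def scale_mult_left linear_map_scale[OF assms])
  thus ?thesis
    by (simp add: counit_left)
qed

lemma conv_unit_right:
  assumes "linear_map f"
  shows "conv f unit_map a = f a"
proof -
  have "conv f unit_map a = f (tensor_lift (\<lambda>b c. Poly_Mapping.lookup c 0 *\<^sub>s b) (\<Delta> a))"
    unfolding conv_eq_extend
    by (rule linear_map_eqI[OF linear_map_extend linear_map_comp[OF assms linear_map_tensor_lift]])
      (auto simp: unit_map_def scale_mult_right linear_map_scale[OF assms])
  thus ?thesis
    by (simp add: counit_right)
qed

text \<open>\<open>aug_pow\<close> multiplies by \<open>aug\<close> from the left, whereas for the
  left inverse the additional factor stands on the right.\<close>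

lemma conv_aug_pow_commute: "conv (aug_pow k) aug = conv aug (aug_pow k)"
proof (induction k)
  case 0
  show ?case
    by (simp add: fun_eq_iff conv_unit_left conv_unit_right linear_map_aug)
next
  case (Suc k)
  have "conv (aug_pow (Suc k)) aug a = conv aug (aug_pow (Suc k)) a" for a
    using conv_assoc[OF linear_map_aug linear_map_aug_pow linear_map_aug] Suc by simp
  thus ?case
    by blast
qed

lemma aug_basis_zero: "aug (basis 0) = 0"
  by (simp add: aug_def unit_map_def)

text \<open>\<open>aug\<close> kills the basis element of degree 0, so each factor
  \<open>aug\<close> uses up at least one degree.\<close>

lemma aug_pow_eq_0: "deg x < k \<Longrightarrow> aug_pow k (basis x) = 0"
proof (induction k arbitrary: x)
  case (Suc k)
  have "aug (basis y) * aug_pow k (basis z) = 0" if "(y, z) \<in> Poly_Mapping.keys (\<Delta> (basis x))" for y z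
  proof (cases "y = 0")
    case True
    then show ?thesis
      using aug_basis_zero by simp
  next
    case False
    hence "deg z < k"
      using deg_comult[OF that] Suc.prems deg_eq_0_iff[of y] by linarith
    then show ?thesis
      by (simp add: Suc.IH)
  qed
  hence "(\<Sum>w\<in>Poly_Mapping.keys (\<Delta> (basis x)). Poly_Mapping.lookup (\<Delta> (basis x)) w *\<^sub>s
      (case w of (y, z) \<Rightarrow> aug (basis y) * aug_pow k (basis z))) = 0"
    by (intro sum.neutral) auto
  thus ?case
    by (simp add: conv_eq_extend extend_def)
qed simp

lemma linear_map_partial_antipode: "linear_map (partial_antipode n)"
  unfolding partial_antipode_def by (intro linear_map_sum_map linear_map_scale_map linear_map_aug_pow)

lemma linear_map_antipode: "linear_map antipode"
  unfolding antipode_def by (rule linear_map_extend)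

lemma antipode_eq_partial:
  assumes "deg x \<le> n"
  shows "antipode (basis x) = partial_antipode n (basis x)"
  unfolding antipode_def partial_antipode_def extend_basis using assms
  by (intro sum.mono_neutral_left) (auto simp: aug_pow_eq_0)

lemma id_eq_unit_plus_aug: "id = (\<lambda>a. unit_map a + aug a)"
  by (simp add: aug_def fun_eq_iff)

text \<open>With \<open>J\<close> for \<open>aug\<close>, this is the geometric sum in the
  convolution algebra: \<open>1 + J\<close> times the sum of the powers of \<open>- J\<close> up to
  \<open>n\<close> is \<open>1 - (- J) ^ (n + 1)\<close>.\<close>

lemma telescope: "(\<Sum>k\<le>n. (-1) ^ k *\<^sub>s aug_pow k a) + (\<Sum>k\<le>n. (-1) ^ k *\<^sub>s aug_pow (Suc k) a) =
    unit_map a + (-1) ^ n *\<^sub>s aug_pow (Suc n) a"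
  by (induction n) (simp_all add: algebra_simps)

lemma conv_partial_antipode_id:
  "conv (partial_antipode n) id a = unit_map a + (-1) ^ n *\<^sub>s aug_pow (Suc n) a"
proof -
  have "conv (partial_antipode n) id a = conv (partial_antipode n) unit_map a + conv (partial_antipode n) aug a"
    unfolding id_eq_unit_plus_aug
    by (rule conv_add_right)
  also have "conv (partial_antipode n) unit_map a = (\<Sum>k\<le>n. (-1) ^ k *\<^sub>s aug_pow k a)"
    by (simp add: conv_unit_right[OF linear_map_partial_antipode] partial_antipode_def)
  also have "conv (partial_antipode n) aug a = (\<Sum>k\<le>n. (-1) ^ k *\<^sub>s aug_pow (Suc k) a)"
    unfolding partial_antipode_def conv_sum_left by (simp add: conv_aug_pow_commute)
  finally show ?thesis
    by (simp only: telescope)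
qed

lemma conv_id_partial_antipode:
  "conv id (partial_antipode n) a = unit_map a + (-1) ^ n *\<^sub>s aug_pow (Suc n) a"
proof -
  have "conv id (partial_antipode n) a = conv unit_map (partial_antipode n) a + conv aug (partial_antipode n) a"
    unfolding id_eq_unit_plus_aug by (rule conv_add_left)
  also have "conv unit_map (partial_antipode n) a = (\<Sum>k\<le>n. (-1) ^ k *\<^sub>s aug_pow k a)"
    by (simp add: conv_unit_left[OF linear_map_partial_antipode] partial_antipode_def)
  also have "conv aug (partial_antipode n) a = (\<Sum>k\<le>n. (-1) ^ k *\<^sub>s aug_pow (Suc k) a)"
    unfolding partial_antipode_def conv_sum_right by simp
  finally show ?thesis
    by (simp only: telescope)
qed

lemma antipode_conv:
  "conv antipode id a = unit_map a" "conv id antipode a = unit_map a"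
proof -
  \<comment> \<open>Both components of a coproduct term have degree at most \<open>deg x\<close>, so
    truncation at \<open>deg x\<close> serves for all of them, and the remainder with
    \<open>aug_pow (Suc (deg x))\<close> vanishes on \<open>basis x\<close>.\<close>
  have *: "deg y \<le> deg x" "deg z \<le> deg x" if "(y, z) \<in> Poly_Mapping.keys (\<Delta> (basis x))" for x y z
    using deg_comult[OF that] by linarith+
  show "conv antipode id a = unit_map a"
  proof (rule linear_map_eqI[OF linear_map_conv linear_map_unit_map])
    fix x
    have "conv antipode id (basis x) = conv (partial_antipode (deg x)) id (basis x)"
    proof (rule conv_cong_basis)
      fix y z assume "(y, z) \<in> Poly_Mapping.keys (\<Delta> (basis x))"
      thus "antipode (basis y) * id (basis z) = partial_antipode (deg x) (basis y) * id (basis z)"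
        using antipode_eq_partial[OF *(1)] by simp
    qed
    thus "conv antipode id (basis x) = unit_map (basis x)"
      by (simp only: conv_partial_antipode_id aug_pow_eq_0) simp
  qed
  show "conv id antipode a = unit_map a"
  proof (rule linear_map_eqI[OF linear_map_conv linear_map_unit_map])
    fix x
    have "conv id antipode (basis x) = conv id (partial_antipode (deg x)) (basis x)"
    proof (rule conv_cong_basis)
      fix y z assume "(y, z) \<in> Poly_Mapping.keys (\<Delta> (basis x))"
      thus "id (basis y) * antipode (basis z) = id (basis y) * partial_antipode (deg x) (basis z)"
        using antipode_eq_partial[OF *(2)] by simp
    qed
    thus "conv id antipode (basis x) = unit_map (basis x)"
      by (simp only: conv_id_partial_antipode aug_pow_eq_0) simp
  qed
qed

section \<open>Compatibility with the grading\<close>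

lemma aug_pow_homogeneous: "aug_pow k (basis x) \<in> homogeneous deg (deg x)"
proof (induction k arbitrary: x)
  case 0
  \<comment> \<open>In positive degree \<open>unit_map\<close> vanishes on basis elements, and zero
    is homogeneous of every degree.\<close>
  show ?case
    using deg_eq_0_iff[of x]
    by (auto simp: unit_map_def lookup_single when_def homogeneous_def deg_eq_0_iff split: if_splits)
next
  case (Suc k)
  have unit: "unit_map (basis y) \<in> homogeneous deg (deg y)" for y
    using deg_eq_0_iff[of y]
    by (auto simp: unit_map_def lookup_single when_def homogeneous_def deg_eq_0_iff split: if_splits)
  have "aug (basis y) \<in> homogeneous deg (deg y)" for y
    unfolding aug_def by (rule scale.subspace_diff[OF homogeneous_subspace homogeneous_basis unit])
  hence "aug (basis y) * aug_pow k (basis z) \<in> homogeneous deg (deg x)"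
    if "(y, z) \<in> Poly_Mapping.keys (\<Delta> (basis x))" for y z
    using homogeneous_mult[OF deg_add _ Suc.IH] deg_comult[OF that] by metis
  thus ?case
    by (auto simp: conv_eq_extend extend_def
        intro!: scale.subspace_sum[OF homogeneous_subspace] scale.subspace_scale[OF homogeneous_subspace])
qed

lemma antipode_homogeneous:
  assumes "a \<in> homogeneous deg n"
  shows "antipode a \<in> homogeneous deg n"
proof -
  have "partial_antipode (deg x) (basis x) \<in> homogeneous deg n" if "x \<in> Poly_Mapping.keys a" for x
  proof -
    have "deg x = n"
      using assms that by (simp add: homogeneous_def)
    thus ?thesis
      using aug_pow_homogeneous[of _ x] unfolding partial_antipode_def
      by (intro scale.subspace_sum scale.subspace_scale homogeneous_subspace) simp
  qed
  thus ?thesis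
    unfolding antipode_def extend_def
    by (intro scale.subspace_sum scale.subspace_scale homogeneous_subspace)
qed

lemma comult_homogeneous:
  assumes "a \<in> homogeneous deg n"
  shows "\<Delta> a \<in> scale.span {b \<otimes> c | b c. \<exists>i j. i + j = n \<and> b \<in> homogeneous deg i \<and> c \<in> homogeneous deg j}"
    (is "_ \<in> scale.span ?T")
proof -
  have "basis (y, z) \<in> scale.span ?T"
    if x: "x \<in> Poly_Mapping.keys a" and yz: "(y, z) \<in> Poly_Mapping.keys (\<Delta> (basis x))" for x y z
  proof (rule scale.span_base)
    have "deg y + deg z = n"
      using deg_comult[OF yz] x assms by (simp add: homogeneous_def)
    moreover have "basis (y, z) = basis y \<otimes> basis z"
      by (simp add: single_tensor_single)
    ultimately show "basis (y, z) \<in> ?T"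
      using homogeneous_basis[of y deg] homogeneous_basis[of z deg] by blast
  qed
  hence "\<Delta> (basis x) \<in> scale.span ?T" if "x \<in> Poly_Mapping.keys a" for x
    using that by (subst sum_basis) (intro scale.span_sum scale.span_scale, auto)
  moreover have "\<Delta> a = (\<Sum>x\<in>Poly_Mapping.keys a. Poly_Mapping.lookup a x *\<^sub>s \<Delta> (basis x))"
    using arg_cong[OF sum_basis, of \<Delta> a] by (simp add: linear_map_sum linear_map_scale comult_linear)
  ultimately show ?thesis
    by (simp add: scale.span_sum scale.span_scale)
qed

definition component :: "nat \<Rightarrow> ('m \<Rightarrow>\<^sub>0 rat) \<Rightarrow> ('m \<Rightarrow>\<^sub>0 rat)"
  where "component n a = (\<Sum>x | x \<in> Poly_Mapping.keys a \<and> deg x = n. Poly_Mapping.lookup a x *\<^sub>s basis x)"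

lemma lookup_component: "Poly_Mapping.lookup (component n a) x = (if deg x = n then Poly_Mapping.lookup a x else 0)"
proof -
  have "Poly_Mapping.lookup (component n a) x =
      (\<Sum>y | y \<in> Poly_Mapping.keys a \<and> deg y = n. if y = x then Poly_Mapping.lookup a y else 0)"
    unfolding component_def lookup_sum by (intro sum.cong) (auto simp: lookup_single when_def)
  thus ?thesis
    by (simp add: in_keys_iff)
qed

lemma homogeneous_direct_sum:
  "\<exists>!f. (\<forall>n. f n \<in> homogeneous deg n) \<and> finite {n. f n \<noteq> 0} \<and> a = (\<Sum>n | f n \<noteq> 0. f n)"
proof (rule ex1I[of _ "\<lambda>n. component n a"], intro conjI allI)
  show "component n a \<in> homogeneous deg n" for n
    by (auto simp: homogeneous_def in_keys_iff lookup_component split: if_splits)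
  have "{n. component n a \<noteq> 0} \<subseteq> deg ` Poly_Mapping.keys a"
  proof
    fix n assume "n \<in> {n. component n a \<noteq> 0}"
    then obtain x where "Poly_Mapping.lookup (component n a) x \<noteq> 0"
      using poly_mapping_eqI[of "component n a" 0] by auto
    thus "n \<in> deg ` Poly_Mapping.keys a"
      by (auto simp: lookup_component in_keys_iff split: if_splits)
  qed
  thus fin: "finite {n. component n a \<noteq> 0}"
    by (rule finite_subset) simp
  show "a = (\<Sum>n | component n a \<noteq> 0. component n a)"
  proof (rule poly_mapping_eqI)
    fix x
    have "Poly_Mapping.lookup (\<Sum>n | component n a \<noteq> 0. component n a) x =
        (if component (deg x) a \<noteq> 0 then Poly_Mapping.lookup a x else 0)"
      using fin by (simp add: lookup_sum lookup_component)
    thus "Poly_Mapping.lookup a x = Poly_Mapping.lookup (\<Sum>n | component n a \<noteq> 0. component n a) x"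
      using lookup_component[of "deg x" a x] by auto
  qed
next
  fix f assume f: "(\<forall>n. f n \<in> homogeneous deg n) \<and> finite {n. f n \<noteq> 0} \<and> a = (\<Sum>n | f n \<noteq> 0. f n)"
  have "f n = component n a" for n
  proof (rule poly_mapping_eqI)
    fix x
    have off: "Poly_Mapping.lookup (f m) x = 0" if "m \<noteq> deg x" for m
    proof -
      have "x \<notin> Poly_Mapping.keys (f m)"
        using spec[OF conjunct1[OF f], of m] that by (auto simp: homogeneous_def)
      thus ?thesis
        by (simp add: in_keys_iff)
    qed
    have "Poly_Mapping.lookup a x = (\<Sum>m | f m \<noteq> 0. Poly_Mapping.lookup (f m) x)"
      using f by (metis lookup_sum)
    also have "\<dots> = (\<Sum>m | f m \<noteq> 0. if m = deg x then Poly_Mapping.lookup (f m) x else 0)"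
      using off by (intro sum.cong) auto
    also have "\<dots> = Poly_Mapping.lookup (f (deg x)) x"
      using f by auto
    finally show "Poly_Mapping.lookup (f n) x = Poly_Mapping.lookup (component n a) x"
      using off[of n] by (auto simp: lookup_component)
  qed
  thus "f = (\<lambda>n. component n a)"
    by blast
qed

lemma counit_mult:
  fixes a b :: "'m \<Rightarrow>\<^sub>0 rat"
  shows "Poly_Mapping.lookup (a * b) 0 = Poly_Mapping.lookup a 0 * Poly_Mapping.lookup b 0"
proof (rule lookup_mult_zero)
  show "x + y = 0 \<longleftrightarrow> x = 0 \<and> y = 0" for x y :: 'm
    using deg_add[of x y] deg_eq_0_iff by (metis add_is_0)
qed

theorem graded_connected_hopf_algebra:
  "graded_connected_commutative_hopf_algebra \<Delta> (\<lambda>a. Poly_Mapping.lookup a 0) antipode (homogeneous deg)"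
proof (intro graded_connected_commutative_hopf_algebra.intro hopf_algebra.intro
    graded_connected_commutative_hopf_algebra_axioms.intro)
  show "algebra_hom \<Delta>"
    by (rule comult_hom)
  have "vector_space ((*) :: rat \<Rightarrow> rat \<Rightarrow> rat)"
    by unfold_locales (simp_all add: algebra_simps)
  thus "Vector_Spaces.linear scale (*) (\<lambda>a :: 'm \<Rightarrow>\<^sub>0 rat. Poly_Mapping.lookup a 0)"
    unfolding Vector_Spaces.linear_iff
    by (intro conjI allI vector_space_scale) (simp_all add: lookup_add)
  show "Vector_Spaces.linear scale scale antipode"
    by (rule linear_map_antipode)
  show "tensor_lift (*) (tensor_map antipode id (\<Delta> a)) = Poly_Mapping.lookup a 0 *\<^sub>s 1"
    "tensor_lift (*) (tensor_map id antipode (\<Delta> a)) = Poly_Mapping.lookup a 0 *\<^sub>s 1" for a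
    using antipode_conv[of a] by (simp_all add: conv_def unit_map_def)
  show "Poly_Mapping.lookup a 0 = 0" if "a \<in> homogeneous deg n" "0 < n" for a :: "'m \<Rightarrow>\<^sub>0 rat" and n
  proof -
    have "0 \<notin> Poly_Mapping.keys a"
      using that deg_eq_0_iff[of 0] by (auto simp: homogeneous_def)
    thus ?thesis
      by (simp add: in_keys_iff)
  qed
  show "(1 :: 'm \<Rightarrow>\<^sub>0 rat) \<in> homogeneous deg 0"
    using homogeneous_basis[of 0 deg] deg_eq_0_iff[of 0] by simp
  show "homogeneous deg 0 = {c *\<^sub>s (1 :: 'm \<Rightarrow>\<^sub>0 rat) | c. True}"
  proof (intro equalityI subsetI)
    fix a assume "a \<in> homogeneous deg 0"
    hence "Poly_Mapping.lookup a x = 0" if "x \<noteq> 0" for x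
      using that deg_eq_0_iff by (auto simp: homogeneous_def in_keys_iff)
    hence "a = Poly_Mapping.lookup a 0 *\<^sub>s 1"
      by (intro poly_mapping_eqI) (auto simp: lookup_one when_def)
    thus "a \<in> {c *\<^sub>s (1 :: 'm \<Rightarrow>\<^sub>0 rat) | c. True}"
      by blast
  next
    fix a assume "a \<in> {c *\<^sub>s (1 :: 'm \<Rightarrow>\<^sub>0 rat) | c. True}"
    thus "a \<in> homogeneous deg 0"
      using homogeneous_basis[of 0 deg] deg_eq_0_iff[of 0] scale.subspace_scale[OF homogeneous_subspace] by auto
  qed
qed (simp_all add: coassoc counit_left counit_right counit_mult homogeneous_subspace homogeneous_mult[OF deg_add]
    homogeneous_direct_sum antipode_homogeneous comult_homogeneous mult.commute)

end

section \<open>Refining a set of chords\<close>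

context split_system
begin

text \<open>Chords of \<open>C\<close> do not separate sides of \<open>F\<close> and chords of
  \<open>D\<close> from other faces do not cut \<open>F\<close>, so within \<open>F\<close> only the
  chords of \<open>D\<close> inside it matter.\<close>

lemma side_class_refine:
  assumes "C \<subseteq> E" "D \<subseteq> E - C" "F \<in> side_classes K C" "s \<in> F"
  shows "side_class F (D \<inter> inside E C F) s = side_class K (C \<union> D) s"
proof (intro equalityI subsetI)
  fix t assume t: "t \<in> side_class F (D \<inter> inside E C F) s"
  hence "t \<in> F"
    by (simp add: side_class_def)
  have "\<not> separates c s t" if "c \<in> C \<union> D" for c
  proof (cases "c \<in> D \<inter> inside E C F")
    case True
    then show ?thesis
      using t by (simp add: side_class_def)
  next
    case False
    show ?thesis
    proof (cases "c \<in> C")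
      case True
      then show ?thesis
        using side_classes_not_separated[OF assms(3,4) \<open>t \<in> F\<close>] by blast
    next
      case False
      hence "\<not> cuts c F"
        using \<open>c \<notin> D \<inter> inside E C F\<close> that assms(2) unfolding inside_def by blast
      thus ?thesis
        using assms(4) \<open>t \<in> F\<close> unfolding cuts_def by blast
    qed
  qed
  thus "t \<in> side_class K (C \<union> D) s"
    using \<open>t \<in> F\<close> side_classes_subset[OF assms(3)] by (auto simp: side_class_def)
next
  fix t assume t: "t \<in> side_class K (C \<union> D) s"
  hence "t \<in> F"
    using side_classes_mem[OF assms(3,4)] by (simp add: side_class_def)
  thus "t \<in> side_class F (D \<inter> inside E C F) s"
    using t by (simp add: side_class_def)
qed

lemma side_classes_refine:
  assumes "C \<subseteq> E" "D \<subseteq> E - C"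
  shows "side_classes K (C \<union> D) = (\<Union>F\<in>side_classes K C. side_classes F (D \<inter> inside E C F))"
proof -
  have "side_classes F (D \<inter> inside E C F) = side_class K (C \<union> D) ` F" if "F \<in> side_classes K C" for F
    unfolding side_classes_def using side_class_refine[OF assms that] by (intro image_cong) auto
  hence "(\<Union>F\<in>side_classes K C. side_classes F (D \<inter> inside E C F)) =
      (\<Union>F\<in>side_classes K C. side_class K (C \<union> D) ` F)"
    by simp
  also have "\<dots> = side_class K (C \<union> D) ` \<Union> (side_classes K C)"
    by blast
  finally show ?thesis
    unfolding Union_side_classes side_classes_def[of K "C \<union> D"] by simp
qed

lemma side_classes_refine_disjoint:
  assumes "F \<in> side_classes K C" "G \<in> side_classes K C" "F \<noteq> G"
  shows "side_classes F X \<inter> side_classes G Y = {}"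
proof (rule ccontr)
  assume "\<not> ?thesis"
  then obtain B where B: "B \<in> side_classes F X" "B \<in> side_classes G Y"
    by blast
  then obtain s where "s \<in> B"
    using side_classes_nonempty by blast
  hence "s \<in> F" "s \<in> G"
    using B side_classes_subset by blast+
  thus False
    using side_classes_unique assms by blast
qed

lemma inside_refine:
  assumes "C \<subseteq> E" "D \<subseteq> E - C" "F \<in> side_classes K C" "B \<in> side_classes F (D \<inter> inside E C F)"
  shows "inside (inside E C F) (D \<inter> inside E C F) B = inside E (C \<union> D) B"
proof -
  have "cuts c F" if "cuts c B" for c
    using cuts_mono[OF that side_classes_subset[OF assms(4)]] .
  thus ?thesis
    unfolding inside_def by blast
qed

text \<open>This matches the first tensor factors in coassociativity: the faces of
  \<open>C \<union> D\<close> are grouped by the faces of \<open>C\<close> that contain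
  them.\<close>

lemma q_part_refine:
  assumes "C \<subseteq> E" "D \<subseteq> E - C"
  shows "q_part K E (C \<union> D) = (\<Prod>F\<in>side_classes K C. q_part F (inside E C F) (D \<inter> inside E C F))"
proof -
  have fin: "finite F" if "F \<in> side_classes K C" for F
    using finite_subset[OF side_classes_subset[OF that] finite_sides] .
  have "q_part K E (C \<union> D) =
      (\<Prod>F\<in>side_classes K C. \<Prod>B\<in>side_classes F (D \<inter> inside E C F). contracted B (inside E (C \<union> D) B))"
    unfolding q_part_def side_classes_refine[OF assms]
    using side_classes_refine_disjoint fin finite_sides
    by (intro prod.UNION_disjoint) auto
  also have "\<dots> = (\<Prod>F\<in>side_classes K C. q_part F (inside E C F) (D \<inter> inside E C F))"
    unfolding q_part_def using inside_refine[OF assms] by (intro prod.cong) auto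
  finally show ?thesis .
qed

lemma transversal_refine:
  assumes "C \<subseteq> E" "D \<subseteq> E - C"
  shows "transversal K (C \<union> D) = (\<Union>F\<in>side_classes K C. transversal F (D \<inter> inside E C F))"
  unfolding transversal_def side_classes_refine[OF assms] by blast

lemma transversal_refine_Int:
  assumes "C \<subseteq> E" "D \<subseteq> E - C" "F \<in> side_classes K C"
  shows "transversal F (D \<inter> inside E C F) = F \<inter> transversal K (C \<union> D)"
proof -
  have sub: "transversal G (D \<inter> inside E C G) \<subseteq> G" if "G \<in> side_classes K C" for G
    by (rule split_system.transversal_subset[OF split_system_inside[OF assms(1) that]])
  have "transversal G (D \<inter> inside E C G) \<inter> F = {}" if "G \<in> side_classes K C" "G \<noteq> F" for G
    using sub[OF that(1)] side_classes_unique[OF that(1) assms(3)] that(2) by blast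
  thus ?thesis
    unfolding transversal_refine[OF assms(1,2)] using sub[OF assms(3)] assms(3) by blast
qed

lemma transversal_Int_nonempty:
  assumes "C \<subseteq> E" "D \<subseteq> E - C" "F \<in> side_classes K C"
  shows "F \<inter> transversal K (C \<union> D) \<noteq> {}"
proof -
  interpret F: split_system F "inside E C F"
    by (rule split_system_inside[OF assms(1,3)])
  have "split_system (transversal F (D \<inter> inside E C F)) (D \<inter> inside E C F)"
    by (rule F.split_system_transversal) blast
  thus ?thesis
    using split_system.sides_nonempty transversal_refine_Int[OF assms] by blast
qed

text \<open>Each face of \<open>C\<close> retains the least sides of its subfaces, so none of them
  disappears in passing to \<open>r_part K (C \<union> D)\<close>.\<close>

lemma side_classes_transversal:
  assumes "C \<subseteq> E" "D \<subseteq> E - C"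
  shows "side_classes (transversal K (C \<union> D)) C = (\<lambda>F. F \<inter> transversal K (C \<union> D)) ` side_classes K C"
proof -
  let ?T = "transversal K (C \<union> D)"
  have T: "?T \<subseteq> K"
    by (rule transversal_subset)
  have cls: "side_class ?T C s = side_class K C s \<inter> ?T" for s
    using T by (auto simp: side_class_def)
  show ?thesis
  proof (intro equalityI subsetI)
    fix G assume "G \<in> side_classes ?T C"
    thus "G \<in> (\<lambda>F. F \<inter> ?T) ` side_classes K C"
      using T unfolding side_classes_def cls by blast
  next
    fix G assume "G \<in> (\<lambda>F. F \<inter> ?T) ` side_classes K C"
    then obtain F where F: "F \<in> side_classes K C" "G = F \<inter> ?T"
      by blast
    then obtain s where s: "s \<in> F" "s \<in> ?T"
      using transversal_Int_nonempty[OF assms F(1)] by blast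
    hence "G = side_class ?T C s"
      using side_classes_eq[OF F(1) s(1)] F(2) by (simp add: cls)
    thus "G \<in> side_classes ?T C"
      using s(2) by (simp add: side_classes_def)
  qed
qed

lemma inj_on_Int_transversal:
  assumes "C \<subseteq> E" "D \<subseteq> E - C"
  shows "inj_on (\<lambda>F. F \<inter> transversal K (C \<union> D)) (side_classes K C)"
proof (rule inj_onI)
  fix F G assume FG: "F \<in> side_classes K C" "G \<in> side_classes K C"
    "F \<inter> transversal K (C \<union> D) = G \<inter> transversal K (C \<union> D)"
  then obtain s where "s \<in> F" "s \<in> G"
    using transversal_Int_nonempty[OF assms FG(1)] by blast
  thus "F = G"
    using side_classes_unique FG(1,2) by blast
qed

text \<open>The point is that \<open>c\<close> in \<open>D\<close> still cuts what remains of its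
  face. On the transversal \<open>C \<union> D\<close> is again a split system, so \<open>c\<close>
  cuts the trace of some face \<open>G\<close> of \<open>C\<close>, hence \<open>G\<close> itself,
  and \<open>G = F\<close> by uniqueness.\<close>

lemma inside_transversal:
  assumes "C \<subseteq> E" "D \<subseteq> E - C" "F \<in> side_classes K C"
  shows "inside (C \<union> D) C (F \<inter> transversal K (C \<union> D)) = D \<inter> inside E C F"
proof -
  let ?T = "transversal K (C \<union> D)"
  have CD: "C \<union> D \<subseteq> E"
    using assms by blast
  interpret T: split_system ?T "C \<union> D"
    by (rule split_system_transversal[OF CD])
  show ?thesis
  proof (intro equalityI subsetI)
    fix c assume "c \<in> inside (C \<union> D) C (F \<inter> ?T)"
    hence "c \<in> D" "c \<notin> C" "cuts c (F \<inter> ?T)"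
      by (auto simp: inside_def)
    thus "c \<in> D \<inter> inside E C F"
      using cuts_mono[of c "F \<inter> ?T" F] assms(2) by (auto simp: inside_def)
  next
    fix c assume c: "c \<in> D \<inter> inside E C F"
    hence c': "c \<in> (C \<union> D) - C" "cuts c F" "c \<in> E"
      by (auto simp: inside_def)
    then obtain G where G: "G \<in> side_classes K C" "cuts c (G \<inter> ?T)"
      using T.ex_cut_class[of C c] unfolding side_classes_transversal[OF assms(1,2)] by blast
    hence "cuts c G"
      using cuts_mono by blast
    hence "G = F"
      using cut_class_unique[OF assms(1) c'(3) G(1) assms(3)] c'(2) by blast
    thus "c \<in> inside (C \<union> D) C (F \<inter> ?T)"
      using G(2) c'(1) unfolding inside_def by blast
  qed
qed

text \<open>This matches the middle tensor factors in coassociativity: q applied after r on one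
  side, r applied in each face after q on the other.\<close>

lemma q_part_transversal:
  assumes "C \<subseteq> E" "D \<subseteq> E - C"
  shows "q_part (transversal K (C \<union> D)) (C \<union> D) C = (\<Prod>F\<in>side_classes K C. r_part F (D \<inter> inside E C F))"
proof -
  let ?T = "transversal K (C \<union> D)"
  have "q_part ?T (C \<union> D) C =
      (\<Prod>F\<in>side_classes K C. contracted (F \<inter> ?T) (inside (C \<union> D) C (F \<inter> ?T)))"
    unfolding q_part_def side_classes_transversal[OF assms]
    by (simp add: prod.reindex[OF inj_on_Int_transversal[OF assms]])
  also have "\<dots> = (\<Prod>F\<in>side_classes K C. r_part F (D \<inter> inside E C F))"
    unfolding r_part_def
    by (intro prod.cong) (simp_all add: inside_transversal[OF assms] transversal_refine_Int[OF assms])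
  finally show ?thesis .
qed

text \<open>The least side of a face of \<open>C\<close> is also least in its class for
  \<open>C \<union> D\<close>, so it is kept in \<open>r_part K (C \<union> D)\<close>. Taking
  minima as representatives is what makes the third tensor factors agree.\<close>

lemma transversal_transversal:
  assumes "C \<subseteq> E" "D \<subseteq> E - C"
  shows "transversal (transversal K (C \<union> D)) C = transversal K C"
proof -
  let ?T = "transversal K (C \<union> D)"
  have "Min (F \<inter> ?T) = Min F" if F: "F \<in> side_classes K C" for F
  proof -
    have fin: "finite F"
      using finite_subset[OF side_classes_subset[OF F] finite_sides] .
    define B where "B = side_class F (D \<inter> inside E C F) (Min F)"
    have B: "B \<in> side_classes F (D \<inter> inside E C F)" "Min F \<in> B"
      using Min_class[OF F] side_class_mem by (auto simp: B_def side_classes_def)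
    have "B \<subseteq> F"
      by (rule side_classes_subset[OF B(1)])
    hence "Min B = Min F"
      using B(2) fin finite_subset by (intro Min_eqI) auto
    hence "Min F \<in> transversal F (D \<inter> inside E C F)"
      using imageI[OF B(1), of Min] by (simp add: transversal_def)
    hence "Min F \<in> F \<inter> ?T"
      using transversal_refine_Int[OF assms F] by blast
    thus ?thesis
      using fin by (intro Min_eqI) auto
  qed
  thus ?thesis
    unfolding transversal_def[of ?T C] side_classes_transversal[OF assms]
    by (simp add: transversal_def[of K C] image_image)
qed

lemma r_part_transversal:
  assumes "C \<subseteq> E" "D \<subseteq> E - C"
  shows "r_part (transversal K (C \<union> D)) C = r_part K C"
  by (simp add: r_part_def transversal_transversal[OF assms])

end

section \<open>Signs under refinement\<close>

lemma neg_one_power_card: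
  assumes "finite A"
  shows "(- 1 :: rat) ^ card {c \<in> A. P c} = (\<Prod>c\<in>A. if P c then - 1 else 1)"
  using assms by (simp add: prod.If_cases Int_def)

context split_system
begin

text \<open>Let \<open>x\<close>, \<open>y\<close>, \<open>z\<close> be the directions in
  \<open>(K, E)\<close>, after keeping \<open>C \<union> D\<close> and after keeping
  \<open>C\<close>. For chords of \<open>C\<close>, comparing \<open>x\<close> with \<open>z\<close>
  splits into \<open>x\<close> with \<open>y\<close> and \<open>y\<close> with \<open>z\<close>; the
  chords of \<open>D\<close> contribute the comparison of \<open>x\<close> with \<open>y\<close> on
  both sides.\<close>

lemma sign_refine:
  assumes "C \<subseteq> E" "D \<subseteq> E - C"
  shows "(- 1 :: rat) ^ k_part K E C *
      (\<Prod>F\<in>side_classes K C. (- 1) ^ k_part F (inside E C F) (D \<inter> inside E C F)) =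
    (- 1) ^ k_part K E (C \<union> D) * (- 1) ^ k_part (transversal K (C \<union> D)) (C \<union> D) C"
proof -
  let ?T = "transversal K (C \<union> D)"
  define x where "x = leaves_min K E"
  define y where "y = leaves_min ?T (C \<union> D)"
  define z where "z = leaves_min (transversal K C) C"
  define s :: "bool \<Rightarrow> bool \<Rightarrow> rat" where "s p q = (if p \<noteq> q then - 1 else 1)" for p q
  have CD: "C \<union> D \<subseteq> E"
    using assms by blast
  have fin: "finite C" "finite D"
    using assms finite_chords finite_subset by blast+
  interpret T: split_system ?T "C \<union> D"
    by (rule split_system_transversal[OF CD])
  \<comment> \<open>Applying \<open>leaves_min_inside\<close> to \<open>E\<close>, and to
    \<open>C \<union> D\<close> on the transversal, replaces directions within a face by directions
    in the surrounding diagram.\<close>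
  have face: "(- 1) ^ k_part F (inside E C F) (D \<inter> inside E C F) = (\<Prod>c\<in>D \<inter> inside E C F. s (x c) (y c))"
    if F: "F \<in> side_classes K C" for F
  proof -
    have FT: "F \<inter> ?T \<in> side_classes ?T C"
      using F side_classes_transversal[OF assms] by blast
    have "leaves_min F (inside E C F) c = x c" if "c \<in> D \<inter> inside E C F" for c
      using leaves_min_inside[OF assms(1) F] that by (simp add: x_def)
    moreover have "leaves_min (transversal F (D \<inter> inside E C F)) (D \<inter> inside E C F) c = y c"
      if "c \<in> D \<inter> inside E C F" for c
      using T.leaves_min_inside[OF _ FT, of c] that
      by (simp add: y_def inside_transversal[OF assms F] transversal_refine_Int[OF assms F])
    ultimately have "k_part F (inside E C F) (D \<inter> inside E C F) = card {c \<in> D \<inter> inside E C F. x c \<noteq> y c}"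
      unfolding k_part_def by (intro arg_cong[of _ _ card]) auto
    thus ?thesis
      using neg_one_power_card[of "D \<inter> inside E C F" "\<lambda>c. x c \<noteq> y c"] fin(2) by (simp add: s_def)
  qed
  have "(\<Prod>F\<in>side_classes K C. (- 1 :: rat) ^ k_part F (inside E C F) (D \<inter> inside E C F)) =
      (\<Prod>F\<in>side_classes K C. \<Prod>c\<in>D \<inter> inside E C F. s (x c) (y c))"
    using face by (rule prod.cong[OF refl])
  also have "\<dots> = (\<Prod>c\<in>(\<Union>F\<in>side_classes K C. D \<inter> inside E C F). s (x c) (y c))"
    using finite_sides fin(2) inside_disjoint[OF assms(1)] by (subst prod.UNION_disjoint) fastforce+
  also have "(\<Union>F\<in>side_classes K C. D \<inter> inside E C F) = D"
    using UN_inside[OF assms(1)] assms(2) by blast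
  finally have faces: "(\<Prod>F\<in>side_classes K C. (- 1 :: rat) ^ k_part F (inside E C F) (D \<inter> inside E C F)) =
      (\<Prod>c\<in>D. s (x c) (y c))" .
  have 1: "(- 1 :: rat) ^ k_part K E C = (\<Prod>c\<in>C. s (x c) (z c))"
    unfolding k_part_def x_def z_def s_def by (rule neg_one_power_card[OF fin(1)])
  have 2: "(- 1 :: rat) ^ k_part K E (C \<union> D) = (\<Prod>c\<in>C \<union> D. s (x c) (y c))"
    unfolding k_part_def x_def y_def s_def using fin by (intro neg_one_power_card) simp
  have 3: "(- 1 :: rat) ^ k_part ?T (C \<union> D) C = (\<Prod>c\<in>C. s (y c) (z c))"
    unfolding k_part_def transversal_transversal[OF assms] y_def z_def s_def
    by (rule neg_one_power_card[OF fin(1)])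
  have "(\<Prod>c\<in>C. s (x c) (z c)) = (\<Prod>c\<in>C. s (x c) (y c)) * (\<Prod>c\<in>C. s (y c) (z c))"
    unfolding prod.distrib[symmetric] by (intro prod.cong) (auto simp: s_def)
  moreover have "(\<Prod>c\<in>C \<union> D. s (x c) (y c)) = (\<Prod>c\<in>C. s (x c) (y c)) * (\<Prod>c\<in>D. s (x c) (y c))"
    using fin assms(2) by (intro prod.union_disjoint) auto
  ultimately show ?thesis
    by (simp add: faces 1 2 3)
qed

end

section \<open>The Hopf algebra of dissection diagrams\<close>

definition weight :: "pos_diagram multiset \<Rightarrow> nat"
  where "weight m = (\<Sum>d\<in>#m. diagram_degree d)"

abbreviation tensor_weight :: "pos_diagram multiset \<times> pos_diagram multiset \<Rightarrow> nat"
  where "tensor_weight \<equiv> \<lambda>(x, y). weight x + weight y"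

lemma weight_add: "weight (x + y) = weight x + weight y"
  by (simp add: weight_def)

lemma tensor_weight_add: "tensor_weight (x + y) = tensor_weight x + tensor_weight y"
  by (simp add: weight_add split: prod.split)

lemma weight_eq_0_iff: "weight m = 0 \<longleftrightarrow> m = 0"
proof -
  have "0 < diagram_degree d" for d
    using Rep_pos_diagram[of d] by (auto simp: diagram_degree_def)
  thus ?thesis
    by (cases m) (auto simp: weight_def)
qed

lemma degree_component_eq: "degree_component = homogeneous weight"
  by (simp add: fun_eq_iff degree_component_def homogeneous_def weight_def)

lemma lookup_diagram_mult:
  "Poly_Mapping.lookup (a * b) 0 = Poly_Mapping.lookup a 0 * Poly_Mapping.lookup (b :: diagram_algebra) 0"
  by (rule lookup_mult_zero) simp

lemma lookup_diagram_prod: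
  "Poly_Mapping.lookup (\<Prod>i\<in>I. a i) 0 = (\<Prod>i\<in>I. Poly_Mapping.lookup (a i :: diagram_algebra) 0)"
  by (induction I rule: infinite_finite_induct) (simp_all add: lookup_diagram_mult)

lemma lookup_diagram_zero: "Poly_Mapping.lookup (diagram n E) 0 = (if n = 0 then 1 else 0)"
  by (simp add: diagram_def lookup_single when_def)

lemma basis_eq_diagram:
  obtains n E where "dissection_diagram n E" "0 < n" "basis {#d#} = diagram n E"
proof -
  obtain n E where nE: "Rep_pos_diagram d = (n, E)"
    by fastforce
  have "dissection_diagram n E" "0 < n"
    using Rep_pos_diagram[of d] nE by auto
  moreover from this have "basis {#d#} = diagram n E"
    using Rep_pos_diagram_inverse[of d] nE by (simp add: diagram_def)
  ultimately show ?thesis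
    using that by blast
qed

lemma dissection_diagram_eq_contracted:
  assumes "dissection_diagram n E"
  shows "split_system {..n} E" "contracted {..n} E = diagram n E" "contract_chords {..n} E = E" "card E = n"
proof -
  show "split_system {..n} E"
    by (rule split_system_dissection) fact
  show "contract_chords {..n} E = E"
    using dissection_diagram_subset[OF assms] by (rule contract_chords_atMost)
  thus "contracted {..n} E = diagram n E" "card E = n"
    using assms by (simp_all add: contracted_def dissection_diagram_def)
qed

text \<open>Every generator is a restricted diagram in which all sides are kept. The test on all
  \<open>contracted K E\<close> has the form in which the results about \<open>split_system\<close>
  are available.\<close>

lemma algebra_hom_eqI:
  fixes f g :: "diagram_algebra \<Rightarrow> ('k::comm_monoid_add \<Rightarrow>\<^sub>0 rat)"
  assumes "algebra_hom f" "algebra_hom g"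
    and "\<And>K E. split_system K E \<Longrightarrow> f (contracted K E) = g (contracted K E)"
  shows "f a = g a"
proof (rule linear_map_eqI[OF algebra_hom_linear[OF assms(1)] algebra_hom_linear[OF assms(2)]])
  fix m
  show "f (basis m) = g (basis m)"
  proof (induction m)
    case empty
    show ?case
      using assms(1,2)[THEN algebra_hom_one] by simp
  next
    case (add d m)
    obtain n E where nE: "dissection_diagram n E" "basis {#d#} = diagram n E"
      using basis_eq_diagram by metis
    have "basis (add_mset d m) = basis {#d#} * basis m"
      by (simp add: mult_single)
    moreover have "f (basis {#d#}) = g (basis {#d#})"
      using assms(3) dissection_diagram_eq_contracted[OF nE(1)] nE(2) by metis
    ultimately show ?case
      using add assms(1,2) by (simp add: algebra_hom_mult)
  qed
qed

lemma coproduct_eq_extend: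
  "coproduct = extend (\<lambda>m. \<Prod>d\<in>#m. case Rep_pos_diagram d of (n, E) \<Rightarrow> diagram_coproduct n E)"
  by (simp add: fun_eq_iff coproduct_def extend_def)

lemma algebra_hom_coproduct: "algebra_hom coproduct"
  unfolding coproduct_eq_extend
  by (rule algebra_homI[OF linear_map_extend]) (simp_all only: extend_basis, simp_all)

text \<open>Faces without chords contribute diagrams of degree 0 to q. As these are identified with
  1, the formula for the coproduct has to give 1 on them.\<close>

lemma diagram_coproduct_zero: "diagram_coproduct 0 {} = 1"
proof -
  have "faces 0 {} = {{0}}"
    by (simp add: faces_eq side_classes_empty)
  thus ?thesis
    by (simp add: diagram_coproduct_def q_op_def r_op_def k_number_def diagram_def tensor_one)
qed

lemma coproduct_diagram:
  assumes "dissection_diagram n E"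
  shows "coproduct (diagram n E) = diagram_coproduct n E"
proof (cases "n = 0")
  case True
  hence "E = {}"
    using assms by (auto simp: dissection_diagram_def)
  thus ?thesis
    using True diagram_coproduct_zero algebra_hom_one[OF algebra_hom_coproduct] by (simp add: diagram_def)
next
  case False
  hence "Rep_pos_diagram (Abs_pos_diagram (n, E)) = (n, E)"
    using assms by (intro Abs_pos_diagram_inverse) simp
  thus ?thesis
    using False by (simp add: diagram_def coproduct_eq_extend)
qed

lemma (in split_system) coproduct_contracted:
  "coproduct (contracted K E) = (\<Sum>C\<in>Pow E. (-1) ^ k_part K E C *\<^sub>s (q_part K E C \<otimes> r_part K C))"
  unfolding contracted_def coproduct_diagram[OF dissection_diagram_contract] diagram_coproduct_contract ..

section \<open>Coassociativity on restricted diagrams\<close>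

lemma prod_scale:
  "(\<Prod>i\<in>I. c i *\<^sub>s a i) = (\<Prod>i\<in>I. c i) *\<^sub>s (\<Prod>i\<in>I. a i)"
  for a :: "'i \<Rightarrow> ('m::comm_monoid_add \<Rightarrow>\<^sub>0 rat)"
  by (induction I rule: infinite_finite_induct) (simp_all add: scale_mult_left scale_mult_right)

text \<open>For disjoint \<open>A i\<close>, choosing a subset of each is the same as choosing one
  subset \<open>D\<close> of their union. Applied to the faces of \<open>C\<close>, this turns
  independent choices of chords into one set of chords disjoint from \<open>C\<close>.\<close>

lemma prod_sum_Pow:
  fixes f :: "'i \<Rightarrow> 'b set \<Rightarrow> 'c::comm_semiring_1"
  assumes "finite I" "\<And>i. i \<in> I \<Longrightarrow> finite (A i)"
    and "\<And>i j. i \<in> I \<Longrightarrow> j \<in> I \<Longrightarrow> i \<noteq> j \<Longrightarrow> A i \<inter> A j = {}"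
  shows "(\<Prod>i\<in>I. \<Sum>X\<in>Pow (A i). f i X) = (\<Sum>D\<in>Pow (\<Union>i\<in>I. A i). \<Prod>i\<in>I. f i (D \<inter> A i))"
  using assms
proof (induction I)
  case empty
  then show ?case by simp
next
  case (insert j I)
  define U where "U = (\<Union>i\<in>I. A i)"
  have disj: "A j \<inter> U = {}"
    using insert.prems(2) insert.hyps by (fastforce simp: U_def)
  have IH: "(\<Prod>i\<in>I. \<Sum>X\<in>Pow (A i). f i X) = (\<Sum>D\<in>Pow U. \<Prod>i\<in>I. f i (D \<inter> A i))"
    unfolding U_def using insert.prems by (intro insert.IH) simp_all
  have "(\<Prod>i\<in>insert j I. \<Sum>X\<in>Pow (A i). f i X) =
      (\<Sum>X\<in>Pow (A j). \<Sum>D\<in>Pow U. f j X * (\<Prod>i\<in>I. f i (D \<inter> A i)))"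
    using insert.hyps by (simp add: IH sum_product)
  also have "\<dots> = (\<Sum>(X, D)\<in>Pow (A j) \<times> Pow U. f j X * (\<Prod>i\<in>I. f i (D \<inter> A i)))"
    by (rule sum.cartesian_product)
  also have "\<dots> = (\<Sum>D\<in>Pow (A j \<union> U). f j (D \<inter> A j) * (\<Prod>i\<in>I. f i (D \<inter> A i)))"
  proof (rule sum.reindex_bij_witness[of _ "\<lambda>D. (D \<inter> A j, D \<inter> U)" "\<lambda>(X, D). X \<union> D"], goal_cases)
    case (5 XD)
    then obtain X D where XD: "XD = (X, D)" "X \<subseteq> A j" "D \<subseteq> U"
      by auto
    have "(X \<union> D) \<inter> A j = X"
      using XD disj by blast
    moreover have "(X \<union> D) \<inter> A i = D \<inter> A i" if "i \<in> I" for i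
      using XD disj that unfolding U_def by blast
    ultimately show ?case
      by (simp add: XD(1))
  qed (use disj in auto)
  also have "\<dots> = (\<Sum>D\<in>Pow (\<Union>i\<in>insert j I. A i). \<Prod>i\<in>insert j I. f i (D \<inter> A i))"
    using insert.hyps by (simp add: U_def)
  finally show ?case .
qed

context split_system
begin

lemma coproduct_q_part:
  assumes "C \<subseteq> E"
  shows "coproduct (q_part K E C) =
    (\<Sum>D\<in>Pow (E - C). (\<Prod>F\<in>side_classes K C. (-1) ^ k_part F (inside E C F) (D \<inter> inside E C F)) *\<^sub>s
      (q_part K E (C \<union> D) \<otimes> q_part (transversal K (C \<union> D)) (C \<union> D) C))"
proof -
  have "coproduct (q_part K E C) = (\<Prod>F\<in>side_classes K C. coproduct (contracted F (inside E C F)))"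
    unfolding q_part_def by (rule algebra_hom_prod[OF algebra_hom_coproduct])
  also have "\<dots> = (\<Prod>F\<in>side_classes K C. \<Sum>X\<in>Pow (inside E C F).
      (-1) ^ k_part F (inside E C F) X *\<^sub>s (q_part F (inside E C F) X \<otimes> r_part F X))"
    by (intro prod.cong refl split_system.coproduct_contracted split_system_inside[OF assms])
  also have "\<dots> = (\<Sum>D\<in>Pow (E - C). \<Prod>F\<in>side_classes K C.
      (-1) ^ k_part F (inside E C F) (D \<inter> inside E C F) *\<^sub>s
        (q_part F (inside E C F) (D \<inter> inside E C F) \<otimes> r_part F (D \<inter> inside E C F)))"
    using finite_sides finite_inside inside_disjoint[OF assms]
    by (subst prod_sum_Pow) (simp_all add: UN_inside[OF assms])
  also have "\<dots> = (\<Sum>D\<in>Pow (E - C).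
      (\<Prod>F\<in>side_classes K C. (-1) ^ k_part F (inside E C F) (D \<inter> inside E C F)) *\<^sub>s
      (q_part K E (C \<union> D) \<otimes> q_part (transversal K (C \<union> D)) (C \<union> D) C))"
    by (intro sum.cong refl)
      (simp add: prod_scale tensor_prod q_part_refine[OF assms] q_part_transversal[OF assms])
  finally show ?thesis .
qed

lemma coassoc_contracted:
  "tensor_assoc (tensor_map coproduct id (coproduct (contracted K E))) =
    tensor_map id coproduct (coproduct (contracted K E))"
proof -
  let ?T = "\<lambda>C'. transversal K C'"
  \<comment> \<open>Both sides expand into these triple tensors, indexed by the pairs with
    \<open>C \<subseteq> C'\<close>: the left one with \<open>C' = C \<union> D\<close>, the right
    one with \<open>C\<close> chosen among the chords of \<open>r_part K C'\<close>.\<close>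
  define summand where "summand C' C = ((-1) ^ k_part K E C' * (-1) ^ k_part (?T C') C' C) *\<^sub>s
    (q_part K E C' \<otimes> (q_part (?T C') C' C \<otimes> r_part (?T C') C))" for C' C
  note lin = algebra_hom_linear[OF algebra_hom_coproduct]
  have fin: "finite C" if "C \<subseteq> E" for C
    using that finite_chords finite_subset by blast
  have left: "tensor_assoc (tensor_map coproduct id (q_part K E C \<otimes> r_part K C)) =
      (\<Sum>D\<in>Pow (E - C). (\<Prod>F\<in>side_classes K C. (-1) ^ k_part F (inside E C F) (D \<inter> inside E C F)) *\<^sub>s
        (q_part K E (C \<union> D) \<otimes> (q_part (?T (C \<union> D)) (C \<union> D) C \<otimes> r_part K C)))"
    if "C \<subseteq> E" for C
    by (simp add: tensor_map_tensor lin linear_map_id coproduct_q_part[OF that]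
        linear_map_sum[OF linear_map_tensor_left] linear_map_scale[OF linear_map_tensor_left]
        linear_map_sum[OF linear_map_tensor_assoc] linear_map_scale[OF linear_map_tensor_assoc]
        tensor_assoc_tensor)
  have "tensor_assoc (tensor_map coproduct id (coproduct (contracted K E))) =
      (\<Sum>C\<in>Pow E. (-1) ^ k_part K E C *\<^sub>s
        tensor_assoc (tensor_map coproduct id (q_part K E C \<otimes> r_part K C)))"
    by (simp add: coproduct_contracted linear_map_sum[OF linear_map_tensor_map]
        linear_map_scale[OF linear_map_tensor_map]
        linear_map_sum[OF linear_map_tensor_assoc] linear_map_scale[OF linear_map_tensor_assoc])
  also have "\<dots> = (\<Sum>C\<in>Pow E. \<Sum>D\<in>Pow (E - C). summand (C \<union> D) C)"
  proof (rule sum.cong[OF refl])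
    fix C assume "C \<in> Pow E"
    hence C: "C \<subseteq> E"
      by simp
    show "(-1) ^ k_part K E C *\<^sub>s tensor_assoc (tensor_map coproduct id (q_part K E C \<otimes> r_part K C)) =
        (\<Sum>D\<in>Pow (E - C). summand (C \<union> D) C)"
      unfolding left[OF C] scale.scale_sum_right scale.scale_scale
    proof (rule sum.cong[OF refl])
      fix D assume "D \<in> Pow (E - C)"
      hence D: "D \<subseteq> E - C"
        by simp
      show "((-1) ^ k_part K E C *
          (\<Prod>F\<in>side_classes K C. (-1) ^ k_part F (inside E C F) (D \<inter> inside E C F))) *\<^sub>s
          (q_part K E (C \<union> D) \<otimes> (q_part (?T (C \<union> D)) (C \<union> D) C \<otimes> r_part K C)) = summand (C \<union> D) C"
        unfolding sign_refine[OF C D] summand_def r_part_transversal[OF C D] ..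
    qed
  qed
  also have "\<dots> = (\<Sum>(C, D)\<in>Sigma (Pow E) (\<lambda>C. Pow (E - C)). summand (C \<union> D) C)"
    using finite_chords by (intro sum.Sigma) auto
  also have "\<dots> = (\<Sum>(C', C)\<in>Sigma (Pow E) Pow. summand C' C)"
    by (rule sum.reindex_bij_witness[of _ "\<lambda>(C', C). (C, C' - C)" "\<lambda>(C, D). (C \<union> D, C)"])
      (auto simp: Un_absorb1)
  also have "\<dots> = (\<Sum>C'\<in>Pow E. \<Sum>C\<in>Pow C'. summand C' C)"
    using finite_chords fin by (intro sum.Sigma[symmetric]) auto
  also have "\<dots> = (\<Sum>C'\<in>Pow E. (-1) ^ k_part K E C' *\<^sub>s
      tensor_map id coproduct (q_part K E C' \<otimes> r_part K C'))"
  proof (rule sum.cong[OF refl])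
    fix C' assume "C' \<in> Pow E"
    hence "split_system (?T C') C'"
      using split_system_transversal by simp
    thus "(\<Sum>C\<in>Pow C'. summand C' C) =
        (-1) ^ k_part K E C' *\<^sub>s tensor_map id coproduct (q_part K E C' \<otimes> r_part K C')"
      by (simp add: summand_def tensor_map_tensor lin linear_map_id r_part_def[of K]
          split_system.coproduct_contracted linear_map_sum[OF linear_map_tensor_right]
          linear_map_scale[OF linear_map_tensor_right] scale.scale_sum_right)
  qed
  also have "\<dots> = tensor_map id coproduct (coproduct (contracted K E))"
    by (simp add: coproduct_contracted linear_map_sum[OF linear_map_tensor_map]
        linear_map_scale[OF linear_map_tensor_map])
  finally show ?thesis .
qed

section \<open>Counit and grading on diagrams\<close>

lemma lookup_contracted_zero: "Poly_Mapping.lookup (contracted K E) 0 = (if E = {} then 1 else 0)"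
  using finite_chords by (simp add: contracted_def lookup_diagram_zero)

text \<open>A face contributes a nonzero coefficient only if it has no chord inside, and together
  the faces contain all of \<open>E - C\<close>.\<close>

lemma lookup_q_part_zero:
  assumes "C \<subseteq> E"
  shows "Poly_Mapping.lookup (q_part K E C) 0 = (if C = E then 1 else 0)"
proof -
  have "Poly_Mapping.lookup (q_part K E C) 0 =
      (\<Prod>F\<in>side_classes K C. if inside E C F = {} then 1 else 0)"
    unfolding q_part_def lookup_diagram_prod
    by (intro prod.cong refl split_system.lookup_contracted_zero split_system_inside[OF assms])
  also have "\<dots> = (if C = E then 1 else 0)"
  proof (cases "C = E")
    case True
    then show ?thesis
      by (simp add: inside_def)
  next
    case False
    then obtain F where "F \<in> side_classes K C" "inside E C F \<noteq> {}"
      using UN_inside[OF assms] assms by blast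
    then show ?thesis
      using False finite_sides by (auto simp: prod_zero_iff)
  qed
  finally show ?thesis .
qed

lemma q_part_empty: "q_part K E {} = contracted K E"
proof -
  have "inside E {} K = E"
    using cuts_sides by (auto simp: inside_def)
  thus ?thesis
    by (simp add: q_part_def side_classes_empty[OF sides_nonempty])
qed

lemma transversal_all: "transversal K E = K"
proof -
  have "side_classes K E = (\<lambda>s. {s}) ` K"
    by (rule side_classes_singletons) (rule separated)
  thus ?thesis
    by (simp add: transversal_def image_image)
qed

lemma coproduct_contracted_homogeneous:
  "coproduct (contracted K E) \<in> homogeneous tensor_weight (card E)"
  unfolding coproduct_contracted
proof (intro scale.subspace_sum scale.subspace_scale homogeneous_subspace)
  fix C assume "C \<in> Pow E"
  hence C: "C \<subseteq> E"
    by simp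
  have hom: "contracted L G \<in> homogeneous weight (card G)" if "split_system L G" for L G
  proof -
    have "dissection_diagram (card G) (contract_chords L G)"
      by (rule split_system.dissection_diagram_contract) fact
    thus ?thesis
      by (auto simp: contracted_def diagram_def homogeneous_def weight_def diagram_degree_def
          Abs_pos_diagram_inverse)
  qed
  have "q_part K E C \<in> homogeneous weight (\<Sum>F\<in>side_classes K C. card (inside E C F))"
    unfolding q_part_def
    by (intro homogeneous_prod weight_add hom split_system_inside[OF C])
  also have "(\<Sum>F\<in>side_classes K C. card (inside E C F)) = card (\<Union>F\<in>side_classes K C. inside E C F)"
    using inside_disjoint[OF C] finite_inside finite_sides by (subst card_UN_disjoint) auto
  also have "\<dots> = card E - card C"
    using C finite_chords by (simp add: UN_inside card_Diff_subset finite_subset)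
  finally have "q_part K E C \<in> homogeneous weight (card E - card C)" .
  moreover have "r_part K C \<in> homogeneous weight (card C)"
    unfolding r_part_def by (intro hom split_system_transversal[OF C])
  ultimately have "q_part K E C \<otimes> r_part K C \<in> homogeneous tensor_weight (card E - card C + card C)"
    by (rule homogeneous_tensor)
  thus "q_part K E C \<otimes> r_part K C \<in> homogeneous tensor_weight (card E)"
    using card_mono[OF finite_chords C] by simp
qed

lemma counit_left_contracted:
  "tensor_lift (\<lambda>b c. Poly_Mapping.lookup b 0 *\<^sub>s c) (coproduct (contracted K E)) = contracted K E"
proof -
  have lift: "tensor_lift (\<lambda>b c. Poly_Mapping.lookup b 0 *\<^sub>s c) (a \<otimes> b) = Poly_Mapping.lookup a 0 *\<^sub>s b"
    for a b :: diagram_algebra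
    by (rule tensor_lift_tensor)
      (auto intro!: linear_mapI simp: lookup_add scale.scale_left_distrib scale.scale_right_distrib mult.commute)
  have "tensor_lift (\<lambda>b c. Poly_Mapping.lookup b 0 *\<^sub>s c) (coproduct (contracted K E)) =
      (\<Sum>C\<in>Pow E. (-1) ^ k_part K E C *\<^sub>s Poly_Mapping.lookup (q_part K E C) 0 *\<^sub>s r_part K C)"
    by (simp add: coproduct_contracted linear_map_sum[OF linear_map_tensor_lift]
        linear_map_scale[OF linear_map_tensor_lift] lift)
  also have "\<dots> = (\<Sum>C\<in>Pow E. if C = E then (-1) ^ k_part K E C *\<^sub>s r_part K C else 0)"
    by (intro sum.cong) (auto simp: lookup_q_part_zero)
  also have "\<dots> = (-1) ^ k_part K E E *\<^sub>s r_part K E"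
    using finite_chords by simp
  \<comment> \<open>For \<open>C = E\<close> all classes are singletons, so nothing is contracted in
    \<open>r_part K E\<close>, no chord is reversed and the exponent is 0.\<close>
  also have "\<dots> = contracted K E"
    by (simp add: k_part_def r_part_def transversal_all)
  finally show ?thesis .
qed

lemma counit_right_contracted:
  "tensor_lift (\<lambda>b c. Poly_Mapping.lookup c 0 *\<^sub>s b) (coproduct (contracted K E)) = contracted K E"
proof -
  have lift: "tensor_lift (\<lambda>b c. Poly_Mapping.lookup c 0 *\<^sub>s b) (a \<otimes> b) = Poly_Mapping.lookup b 0 *\<^sub>s a"
    for a b :: diagram_algebra
    by (rule tensor_lift_tensor)
      (auto intro!: linear_mapI simp: lookup_add scale.scale_left_distrib scale.scale_right_distrib mult.commute)
  have r: "Poly_Mapping.lookup (r_part K C) 0 = (if C = {} then 1 else 0)" if "C \<subseteq> E" for C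
    unfolding r_part_def by (rule split_system.lookup_contracted_zero[OF split_system_transversal[OF that]])
  have "tensor_lift (\<lambda>b c. Poly_Mapping.lookup c 0 *\<^sub>s b) (coproduct (contracted K E)) =
      (\<Sum>C\<in>Pow E. (-1) ^ k_part K E C *\<^sub>s Poly_Mapping.lookup (r_part K C) 0 *\<^sub>s q_part K E C)"
    by (simp add: coproduct_contracted linear_map_sum[OF linear_map_tensor_lift]
        linear_map_scale[OF linear_map_tensor_lift] lift)
  also have "\<dots> = (\<Sum>C\<in>Pow E. if C = {} then (-1) ^ k_part K E C *\<^sub>s q_part K E C else 0)"
    by (intro sum.cong) (auto simp: r)
  also have "\<dots> = (-1) ^ k_part K E {} *\<^sub>s q_part K E {}"
    using finite_chords by simp
  also have "\<dots> = contracted K E"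
    by (simp add: k_part_def q_part_empty)
  finally show ?thesis .
qed

end

lemma coproduct_basis_homogeneous: "coproduct (basis m) \<in> homogeneous tensor_weight (weight m)"
proof (induction m)
  case empty
  show ?case
    using homogeneous_one[of tensor_weight, OF tensor_weight_add] algebra_hom_one[OF algebra_hom_coproduct]
    by (simp add: weight_def)
next
  case (add d m)
  obtain n E where nE: "dissection_diagram n E" "0 < n" "basis {#d#} = diagram n E"
    using basis_eq_diagram by metis
  note E = dissection_diagram_eq_contracted[OF nE(1)]
  have "coproduct (basis {#d#}) \<in> homogeneous tensor_weight n"
    using split_system.coproduct_contracted_homogeneous[OF E(1)] E nE(3) by simp
  hence "coproduct (basis {#d#} * basis m) \<in> homogeneous tensor_weight (n + weight m)"
    using homogeneous_mult[of tensor_weight, OF tensor_weight_add _ add]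
    by (simp only: algebra_hom_mult[OF algebra_hom_coproduct])
  \<comment> \<open>\<open>basis_eq_diagram\<close> leaves the representation of \<open>d\<close>
    implicit; comparing the keys of the two basis elements recovers it.\<close>
  moreover have "{#d#} = {#Abs_pos_diagram (n, E)#}"
    using nE(2) arg_cong[OF nE(3), of Poly_Mapping.keys] by (simp add: diagram_def)
  hence "diagram_degree d = n"
    using nE(1,2) by (simp add: diagram_degree_def Abs_pos_diagram_inverse)
  ultimately show ?case
    by (simp add: mult_single weight_def)
qed

lemma algebra_hom_counit_left:
  "algebra_hom (tensor_lift (\<lambda>b c. Poly_Mapping.lookup b 0 *\<^sub>s c) :: diagram_algebra_tensor \<Rightarrow> diagram_algebra)"
proof (rule algebra_homI[OF linear_map_tensor_lift])
  fix x y :: "pos_diagram multiset \<times> pos_diagram multiset"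
  show "tensor_lift (\<lambda>b c. Poly_Mapping.lookup b 0 *\<^sub>s c) (basis (x + y)) =
      tensor_lift (\<lambda>b c. Poly_Mapping.lookup b 0 *\<^sub>s c) (basis x) *
      tensor_lift (\<lambda>b c. Poly_Mapping.lookup b 0 *\<^sub>s c) (basis y)"
    by (cases x; cases y) (auto simp: lookup_single when_def mult_single)
qed (simp add: zero_prod_def del: single_one, simp)

lemma algebra_hom_counit_right:
  "algebra_hom (tensor_lift (\<lambda>b c. Poly_Mapping.lookup c 0 *\<^sub>s b) :: diagram_algebra_tensor \<Rightarrow> diagram_algebra)"
proof (rule algebra_homI[OF linear_map_tensor_lift])
  fix x y :: "pos_diagram multiset \<times> pos_diagram multiset"
  show "tensor_lift (\<lambda>b c. Poly_Mapping.lookup c 0 *\<^sub>s b) (basis (x + y)) =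
      tensor_lift (\<lambda>b c. Poly_Mapping.lookup c 0 *\<^sub>s b) (basis x) *
      tensor_lift (\<lambda>b c. Poly_Mapping.lookup c 0 *\<^sub>s b) (basis y)"
    by (cases x; cases y) (auto simp: lookup_single when_def mult_single)
qed (simp add: zero_prod_def del: single_one, simp)

text \<open>Both sides of coassociativity and of the counit laws are algebra morphisms, so comparing
  them on diagrams suffices.\<close>

interpretation coproduct: connected_bialgebra coproduct weight
proof
  show "algebra_hom coproduct"
    by (rule algebra_hom_coproduct)
  show "tensor_assoc (tensor_map coproduct id (coproduct a)) = tensor_map id coproduct (coproduct a)" for a
    by (rule algebra_hom_eqI[of "\<lambda>a. tensor_assoc (tensor_map coproduct id (coproduct a))"])
      (intro algebra_hom_comp[OF algebra_hom_tensor_assoc] algebra_hom_comp[OF algebra_hom_tensor_map]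
        algebra_hom_coproduct algebra_hom_id split_system.coassoc_contracted | assumption)+
  show "tensor_lift (\<lambda>b c. Poly_Mapping.lookup b 0 *\<^sub>s c) (coproduct a) = a" for a
    using algebra_hom_eqI[OF algebra_hom_comp[OF algebra_hom_counit_left algebra_hom_coproduct]
        algebra_hom_id, of a] split_system.counit_left_contracted by simp
  show "tensor_lift (\<lambda>b c. Poly_Mapping.lookup c 0 *\<^sub>s b) (coproduct a) = a" for a
    using algebra_hom_eqI[OF algebra_hom_comp[OF algebra_hom_counit_right algebra_hom_coproduct]
        algebra_hom_id, of a] split_system.counit_right_contracted by simp
  show "weight y + weight z = weight x" if "(y, z) \<in> Poly_Mapping.keys (coproduct (basis x))" for x y z
    using coproduct_basis_homogeneous[of x] that by (auto simp: homogeneous_def)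
qed (rule weight_add weight_eq_0_iff)+

theorem proposition2p11:
  shows "(\<forall>n E. dissection_diagram n E \<longrightarrow>
            coproduct (diagram n E) =
              (\<Sum>C\<in>Pow E. (-1) ^ k_number n E C *\<^sub>s (q_op n E C \<otimes> r_op n C))) \<and>
         (\<exists>\<epsilon> S. graded_connected_commutative_hopf_algebra coproduct \<epsilon> S degree_component)"
proof (intro conjI allI impI)
  show "coproduct (diagram n E) = (\<Sum>C\<in>Pow E. (-1) ^ k_number n E C *\<^sub>s (q_op n E C \<otimes> r_op n C))"
    if "dissection_diagram n E" for n E
    using coproduct_diagram[OF that] by (simp add: diagram_coproduct_def)
  show "\<exists>\<epsilon> S. graded_connected_commutative_hopf_algebra coproduct \<epsilon> S degree_component"
    using coproduct.graded_connected_hopf_algebra unfolding degree_component_eq by blast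
qed

end
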